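(* There exists a constant $c_1>0$ such that the following holds. Let $H$ be any $N\times k$ harmonic frame, and let $F$ be an $m\times k$ matrix whose rows are chosen independently and uniformly at random from the rows of $H$ (with replacement). For any $\eta,\epsilon>0$ and any integers $l$, $m$ satisfying $m/\pi^2\geq l\geq \frac{c_1}{\eta^2}k\log^3(m/\epsilon)$, $$P\big(\sigma_{\min}(V_l^TF)\leq(1-\eta)\sqrt l\big)<\epsilon.$$ If in addition $H$ does not contain the all-ones column, then also $$P\big(\sigma_{\max}(V_l^TF)\geq(1+\eta)\sqrt l\big)<\epsilon.$$
   Context: An $N\times k$ harmonic frame is a matrix $H(j,s)=e^{2\pi i\,\omega(s)\,j/N}$, $j=1,\dots,N$, $s=1,\dots,k$, for some $\omega=\{\omega(1),\dots,\omega(k)\}\subseteq\{1,\dots,N\}$. $D$ is the $m\times m$ first-order difference matrix with ones on the main diagonal, $-1$ on the first subdiagonal and zeros elsewhere. If $USV^T$ is the singular value decomposition of $D^{-1}$ (singular values in decreasing order), $V_l$ denotes the $m\times l$ matrix of the first $l$ columns of $V$ (the first $l$ right singular vectors of $D^{-1}$). $\sigma_{\min},\sigma_{\max}$ denote smallest and largest singular values. *)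

theory Defs
  imports Complex_Main "HOL-Library.FuncSet"
begin

text \<open>Matrices are functions nat \<Rightarrow> nat \<Rightarrow> 'a, indexed from 1 as in the paper;
  dimensions are carried explicitly.\<close>

definition harmonic_frame :: "nat \<Rightarrow> (nat \<Rightarrow> nat) \<Rightarrow> nat \<Rightarrow> nat \<Rightarrow> complex" where
  "harmonic_frame N \<omega> j s = exp (2 * of_real pi * \<i> * of_nat (\<omega> s) * of_nat j / of_nat N)"

definition diff_mat :: "nat \<Rightarrow> nat \<Rightarrow> real" where
  "diff_mat i j = (if i = j then 1 else if i = j + 1 then -1 else 0)"

definition mmul :: "nat \<Rightarrow> (nat \<Rightarrow> nat \<Rightarrow> real) \<Rightarrow> (nat \<Rightarrow> nat \<Rightarrow> real) \<Rightarrow> nat \<Rightarrow> nat \<Rightarrow> real" where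
  "mmul n A B i j = (\<Sum>t=1..n. A i t * B t j)"

definition transp_mat :: "(nat \<Rightarrow> nat \<Rightarrow> real) \<Rightarrow> nat \<Rightarrow> nat \<Rightarrow> real" where
  "transp_mat A i j = A j i"

definition id_mat :: "nat \<Rightarrow> nat \<Rightarrow> real" where
  "id_mat i j = (if i = j then 1 else 0)"

definition is_svd_of_Dinv :: "nat \<Rightarrow> (nat \<Rightarrow> nat \<Rightarrow> real) \<Rightarrow> (nat \<Rightarrow> nat \<Rightarrow> real)
    \<Rightarrow> (nat \<Rightarrow> nat \<Rightarrow> real) \<Rightarrow> bool" where
  "is_svd_of_Dinv m U S V \<longleftrightarrow>
     (\<forall>i\<in>{1..m}. \<forall>j\<in>{1..m}. mmul m (transp_mat U) U i j = id_mat i j) \<and>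
     (\<forall>i\<in>{1..m}. \<forall>j\<in>{1..m}. mmul m (transp_mat V) V i j = id_mat i j) \<and>
     (\<forall>i\<in>{1..m}. \<forall>j\<in>{1..m}. i \<noteq> j \<longrightarrow> S i j = 0) \<and>
     (\<forall>i\<in>{1..m}. S i i \<ge> 0) \<and>
     (\<forall>i\<in>{1..m}. \<forall>j\<in>{1..m}. i \<le> j \<longrightarrow> S j j \<le> S i i) \<and>
     (\<forall>i\<in>{1..m}. \<forall>j\<in>{1..m}.
        mmul m diff_mat (mmul m (mmul m U S) (transp_mat V)) i j = id_mat i j)"

definition cnorm :: "nat \<Rightarrow> (nat \<Rightarrow> complex) \<Rightarrow> real" where
  "cnorm n x = sqrt (\<Sum>i=1..n. (cmod (x i))\<^sup>2)"

definition cmat_vec :: "nat \<Rightarrow> (nat \<Rightarrow> nat \<Rightarrow> complex) \<Rightarrow> (nat \<Rightarrow> complex) \<Rightarrow> nat \<Rightarrow> complex" where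
  "cmat_vec k A x a = (\<Sum>s=1..k. A a s * x s)"

definition cadjoint :: "(nat \<Rightarrow> nat \<Rightarrow> complex) \<Rightarrow> nat \<Rightarrow> nat \<Rightarrow> complex" where
  "cadjoint A i j = cnj (A j i)"

definition sigma_max :: "nat \<Rightarrow> nat \<Rightarrow> (nat \<Rightarrow> nat \<Rightarrow> complex) \<Rightarrow> real" where
  "sigma_max l k A = Sup {cnorm l (cmat_vec k A x) | x. cnorm k x = 1}"

text \<open>Smallest singular value (the min(l,k)-th singular value) of an l x k complex matrix.\<close>
definition sigma_min :: "nat \<Rightarrow> nat \<Rightarrow> (nat \<Rightarrow> nat \<Rightarrow> complex) \<Rightarrow> real" where
  "sigma_min l k A =
     (if k \<le> l then Inf {cnorm l (cmat_vec k A x) | x. cnorm k x = 1}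
      else Inf {cnorm k (cmat_vec l (cadjoint A) y) | y. cnorm l y = 1})"

definition VlT_F :: "nat \<Rightarrow> (nat \<Rightarrow> nat \<Rightarrow> real) \<Rightarrow> (nat \<Rightarrow> nat \<Rightarrow> complex) \<Rightarrow> (nat \<Rightarrow> nat)
    \<Rightarrow> nat \<Rightarrow> nat \<Rightarrow> complex" where
  "VlT_F m V H J a s = (\<Sum>r=1..m. of_real (V r a) * H (J r) s)"

definition row_sample_prob :: "nat \<Rightarrow> nat \<Rightarrow> ((nat \<Rightarrow> nat) \<Rightarrow> bool) \<Rightarrow> real" where
  "row_sample_prob N m P = real (card {J \<in> {1..m} \<rightarrow>\<^sub>E {1..N}. P J}) / real N ^ m"

end

theory Submission
  imports Defs "HOL-Analysis.Complex_Transcendental"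
begin

text \<open>Write \<open>M = V\<^sub>l\<^sup>T F\<close>, \<open>P = V\<^sub>l V\<^sub>l\<^sup>T\<close> and let \<open>u\<^sub>1, \<dots>, u\<^sub>m\<close> be the conjugated sampled rows,
  restricted to the non-constant columns. On those columns \<open>M\<^sup>* M - l = Y + Z\<close> with a diagonal part
  \<open>Y = \<Sum> P\<^sub>r\<^sub>r (u\<^sub>r u\<^sub>r\<^sup>* - 1)\<close> and a chaos \<open>Z = \<Sum> P\<^sub>r\<^sub>q u\<^sub>r u\<^sub>q\<^sup>*\<close> over \<open>r \<noteq> q\<close>. Both are bounded
  through the moments \<open>E tr X\<^sup>2\<^sup>p\<close> with \<open>p\<close> of order \<open>log (m / \<epsilon>)\<close>. Resampling the row \<open>r\<close> gives an exchangeable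
  pair \<open>(X, X')\<close>, and the differences \<open>X - X'\<close> average to a multiple of \<open>X\<close>. A mean value inequality for
  \<open>tr (X - X') (X\<^sup>2\<^sup>n\<^sup>+\<^sup>1 - X'\<^sup>2\<^sup>n\<^sup>+\<^sup>1)\<close> then bounds the moment of order \<open>2n + 2\<close> by that of order \<open>2n\<close>.
  For the chaos, \<open>X - X'\<close> contains the vectors \<open>h\<^sub>r = \<Sum> P\<^sub>r\<^sub>q u\<^sub>q\<close> over \<open>q \<noteq> r\<close>; these, and the norm of \<open>F\<close>, are
  controlled outside an event so unlikely that trivial bounds suffice on it.

  On the non-constant columns the singular vectors enter only through
  \<open>V\<^sub>i\<^sub>a\<^sup>2 \<le> 4 / (2m + 1)\<close>, which yields \<open>P\<^sub>r\<^sub>r \<le> 2l / m\<close>. A constant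
  column contributes the deterministic vector \<open>V\<^sub>l\<^sup>T 1\<close>, whose squared norm is at least \<open>2l\<close> and whose inner products
  with the other columns are subgaussian, so it does not lower the smallest singular value.\<close>

section \<open>Hermitian matrices over a finite index set\<close>

text \<open>The third power of the logarithm is a count of factors \<open>p\<close>. Each step of
  the moment recursion costs one factor \<open>p\<close> through the trace inequality, and
  \<open>nv (h J r)\<close> has size \<open>k p^2 d\<close>, because its tails are needed at order
  \<open>4 p^2\<close>. With \<open>d m = 2 l\<close> the variance proxy of the chaos is of order
  \<open>k p^3 l\<close>. Its square root has to stay below a fraction of \<open>\<eta> l\<close>,
  which is the condition \<open>l \<ge> C k p^3 / \<eta>^2\<close>.

  The obstacle is that the vectors \<open>h J r\<close> depend on the sample. Conditioning on a good
  event would break the exchangeability of the pair, so the event enters only afterwards, as an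
  indicator inside the expectation. Both recursions close for the same reason: the sums of
  \<open>nv (av W (u (J r)))\<close> and of \<open>nv (av W (h J r))\<close> can be expressed by the
  matrix under study. The odd moment that appears is split between its two even neighbours, and half
  of the higher one is absorbed on the left.

  Even moments are kept as Hilbert-Schmidt norms of powers, which makes them visibly nonnegative and
  avoids eigenvalues altogether.\<close>

lemma cmod_add_sq_le: "(cmod (a + b))\<^sup>2 \<le> 2 * (cmod a)\<^sup>2 + 2 * (cmod b)\<^sup>2"
proof -
  have "(cmod (a + b))\<^sup>2 \<le> (cmod a + cmod b)\<^sup>2"
    by (intro power_mono norm_triangle_ineq) auto
  also have "\<dots> \<le> 2 * (cmod a)\<^sup>2 + 2 * (cmod b)\<^sup>2"
    using zero_le_power2[of "cmod a - cmod b"] by (simp add: power2_eq_square algebra_simps)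
  finally show ?thesis .
qed

lemma cmod_diff_sq_le: "(cmod (a - b))\<^sup>2 \<le> 2 * (cmod a)\<^sup>2 + 2 * (cmod b)\<^sup>2"
  using cmod_add_sq_le[of a "- b"] by simp

lemma cmod_sum_mult_sq_le:
  "(cmod (\<Sum>i\<in>R. a i * b i))\<^sup>2 \<le> (\<Sum>i\<in>R. (cmod (a i))\<^sup>2) * (\<Sum>i\<in>R. (cmod (b i))\<^sup>2)"
proof -
  have "cmod (\<Sum>i\<in>R. a i * b i) \<le> (\<Sum>i\<in>R. cmod (a i) * cmod (b i))"
    by (rule order_trans[OF norm_sum]) (simp add: norm_mult)
  then have "(cmod (\<Sum>i\<in>R. a i * b i))\<^sup>2 \<le> (\<Sum>i\<in>R. cmod (a i) * cmod (b i))\<^sup>2"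
    by (intro power_mono) auto
  also have "\<dots> \<le> (\<Sum>i\<in>R. (cmod (a i))\<^sup>2) * (\<Sum>i\<in>R. (cmod (b i))\<^sup>2)"
    by (rule Cauchy_Schwarz_ineq_sum)
  finally show ?thesis .
qed

type_synonym cmat = "nat \<Rightarrow> nat \<Rightarrow> complex"

locale index_set =
  fixes K :: "nat set"
  assumes finite_K: "finite K"
begin

definition mm :: "cmat \<Rightarrow> cmat \<Rightarrow> cmat" where
  "mm A B i j = (\<Sum>t\<in>K. A i t * B t j)"

definition ip :: "cmat \<Rightarrow> cmat \<Rightarrow> real" where
  "ip A B = (\<Sum>i\<in>K. \<Sum>j\<in>K. Re (A i j * cnj (B i j)))"

abbreviation hs :: "cmat \<Rightarrow> real" where
  "hs A \<equiv> ip A A"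

definition eye :: cmat where
  "eye i j = (if i = j \<and> i \<in> K then 1 else 0)"

primrec pw :: "cmat \<Rightarrow> nat \<Rightarrow> cmat" where
  "pw A 0 = eye"
| "pw A (Suc n) = mm A (pw A n)"

text \<open>Requiring support in \<open>K \<times> K\<close> makes \<open>eye\<close> a genuine unit for Hermitian matrices.\<close>

definition herm :: "cmat \<Rightarrow> bool" where
  "herm A \<longleftrightarrow> (\<forall>i j. A j i = cnj (A i j)) \<and> (\<forall>i j. i \<notin> K \<longrightarrow> A i j = 0)"

definition av :: "cmat \<Rightarrow> (nat \<Rightarrow> complex) \<Rightarrow> nat \<Rightarrow> complex" where
  "av A v i = (\<Sum>t\<in>K. A i t * v t)"

definition nv :: "(nat \<Rightarrow> complex) \<Rightarrow> real" where
  "nv v = (\<Sum>i\<in>K. (cmod (v i))\<^sup>2)"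

definition outer :: "(nat \<Rightarrow> complex) \<Rightarrow> (nat \<Rightarrow> complex) \<Rightarrow> cmat" where
  "outer a b i j = a i * cnj (b j)"

lemma hermD: "herm A \<Longrightarrow> A j i = cnj (A i j)"
  unfolding herm_def by blast

lemma herm_supp1: "herm A \<Longrightarrow> i \<notin> K \<Longrightarrow> A i j = 0"
  unfolding herm_def by blast

lemma hermI:
  "(\<And>i j. A j i = cnj (A i j)) \<Longrightarrow> (\<And>i j. i \<notin> K \<Longrightarrow> A i j = 0) \<Longrightarrow> herm A"
  unfolding herm_def by blast

lemma herm_supp2: "herm A \<Longrightarrow> j \<notin> K \<Longrightarrow> A i j = 0"
  by (metis complex_cnj_zero herm_def)

lemma herm_diff:
  assumes "herm A" "herm B" shows "herm (A - B)"
proof (rule hermI)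
  fix i j
  show "(A - B) j i = cnj ((A - B) i j)"
    using hermD[OF assms(1), of j i] hermD[OF assms(2), of j i] by simp
qed (use assms in \<open>simp add: herm_supp1\<close>)

lemma mm_assoc: "mm (mm A B) C = mm A (mm B C)"
proof (intro ext)
  fix i j
  have "mm (mm A B) C i j = (\<Sum>t\<in>K. \<Sum>s\<in>K. A i s * B s t * C t j)"
    by (simp add: mm_def sum_distrib_right)
  also have "\<dots> = (\<Sum>s\<in>K. \<Sum>t\<in>K. A i s * B s t * C t j)"
    by (rule sum.swap)
  also have "\<dots> = mm A (mm B C) i j"
    by (simp add: mm_def sum_distrib_left mult.assoc)
  finally show "mm (mm A B) C i j = mm A (mm B C) i j" .
qed

lemma mm_diff_left: "mm (A - B) C = mm A C - mm B C"
  by (intro ext) (simp add: mm_def sum_subtractf left_diff_distrib)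

lemma mm_diff_right: "mm C (A - B) = mm C A - mm C B"
  by (intro ext) (simp add: mm_def sum_subtractf right_diff_distrib)

lemma sum_eye_left: "(\<Sum>t\<in>K. eye i t * f t) = (if i \<in> K then f i else 0)"
proof -
  have "(\<Sum>t\<in>K. eye i t * f t) = (\<Sum>t\<in>K. if i = t then f t else 0)"
    by (intro sum.cong) (auto simp: eye_def)
  then show ?thesis using finite_K by (simp add: sum.delta)
qed

lemma sum_eye_right: "(\<Sum>t\<in>K. f t * eye t i) = (if i \<in> K then f i else 0)"
proof -
  have "(\<Sum>t\<in>K. f t * eye t i) = (\<Sum>t\<in>K. if i = t then f t else 0)"
    by (intro sum.cong) (auto simp: eye_def)
  then show ?thesis using finite_K by (simp add: sum.delta)
qed

lemma mm_eye_left: "(\<And>i j. i \<notin> K \<Longrightarrow> A i j = 0) \<Longrightarrow> mm eye A = A"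
  by (intro ext) (auto simp: mm_def sum_eye_left)

lemma mm_eye_right: "(\<And>i j. j \<notin> K \<Longrightarrow> A i j = 0) \<Longrightarrow> mm A eye = A"
  by (intro ext) (auto simp: mm_def sum_eye_right)

lemma pw_supp1: "herm A \<Longrightarrow> i \<notin> K \<Longrightarrow> pw A n i j = 0"
  by (cases n) (auto simp: eye_def mm_def herm_supp1)

lemma pw_supp2: "herm A \<Longrightarrow> j \<notin> K \<Longrightarrow> pw A n i j = 0"
  by (induction n arbitrary: i) (auto simp: eye_def mm_def)

lemma pw_add: "herm A \<Longrightarrow> mm (pw A m) (pw A n) = pw A (m + n)"
  by (induction m) (auto simp: mm_assoc pw_supp1 intro!: mm_eye_left)

lemma pw_1: "herm A \<Longrightarrow> pw A 1 = A"
  by (simp add: mm_eye_right herm_supp2)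

lemma pw_Suc2: "herm A \<Longrightarrow> mm (pw A n) A = pw A (Suc n)"
  using pw_add[of A n 1] by (simp add: mm_eye_right herm_supp2)

lemma herm_pw: assumes "herm A" shows "herm (pw A n)"
proof (induction n)
  case 0
  then show ?case by (intro hermI) (auto simp: eye_def)
next
  case (Suc n)
  have "pw A (Suc n) j i = cnj (pw A (Suc n) i j)" for i j
  proof -
    have "pw A (Suc n) j i = (\<Sum>t\<in>K. A j t * pw A n t i)" by (simp add: mm_def)
    also have "\<dots> = (\<Sum>t\<in>K. cnj (pw A n i t * A t j))"
      by (intro sum.cong) (auto simp: hermD[OF assms, of j] hermD[OF Suc, of _ i])
    also have "\<dots> = cnj (mm (pw A n) A i j)" by (simp add: mm_def)
    finally show ?thesis using pw_Suc2[OF assms, of n] by simp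
  qed
  then show ?case using pw_supp1[OF assms] by (intro hermI)
qed

lemma ip_commute: "ip A B = ip B A"
  by (simp add: ip_def mult.commute)

lemma ip_diff_left: "ip (A - B) C = ip A C - ip B C"
  by (simp add: ip_def left_diff_distrib sum_subtractf)

lemma ip_diff_right: "ip C (A - B) = ip C A - ip C B"
  by (simp add: ip_def right_diff_distrib sum_subtractf)

lemma hs_eq: "hs A = (\<Sum>i\<in>K. \<Sum>j\<in>K. (cmod (A i j))\<^sup>2)"
  unfolding ip_def cmod_power2 by (simp add: power2_eq_square)

lemma hs_nonneg: "hs A \<ge> 0"
  by (simp add: hs_eq sum_nonneg)

text \<open>The free weight \<open>c\<close> serves the moment recursions: it splits an odd moment
  into the two neighbouring even ones with a prescribed share for each.\<close>

lemma two_ip_le: assumes "c > 0" shows "2 * ip A B \<le> c * hs A + hs B / c"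
proof -
  have *: "2 * Re (a * cnj b) \<le> c * Re (a * cnj a) + Re (b * cnj b) / c" for a b :: complex
  proof -
    have "0 \<le> ((c * Re a - Re b)\<^sup>2 + (c * Im a - Im b)\<^sup>2) / c" using assms by simp
    also have "\<dots> = c * Re (a * cnj a) + Re (b * cnj b) / c - 2 * Re (a * cnj b)"
      using assms by (simp add: field_simps power2_eq_square)
    finally show ?thesis by simp
  qed
  show ?thesis unfolding ip_def sum_distrib_left sum_divide_distrib sum.distrib[symmetric]
    by (intro sum_mono) (rule *)
qed

lemma ip_mm_left: "herm A \<Longrightarrow> ip (mm A E) F = ip E (mm A F)"
proof -
  assume h: "herm A"
  have "ip (mm A E) F = (\<Sum>i\<in>K. \<Sum>j\<in>K. \<Sum>t\<in>K. Re (A i t * E t j * cnj (F i j)))"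
    by (simp add: ip_def mm_def sum_distrib_right)
  also have "\<dots> = (\<Sum>i\<in>K. \<Sum>t\<in>K. \<Sum>j\<in>K. Re (A i t * E t j * cnj (F i j)))"
    by (intro sum.cong refl sum.swap)
  also have "\<dots> = (\<Sum>t\<in>K. \<Sum>i\<in>K. \<Sum>j\<in>K. Re (A i t * E t j * cnj (F i j)))"
    by (rule sum.swap)
  also have "\<dots> = (\<Sum>t\<in>K. \<Sum>j\<in>K. \<Sum>i\<in>K. Re (A i t * E t j * cnj (F i j)))"
    by (intro sum.cong refl sum.swap)
  also have "\<dots> = (\<Sum>t\<in>K. \<Sum>j\<in>K. \<Sum>i\<in>K. Re (E t j * cnj (A t i * F i j)))"
    by (intro sum.cong refl arg_cong[where f = Re]) (subst (1) hermD[OF h], simp)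
  also have "\<dots> = ip E (mm A F)"
    by (simp add: ip_def mm_def sum_distrib_left)
  finally show ?thesis .
qed

lemma ip_mm_right: "herm B \<Longrightarrow> ip (mm E B) F = ip E (mm F B)"
proof -
  assume h: "herm B"
  have "ip (mm E B) F = (\<Sum>i\<in>K. \<Sum>j\<in>K. \<Sum>t\<in>K. Re (E i t * B t j * cnj (F i j)))"
    by (simp add: ip_def mm_def sum_distrib_right)
  also have "\<dots> = (\<Sum>i\<in>K. \<Sum>t\<in>K. \<Sum>j\<in>K. Re (E i t * B t j * cnj (F i j)))"
    by (intro sum.cong refl sum.swap)
  also have "\<dots> = (\<Sum>i\<in>K. \<Sum>t\<in>K. \<Sum>j\<in>K. Re (E i t * cnj (F i j * B j t)))"
    by (intro sum.cong refl arg_cong[where f = Re]) (subst (1) hermD[OF h], simp)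
  also have "\<dots> = ip E (mm F B)"
    by (simp add: ip_def mm_def sum_distrib_left)
  finally show ?thesis .
qed

lemma hs_mm_herm: assumes A: "herm A" and B: "herm B"
  shows "hs (mm A B) = hs (mm B A)"
proof -
  have "cmod (mm A B i j) = cmod (mm B A j i)" for i j
  proof -
    have "mm A B i j = cnj (mm B A j i)"
      unfolding mm_def cnj_sum
      by (intro sum.cong refl) (simp add: hermD[OF A, of i] hermD[OF B, of _ j] mult.commute)
    then show ?thesis by simp
  qed
  then show ?thesis unfolding hs_eq by (subst sum.swap) simp
qed

text \<open>One factor of the even moment is isolated, so that it can be replaced by an average of
  differences \<open>X - X'\<close>.\<close>

lemma hs_pw_Suc: assumes "herm A"
  shows "hs (pw A (Suc n)) = ip A (pw A (2 * n + 1))"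
proof -
  have "pw A (2 * n + 1) = mm (pw A n) (pw A (Suc n))"
    using pw_add[OF assms, of n "Suc n"] by (simp add: mult_2)
  then have "ip A (pw A (2 * n + 1)) = ip (mm (pw A n) A) (pw A (Suc n))"
    by (simp add: ip_mm_left[OF herm_pw[OF assms]] del: pw.simps)
  then show ?thesis using pw_Suc2[OF assms] by simp
qed

text \<open>The numbers \<open>q j = tr (D A\<^sup>j D B\<^sup>2\<^sup>M\<^sup>-\<^sup>j)\<close> form a positive semidefinite Hankel
  sequence. Hence their symmetrisation \<open>Q j = q j + q (2M - j)\<close> satisfies
  \<open>2 Q j \<le> Q 0 + Q (2j)\<close>, so its maximum is attained at \<open>0\<close>.\<close>

lemma pw_diff_le:
  assumes A: "herm A" and B: "herm B" and n: "n = 2 * M + 1"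
  shows "ip (A - B) (pw A n - pw B n)
    \<le> real n / 2 * (hs (mm (pw A M) (A - B)) + hs (mm (pw B M) (A - B)))"
proof -
  define D where "D = A - B"
  have D: "herm D" unfolding D_def using A B by (rule herm_diff)
  \<comment> \<open>Inner products of these \<open>M + 1\<close> matrices depend only on
    \<open>i + j\<close>; this is the origin of the Hankel structure and of the positivity.\<close>
  define X where "X i = mm (pw A i) (mm D (pw B (M - i)))" for i
  define q where "q j = ip D (mm (pw A j) (mm D (pw B (2 * M - j))))" for j
  have ipX: "ip (X i) (X j) = q (i + j)" if "i \<le> M" "j \<le> M" for i j
  proof -
    have "ip (X i) (X j) = ip D (mm (mm (pw A i) (X j)) (pw B (M - i)))"
      unfolding X_def[of i]
      by (simp add: ip_mm_left[OF herm_pw[OF A]] ip_mm_right[OF herm_pw[OF B]])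
    also have "mm (mm (pw A i) (X j)) (pw B (M - i)) =
      mm (mm (pw A i) (pw A j)) (mm D (mm (pw B (M - j)) (pw B (M - i))))"
      by (simp add: X_def mm_assoc)
    also have "\<dots> = mm (pw A (i + j)) (mm D (pw B (2 * M - (i + j))))"
      using that by (simp add: pw_add[OF A] pw_add[OF B] mult_2 add.commute)
    finally show ?thesis by (simp add: q_def)
  qed
  have conv: "2 * q (i + j) \<le> q (2 * i) + q (2 * j)" if "i \<le> M" "j \<le> M" for i j
    using two_ip_le[of 1 "X i" "X j"] ipX[OF that] ipX[OF that(1) that(1)] ipX[OF that(2) that(2)]
    unfolding mult_2[of i] mult_2[of j] by simp
  define Q where "Q j = q j + q (2 * M - j)" for j
  have Qconv: "2 * Q j \<le> Q 0 + Q (2 * j)" if "j \<le> M" for j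
  proof -
    have "M + (M - j) = 2 * M - j" "2 * (M - j) = 2 * M - 2 * j" using that by auto
    then show ?thesis using conv[of 0 j] conv[of M "M - j"] that by (simp add: Q_def)
  qed
  have Qle: "Q j \<le> Q 0" if "j \<le> 2 * M" for j
  proof -
    have fin: "finite (Q ` {..2 * M})" "Q ` {..2 * M} \<noteq> {}" by auto
    obtain i where i: "i \<le> 2 * M" "Q i = Max (Q ` {..2 * M})"
      using Max_in[OF fin] by (metis atMost_iff imageE)
    have mx: "Q h \<le> Q i" if "h \<le> 2 * M" for h
      using i that fin by (metis Max_ge atMost_iff imageI)
    have sym: "Q (2 * M - i) = Q i" using i by (simp add: Q_def)
    \<comment> \<open>\<open>Qconv\<close> only reaches indices up to \<open>M\<close>; by the
      symmetry of \<open>Q\<close> a maximiser can be reflected into that range.\<close>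
    define h where "h = min i (2 * M - i)"
    have h: "h \<le> M" "Q h = Q i" using sym by (auto simp: h_def min_def)
    have "2 * Q i \<le> Q 0 + Q i"
      using Qconv[OF h(1)] mx[of "2 * h"] h by simp
    then show ?thesis using mx[OF that] by simp
  qed
  \<comment> \<open>\<open>c\<close> passes from \<open>B^n\<close> to \<open>A^n\<close> by
    exchanging one factor at a time. Each exchange leaves a factor \<open>D\<close> in its place, so
    the increments are the numbers \<open>q j\<close>.\<close>
  define c where "c j = ip D (mm (pw A j) (pw B (n - j)))" for j
  have step: "c (Suc j) - c j = q j" if "j < n" for j
  proof -
    have "pw B (n - j) = mm B (pw B (2 * M - j))"
    proof -
      have "n - j = Suc (2 * M - j)" using that n by simp
      then show ?thesis by simp
    qed
    moreover have "mm (pw A (Suc j)) (pw B (n - Suc j)) = mm (pw A j) (mm A (pw B (2 * M - j)))"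
      using pw_Suc2[OF A, of j] n by (simp add: mm_assoc[symmetric])
    ultimately show ?thesis
      by (simp add: c_def q_def D_def ip_diff_right[symmetric] mm_diff_right[symmetric]
        mm_diff_left[symmetric] del: pw.simps)
  qed
  have "c n - c 0 = (\<Sum>j<n. q j)"
  proof -
    have "(\<Sum>j<n. q j) = (\<Sum>j<n. c (Suc j) - c j)" using step by simp
    then show ?thesis by (simp add: sum_lessThan_telescope)
  qed
  moreover have "c n - c 0 = ip D (pw A n - pw B n)"
    using mm_eye_right[of "pw A n"] mm_eye_left[of "pw B n"] pw_supp1[OF B] pw_supp2[OF A]
    by (simp add: c_def ip_diff_right del: pw.simps add: pw.simps(1))
  moreover have "2 * (\<Sum>j<n. q j) \<le> real n * Q 0"
  proof -
    have "(\<Sum>j<n. q j) = (\<Sum>j<n. q (2 * M - j))"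
      using n by (intro sum.reindex_bij_witness[of _ "\<lambda>j. 2 * M - j" "\<lambda>j. 2 * M - j"]) auto
    then have "2 * (\<Sum>j<n. q j) = (\<Sum>j<n. Q j)" by (simp add: Q_def sum.distrib)
    also have "\<dots> \<le> (\<Sum>j<n. Q 0)" using n by (intro sum_mono Qle) auto
    finally show ?thesis by simp
  qed
  moreover have "Q 0 = hs (mm (pw A M) D) + hs (mm (pw B M) D)"
  proof -
    have "q 0 = hs (X 0)" using ipX[of 0 0] by simp
    also have "X 0 = mm D (pw B M)"
      unfolding X_def pw.simps(1) diff_zero
      by (rule mm_eye_left) (auto simp: mm_def herm_supp1[OF D])
    also have "hs \<dots> = hs (mm (pw B M) D)" by (rule hs_mm_herm[OF D herm_pw[OF B]])
    finally have 1: "q 0 = hs (mm (pw B M) D)" .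
    have "q (2 * M) = hs (X M)" using ipX[of M M] by (simp add: mult_2)
    also have "X M = mm (pw A M) D"
      unfolding X_def diff_self_eq_0 pw.simps(1)
      by (subst mm_eye_right) (auto simp: herm_supp2[OF D])
    finally show ?thesis using 1 by (simp add: Q_def)
  qed
  ultimately show ?thesis by (simp add: D_def)
qed

section \<open>Vector norms, rank-one matrices and crude norm bounds\<close>

lemma nv_nonneg: "nv v \<ge> 0"
  by (simp add: nv_def sum_nonneg)

lemma nv_diff_le: "nv (\<lambda>i. a i - b i) \<le> 2 * nv a + 2 * nv b"
  unfolding nv_def sum_distrib_left sum.distrib[symmetric] by (intro sum_mono cmod_diff_sq_le)

lemma hs_add_le: "hs (\<lambda>i j. A i j + B i j) \<le> 2 * hs A + 2 * hs B"
  unfolding hs_eq sum_distrib_left sum.distrib[symmetric] by (intro sum_mono cmod_add_sq_le)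

lemma hs_diff_le: "hs (A - B) \<le> 2 * hs A + 2 * hs B"
  unfolding hs_eq sum_distrib_left sum.distrib[symmetric] by (auto intro!: sum_mono cmod_diff_sq_le)

lemma mm_outer: "mm A (outer a b) = outer (av A a) b"
  by (intro ext) (simp add: mm_def outer_def av_def sum_distrib_right mult.assoc)

lemma hs_outer: "hs (outer a b) = nv a * nv b"
  by (simp add: hs_eq nv_def outer_def norm_mult power_mult_distrib sum_product)

lemma av_diff: "av A (\<lambda>i. a i - b i) = (\<lambda>i. av A a i - av A b i)"
  by (intro ext) (simp add: av_def right_diff_distrib sum_subtractf)

lemma nv_av_le: "nv (av A v) \<le> hs A * nv v"
  unfolding nv_def av_def hs_eq sum_distrib_right
  by (intro sum_mono order_trans[OF cmod_sum_mult_sq_le]) (simp add: sum_distrib_right)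

lemma hs_mm_le: "hs (mm A B) \<le> hs A * hs B"
proof -
  have "hs (mm A B) \<le> (\<Sum>i\<in>K. \<Sum>j\<in>K. (\<Sum>t\<in>K. (cmod (A i t))\<^sup>2) * (\<Sum>t\<in>K. (cmod (B t j))\<^sup>2))"
    unfolding hs_eq mm_def by (intro sum_mono cmod_sum_mult_sq_le)
  also have "\<dots> = (\<Sum>i\<in>K. \<Sum>t\<in>K. (cmod (A i t))\<^sup>2) * (\<Sum>j\<in>K. \<Sum>t\<in>K. (cmod (B t j))\<^sup>2)"
    by (simp add: sum_product)
  also have "(\<Sum>j\<in>K. \<Sum>t\<in>K. (cmod (B t j))\<^sup>2) = hs B" unfolding hs_eq by (rule sum.swap)
  finally show ?thesis by (simp add: hs_eq)
qed

lemma hs_pw_le: assumes "herm A" shows "hs (pw A (Suc n)) \<le> hs A ^ Suc n"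
proof (induction n)
  case 0
  then show ?case using pw_1[OF assms] by simp
next
  case (Suc n)
  have "hs (pw A (Suc (Suc n))) \<le> hs A * hs (pw A (Suc n))"
    using hs_mm_le[of A "pw A (Suc n)"] by simp
  also have "\<dots> \<le> hs A * hs A ^ Suc n" by (intro mult_left_mono Suc hs_nonneg)
  finally show ?case by simp
qed

lemma sum_nv_av:
  "(\<Sum>r\<in>R. b r * nv (av W (w r))) =
    ip (mm W (\<lambda>i j. \<Sum>r\<in>R. of_real (b r) * (w r i * cnj (w r j)))) W"
proof -
  have "ip (mm W (\<lambda>i j. \<Sum>r\<in>R. of_real (b r) * (w r i * cnj (w r j)))) W
      = (\<Sum>i\<in>K. \<Sum>j\<in>K. \<Sum>t\<in>K. \<Sum>r\<in>R. Re (W i t * (of_real (b r) * (w r t * cnj (w r j))) * cnj (W i j)))"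
    by (simp add: ip_def mm_def sum_distrib_left sum_distrib_right del: times_complex.sel)
  also have "\<dots> = (\<Sum>i\<in>K. \<Sum>j\<in>K. \<Sum>r\<in>R. \<Sum>t\<in>K. Re (W i t * (of_real (b r) * (w r t * cnj (w r j))) * cnj (W i j)))"
    by (intro sum.cong refl sum.swap)
  also have "\<dots> = (\<Sum>i\<in>K. \<Sum>r\<in>R. \<Sum>j\<in>K. \<Sum>t\<in>K. Re (W i t * (of_real (b r) * (w r t * cnj (w r j))) * cnj (W i j)))"
    by (intro sum.cong refl sum.swap)
  also have "\<dots> = (\<Sum>i\<in>K. \<Sum>r\<in>R. b r * (cmod (av W (w r) i))\<^sup>2)"
  proof (intro sum.cong refl)
    fix i r
    have "complex_of_real ((cmod (av W (w r) i))\<^sup>2) = (\<Sum>j\<in>K. \<Sum>t\<in>K. W i t * w r t * cnj (W i j * w r j))"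
      unfolding complex_norm_square av_def cnj_sum sum_product by (rule sum.swap)
    then have "complex_of_real (b r * (cmod (av W (w r) i))\<^sup>2)
      = (\<Sum>j\<in>K. \<Sum>t\<in>K. W i t * (of_real (b r) * (w r t * cnj (w r j))) * cnj (W i j))"
      by (simp add: sum_distrib_left mult_ac)
    then have "b r * (cmod (av W (w r) i))\<^sup>2
      = Re (\<Sum>j\<in>K. \<Sum>t\<in>K. W i t * (of_real (b r) * (w r t * cnj (w r j))) * cnj (W i j))"
      by (metis Re_complex_of_real)
    then show "(\<Sum>j\<in>K. \<Sum>t\<in>K. Re (W i t * (of_real (b r) * (w r t * cnj (w r j))) * cnj (W i j)))
      = b r * (cmod (av W (w r) i))\<^sup>2" by (simp only: Re_sum)
  qed
  also have "\<dots> = (\<Sum>r\<in>R. \<Sum>i\<in>K. b r * (cmod (av W (w r) i))\<^sup>2)" by (rule sum.swap)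
  finally show ?thesis by (simp add: nv_def sum_distrib_left)
qed

text \<open>This rests on the log-convexity of \<open>n \<mapsto> nv (A\<^sup>n x)\<close>.\<close>

lemma quadratic_form_power_le:
  assumes A: "herm A" and x: "nv x = 1"
  shows "(cmod (\<Sum>i\<in>K. cnj (x i) * av A x i)) ^ (2 * Suc p) \<le> hs (pw A (Suc p))"
proof -
  define y where "y n = av (pw A n) x" for n
  have ySuc: "y (Suc n) = av A (y n)" for n
  proof
    fix i
    have "y (Suc n) i = (\<Sum>t\<in>K. \<Sum>s\<in>K. A i s * pw A n s t * x t)"
      by (simp add: y_def av_def mm_def sum_distrib_right)
    also have "\<dots> = (\<Sum>s\<in>K. \<Sum>t\<in>K. A i s * pw A n s t * x t)" by (rule sum.swap)
    finally show "y (Suc n) i = av A (y n) i"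
      by (simp add: y_def av_def sum_distrib_left mult.assoc)
  qed
  have adj: "(\<Sum>i\<in>K. cnj (a i) * av A b i) = (\<Sum>i\<in>K. cnj (av A a i) * b i)" for a b
  proof -
    have "(\<Sum>i\<in>K. cnj (a i) * av A b i) = (\<Sum>i\<in>K. \<Sum>t\<in>K. cnj (a i) * (A i t * b t))"
      by (simp add: av_def sum_distrib_left)
    also have "\<dots> = (\<Sum>t\<in>K. \<Sum>i\<in>K. cnj (a i) * (A i t * b t))" by (rule sum.swap)
    also have "\<dots> = (\<Sum>t\<in>K. \<Sum>i\<in>K. cnj (A t i * a i) * b t)"
      by (intro sum.cong refl) (subst hermD[OF A], simp)
    finally show ?thesis by (simp add: av_def sum_distrib_right)
  qed
  have y0: "nv (y 0) = 1"
    using x by (simp add: y_def av_def nv_def sum_eye_left)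
  have logc: "(nv (y (Suc n)))\<^sup>2 \<le> nv (y n) * nv (y (Suc (Suc n)))" for n
  proof -
    have "complex_of_real (nv (y (Suc n))) = (\<Sum>i\<in>K. cnj (y (Suc n) i) * av A (y n) i)"
      by (simp add: nv_def complex_norm_square ySuc mult.commute del: of_real_power)
    also have "\<dots> = (\<Sum>i\<in>K. cnj (y (Suc (Suc n)) i) * y n i)"
      by (simp add: adj ySuc)
    finally have "(nv (y (Suc n)))\<^sup>2 = (cmod (\<Sum>i\<in>K. cnj (y (Suc (Suc n)) i) * y n i))\<^sup>2"
      using nv_nonneg by (metis abs_of_nonneg norm_of_real)
    also have "\<dots> \<le> nv (y (Suc (Suc n))) * nv (y n)"
      using cmod_sum_mult_sq_le[of "\<lambda>i. cnj (y (Suc (Suc n)) i)" "y n" K] by (simp add: nv_def)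
    finally show ?thesis by (simp add: mult.commute)
  qed
  \<comment> \<open>Log-convexity makes the ratios of consecutive \<open>nv (y n)\<close>
    nondecreasing, and the first ratio is \<open>nv (y 1)\<close>. The claim is stated without
    division because \<open>nv (y n)\<close> may vanish.\<close>
  have grow: "nv (y 1) * nv (y n) \<le> nv (y (Suc n))" for n
  proof (induction n)
    case 0
    then show ?case using y0 by simp
  next
    case (Suc n)
    show ?case
    proof (cases "nv (y n) = 0")
      case True
      then have "nv (y (Suc n)) = 0" using logc[of n] by simp
      then show ?thesis using nv_nonneg by simp
    next
      case False
      then have pos: "nv (y n) > 0" using nv_nonneg[of "y n"] by simp
      have "nv (y n) * (nv (y 1) * nv (y (Suc n))) = nv (y 1) * nv (y n) * nv (y (Suc n))" by simp
      also have "\<dots> \<le> nv (y (Suc n)) * nv (y (Suc n))"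
        using Suc nv_nonneg by (intro mult_right_mono)
      also have "\<dots> \<le> nv (y n) * nv (y (Suc (Suc n)))" using logc[of n] by (simp add: power2_eq_square)
      finally show ?thesis using pos by simp
    qed
  qed
  have pwr: "nv (y 1) ^ n \<le> nv (y n)" for n
  proof (induction n)
    case 0
    then show ?case using y0 by simp
  next
    case (Suc n)
    have "nv (y 1) ^ Suc n \<le> nv (y 1) * nv (y n)" using Suc nv_nonneg by (simp add: mult_left_mono)
    then show ?case using grow[of n] by simp
  qed
  have "(cmod (\<Sum>i\<in>K. cnj (x i) * av A x i))\<^sup>2 \<le> nv x * nv (av A x)"
    using cmod_sum_mult_sq_le[of "\<lambda>i. cnj (x i)" "av A x" K] by (simp add: nv_def)
  also have "\<dots> = nv (y 1)" using x pw_1[OF A] by (simp add: y_def)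
  finally have "((cmod (\<Sum>i\<in>K. cnj (x i) * av A x i))\<^sup>2) ^ Suc p \<le> nv (y 1) ^ Suc p"
    by (intro power_mono) auto
  also have "\<dots> \<le> nv (y (Suc p))" by (rule pwr)
  also have "\<dots> \<le> hs (pw A (Suc p))" using nv_av_le[of "pw A (Suc p)" x] x by (simp add: y_def)
  finally show ?thesis by (simp only: power_mult)
qed

end

section \<open>Averages and exchangeable pairs\<close>

text \<open>All randomness is uniform on a finite set, so expectations are finite averages. Over an
  empty set the value is 0, by division by zero.\<close>

definition avg :: "'a set \<Rightarrow> ('a \<Rightarrow> real) \<Rightarrow> real" where
  "avg A f = (\<Sum>a\<in>A. f a) / real (card A)"

lemma avg_mono: "(\<And>a. a \<in> A \<Longrightarrow> f a \<le> g a) \<Longrightarrow> avg A f \<le> avg A g"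
  unfolding avg_def by (intro divide_right_mono sum_mono) auto

lemma avg_cong: "(\<And>a. a \<in> A \<Longrightarrow> f a = g a) \<Longrightarrow> avg A f = avg A g"
  unfolding avg_def by (simp cong: sum.cong)

lemma avg_nonneg: "(\<And>a. a \<in> A \<Longrightarrow> 0 \<le> f a) \<Longrightarrow> 0 \<le> avg A f"
  unfolding avg_def by (intro divide_nonneg_nonneg sum_nonneg) auto

lemma avg_add: "avg A (\<lambda>a. f a + g a) = avg A f + avg A g"
  by (simp add: avg_def sum.distrib add_divide_distrib)

lemma avg_cmult: "avg A (\<lambda>a. c * f a) = c * avg A f"
  by (simp add: avg_def sum_distrib_left)

lemma avg_sum: "avg A (\<lambda>a. \<Sum>i\<in>I. f i a) = (\<Sum>i\<in>I. avg A (f i))"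
  unfolding avg_def sum_divide_distrib[symmetric] by (subst sum.swap) simp

lemma avg_const: "finite A \<Longrightarrow> A \<noteq> {} \<Longrightarrow> avg A (\<lambda>_. c) = c"
  by (simp add: avg_def)

lemma avg_const_le: "finite A \<Longrightarrow> 0 \<le> c \<Longrightarrow> avg A (\<lambda>_. c) \<le> c"
  by (cases "A = {}") (auto simp: avg_def)

lemma power_sum_le:
  fixes y :: "'a \<Rightarrow> real"
  assumes A: "finite A" and y: "\<And>a. a \<in> A \<Longrightarrow> y a \<ge> 0" and q: "q \<ge> 1"
  shows "(\<Sum>a\<in>A. y a) ^ q \<le> real (card A) ^ q * avg A (\<lambda>a. y a ^ q)"
proof (cases "A = {}")
  case True
  then show ?thesis using q by (simp add: avg_def power_0_left)
next
  case False
  then have c: "real (card A) > 0" using A by (simp add: card_gt_0_iff)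
  have conv: "convex_on {0::real..} (\<lambda>x. x ^ q)"
    using convex_power_odd convex_on_subset[OF convex_power_even] by (cases "even q") auto
  have "(\<Sum>a\<in>A. (1 / real (card A)) *\<^sub>R y a) ^ q \<le> (\<Sum>a\<in>A. (1 / real (card A)) * y a ^ q)"
    using A False y c by (intro convex_on_sum[OF _ _ conv]) auto
  then have "((\<Sum>a\<in>A. y a) / real (card A)) ^ q \<le> avg A (\<lambda>a. y a ^ q)"
    by (simp add: avg_def sum_divide_distrib)
  then show ?thesis using c by (simp add: power_divide field_simps)
qed

lemma sum_swap3:
  "(\<Sum>t\<in>B. \<Sum>i\<in>C. \<Sum>j\<in>D. g t i j) = (\<Sum>i\<in>C. \<Sum>j\<in>D. \<Sum>t\<in>B. g t i j)"
  by (subst sum.swap) (intro sum.cong refl sum.swap)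

lemma sum_swap4:
  "(\<Sum>r\<in>A. \<Sum>t\<in>B. \<Sum>i\<in>C. \<Sum>j\<in>D. g r t i j) = (\<Sum>i\<in>C. \<Sum>j\<in>D. \<Sum>r\<in>A. \<Sum>t\<in>B. g r t i j)"
  by (subst sum_swap3) (rule sum_swap3)

locale sampling = index_set K for K :: "nat set" +
  fixes N m :: nat
  assumes N_pos: "N \<ge> 1"
begin

definition \<Omega> :: "(nat \<Rightarrow> nat) set" where
  "\<Omega> = {1..m} \<rightarrow>\<^sub>E {1..N}"

abbreviation Ex :: "((nat \<Rightarrow> nat) \<Rightarrow> real) \<Rightarrow> real" where
  "Ex \<equiv> avg \<Omega>"

abbreviation Ej :: "(nat \<Rightarrow> real) \<Rightarrow> real" where
  "Ej \<equiv> avg {1..N}"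

lemma finite_Omega: "finite \<Omega>"
  by (simp add: \<Omega>_def finite_PiE)

lemma card_Omega: "card \<Omega> = N ^ m"
  by (simp add: \<Omega>_def card_PiE)

lemma Omega_nonempty: "\<Omega> \<noteq> {}"
  using N_pos by (auto simp: \<Omega>_def PiE_eq_empty_iff)

lemma Omega_range: "J \<in> \<Omega> \<Longrightarrow> r \<in> {1..m} \<Longrightarrow> J r \<in> {1..N}"
  by (auto simp: \<Omega>_def)

lemma Omega_upd: "J \<in> \<Omega> \<Longrightarrow> r \<in> {1..m} \<Longrightarrow> j \<in> {1..N} \<Longrightarrow> J(r := j) \<in> \<Omega>"
  by (auto simp: \<Omega>_def PiE_iff extensional_def)

lemma Ex_const: "Ex (\<lambda>_. c) = c"
  by (rule avg_const[OF finite_Omega Omega_nonempty])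

lemma Ej_const: "Ej (\<lambda>_. c) = c"
  using N_pos by (intro avg_const) auto

text \<open>The map \<open>(J, j) \<mapsto> (J(r := j), J r)\<close> is an involution of
  \<open>\<Omega> \<times> {1..N}\<close> that swaps the two members of the pair.\<close>

lemma exchange:
  assumes r: "r \<in> {1..m}"
  shows "Ex (\<lambda>J. Ej (\<lambda>j. F J (J(r := j)))) = Ex (\<lambda>J. Ej (\<lambda>j. F (J(r := j)) J))"
proof -
  have "(\<Sum>J\<in>\<Omega>. \<Sum>j\<in>{1..N}. F J (J(r := j))) = (\<Sum>J\<in>\<Omega>. \<Sum>j\<in>{1..N}. F (J(r := j)) J)"
    unfolding sum.cartesian_product
    by (rule sum.reindex_bij_witness[of _ "\<lambda>(J, j). (J(r := j), J r)" "\<lambda>(J, j). (J(r := j), J r)"])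
      (use r Omega_upd Omega_range in auto)
  then show ?thesis by (simp add: avg_def sum_divide_distrib[symmetric])
qed

text \<open>Stein's method of exchangeable pairs: \<open>J\<close> and \<open>J(r := j)\<close> are exchangeable.\<close>

lemma stein:
  assumes herm: "\<And>J. J \<in> \<Omega> \<Longrightarrow> herm (X J)"
    and lin: "\<And>J i j. J \<in> \<Omega> \<Longrightarrow> i \<in> K \<Longrightarrow> j \<in> K \<Longrightarrow>
      (\<Sum>r=1..m. \<Sum>t=1..N. (X J - X (J(r := t))) i j) = of_real (\<gamma> * real N) * X J i j"
  shows "\<gamma> * Ex (\<lambda>J. hs (pw (X J) (Suc M))) \<le> real (2 * M + 1) / 2 *
    (\<Sum>r=1..m. Ex (\<lambda>J. Ej (\<lambda>j. hs (mm (pw (X J) M) (X J - X (J(r := j)))))))"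
proof -
  define n where "n = 2 * M + 1"
  define P where "P J = pw (X J) n" for J
  define G where "G J J' = hs (mm (pw (X J) M) (X J - X J'))" for J J'
  have 1: "\<gamma> * hs (pw (X J) (Suc M)) = (\<Sum>r=1..m. Ej (\<lambda>t. ip (X J - X (J(r := t))) (P J)))"
    if J: "J \<in> \<Omega>" for J
  proof -
    have "(\<Sum>r=1..m. \<Sum>t=1..N. ip (X J - X (J(r := t))) (P J))
      = (\<Sum>i\<in>K. \<Sum>j\<in>K. Re ((\<Sum>r=1..m. \<Sum>t=1..N. (X J - X (J(r := t))) i j) * cnj (P J i j)))"
      unfolding ip_def sum_distrib_right Re_sum by (rule sum_swap4)
    also have "\<dots> = (\<Sum>i\<in>K. \<Sum>j\<in>K. \<gamma> * real N * Re (X J i j * cnj (P J i j)))"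
    proof (intro sum.cong refl)
      fix i j assume ij: "i \<in> K" "j \<in> K"
      show "Re ((\<Sum>r=1..m. \<Sum>t=1..N. (X J - X (J(r := t))) i j) * cnj (P J i j))
        = \<gamma> * real N * Re (X J i j * cnj (P J i j))"
        unfolding lin[OF J ij] mult.assoc[of "complex_of_real _"] by simp
    qed
    also have "\<dots> = \<gamma> * real N * ip (X J) (P J)"
      by (simp only: ip_def sum_distrib_left)
    also have "\<dots> = real N * (\<gamma> * hs (pw (X J) (Suc M)))"
      using hs_pw_Suc[OF herm[OF J], of M] by (simp add: P_def n_def del: pw.simps)
    finally show ?thesis using N_pos
      by (simp add: avg_def sum_divide_distrib[symmetric] field_simps del: pw.simps)
  qed
  \<comment> \<open>Adding the two exchanged forms antisymmetrises: only
    \<open>ip (X - X') (P - P')\<close> remains, and the increment of the odd power \<open>P\<close>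
    is what \<open>pw_diff_le\<close> bounds by squares of \<open>X - X'\<close>.\<close>
  have 2: "Ex (\<lambda>J. Ej (\<lambda>t. ip (X J - X (J(r := t))) (P J))) \<le>
    real n / 2 * Ex (\<lambda>J. Ej (\<lambda>t. G J (J(r := t))))" if r: "r \<in> {1..m}" for r
  proof -
    let ?L = "Ex (\<lambda>J. Ej (\<lambda>t. ip (X J - X (J(r := t))) (P J)))"
    have "?L = Ex (\<lambda>J. Ej (\<lambda>t. ip (X (J(r := t)) - X J) (P (J(r := t)))))"
      by (rule exchange[OF r, of "\<lambda>J J'. ip (X J - X J') (P J)"])
    then have "2 * ?L = Ex (\<lambda>J. Ej (\<lambda>t. ip (X J - X (J(r := t))) (P J) + ip (X (J(r := t)) - X J) (P (J(r := t)))))"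
      by (simp add: avg_add)
    also have "\<dots> = Ex (\<lambda>J. Ej (\<lambda>t. ip (X J - X (J(r := t))) (P J - P (J(r := t)))))"
      by (simp add: ip_diff_left ip_diff_right algebra_simps)
    also have "\<dots> \<le> Ex (\<lambda>J. Ej (\<lambda>t. real n / 2 * (G J (J(r := t)) + G (J(r := t)) J)))"
    proof (intro avg_mono)
      fix J t assume J: "J \<in> \<Omega>" and t: "t \<in> {1..N}"
      have "hs (mm B (C - D)) = hs (mm B (D - C))" for B C D
        unfolding mm_diff_right hs_eq by (simp add: norm_minus_commute)
      then show "ip (X J - X (J(r := t))) (P J - P (J(r := t)))
        \<le> real n / 2 * (G J (J(r := t)) + G (J(r := t)) J)"
        using pw_diff_le[OF herm[OF J] herm[OF Omega_upd[OF J r t]] n_def]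
        unfolding P_def G_def by metis
    qed
    also have "\<dots> = real n / 2 * (2 * Ex (\<lambda>J. Ej (\<lambda>t. G J (J(r := t)))))"
      using exchange[OF r, of G] by (simp only: avg_add avg_cmult mult_2)
    finally show ?thesis by simp
  qed
  have "\<gamma> * Ex (\<lambda>J. hs (pw (X J) (Suc M)))
    = Ex (\<lambda>J. \<Sum>r=1..m. Ej (\<lambda>t. ip (X J - X (J(r := t))) (P J)))"
    unfolding avg_cmult[symmetric] by (intro avg_cong 1)
  also have "\<dots> = (\<Sum>r=1..m. Ex (\<lambda>J. Ej (\<lambda>t. ip (X J - X (J(r := t))) (P J))))"
    by (rule avg_sum)
  also have "\<dots> \<le> (\<Sum>r=1..m. real n / 2 * Ex (\<lambda>J. Ej (\<lambda>t. G J (J(r := t)))))"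
    by (intro sum_mono 2)
  finally show ?thesis by (simp add: n_def G_def sum_distrib_left del: pw.simps)
qed

text \<open>The matrix inequality for one-by-one matrices, with index set \<open>{0}\<close> and
  \<open>\<gamma> = 1\<close>.\<close>

lemma stein_scalar:
  fixes x :: "(nat \<Rightarrow> nat) \<Rightarrow> real"
  assumes lin: "\<And>J. J \<in> \<Omega> \<Longrightarrow> (\<Sum>r=1..m. \<Sum>t=1..N. x J - x (J(r := t))) = real N * x J"
  shows "Ex (\<lambda>J. x J ^ (2 * Suc M)) \<le> real (2 * M + 1) / 2 *
    (\<Sum>r=1..m. Ex (\<lambda>J. Ej (\<lambda>j. x J ^ (2 * M) * (x J - x (J(r := j)))\<^sup>2)))"
proof -
  interpret sc: sampling "{0}" N m
    by unfold_locales (use N_pos in auto)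
  define X :: "(nat \<Rightarrow> nat) \<Rightarrow> cmat" where "X J i j = (if i = 0 \<and> j = 0 then of_real (x J) else 0)" for J i j
  have pwX: "sc.pw (X J) n 0 0 = of_real (x J ^ n)" for J n
    by (induction n) (auto simp: sc.eye_def sc.mm_def X_def)
  have "1 * Ex (\<lambda>J. sc.ip (sc.pw (X J) (Suc M)) (sc.pw (X J) (Suc M))) \<le> real (2 * M + 1) / 2 *
    (\<Sum>r=1..m. Ex (\<lambda>J. Ej (\<lambda>j. sc.ip (sc.mm (sc.pw (X J) M) (X J - X (J(r := j))))
      (sc.mm (sc.pw (X J) M) (X J - X (J(r := j)))))))"
  proof (rule sc.stein)
    fix J i j assume "J \<in> \<Omega>" "i \<in> {0::nat}" "j \<in> {0::nat}"
    then show "(\<Sum>r=1..m. \<Sum>t=1..N. (X J - X (J(r := t))) i j) = complex_of_real (1 * real N) * X J i j"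
      using lin[of J] by (simp add: X_def flip: of_real_diff of_real_sum)
  qed (auto simp: sc.herm_def X_def)
  moreover have "sc.ip (sc.pw (X J) (Suc M)) (sc.pw (X J) (Suc M)) = x J ^ (2 * Suc M)" for J
    unfolding sc.ip_def using pwX[of J "Suc M"]
    by (simp del: sc.pw.simps power_Suc) (simp add: mult_2 power_add power2_eq_square)
  moreover have "sc.ip (sc.mm (sc.pw (X J) M) (X J - X J')) (sc.mm (sc.pw (X J) M) (X J - X J'))
     = x J ^ (2 * M) * (x J - x J')\<^sup>2" for J J'
    unfolding sc.ip_def sc.mm_def using pwX[of J "M"]
    by (simp add: X_def mult_2 power_add power2_eq_square)
  ultimately show ?thesis by simp
qed

text \<open>Resampling row \<open>r\<close> changes the sum by at most
  \<open>2 * \<bar>c r\<bar>\<close>, so raising the order from \<open>2q\<close> to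
  \<open>2q + 2\<close> costs a factor \<open>2 * (2q + 1)\<close> times the sum of squares. The
  number \<open>Q\<close> stays fixed during the induction so that one factor serves all
  steps.\<close>

lemma subgaussian_scalar:
  fixes f :: "nat \<Rightarrow> real"
  assumes f1: "\<And>j. j \<in> {1..N} \<Longrightarrow> \<bar>f j\<bar> \<le> 1" and f0: "(\<Sum>j=1..N. f j) = 0"
    and q: "q \<le> Q"
  shows "Ex (\<lambda>J. (\<Sum>r=1..m. c r * f (J r)) ^ (2 * q)) \<le> (4 * real Q * (\<Sum>r=1..m. (c r)\<^sup>2)) ^ q"
  using q
proof (induction q)
  case 0
  then show ?case by (simp add: Ex_const)
next
  case (Suc q)
  define x where "x J = (\<Sum>r=1..m. c r * f (J r))" for J
  define s where "s = (\<Sum>r=1..m. (c r)\<^sup>2)"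
  have s: "s \<ge> 0" by (simp add: s_def sum_nonneg)
  have dx: "x J - x (J(r := t)) = c r * (f (J r) - f t)" if "r \<in> {1..m}" for J r t
  proof -
    have "x J - x (J(r := t)) = (\<Sum>i=1..m. c i * f (J i) - c i * f ((J(r := t)) i))"
      by (simp add: x_def sum_subtractf)
    also have "\<dots> = (\<Sum>i=1..m. if i = r then c r * (f (J r) - f t) else 0)"
      by (intro sum.cong) (auto simp: algebra_simps)
    finally show ?thesis using that by (simp add: sum.delta)
  qed
  have "Ex (\<lambda>J. x J ^ (2 * Suc q)) \<le> real (2 * q + 1) / 2 *
    (\<Sum>r=1..m. Ex (\<lambda>J. Ej (\<lambda>j. x J ^ (2 * q) * (x J - x (J(r := j)))\<^sup>2)))"
  proof (rule stein_scalar)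
    fix J
    have "(\<Sum>r=1..m. \<Sum>t=1..N. x J - x (J(r := t))) = (\<Sum>r=1..m. \<Sum>t=1..N. c r * (f (J r) - f t))"
      by (intro sum.cong refl dx)
    also have "\<dots> = (\<Sum>r=1..m. real N * (c r * f (J r)))"
      using f0 by (simp add: sum_distrib_left[symmetric] sum_subtractf) (simp add: sum_distrib_left mult_ac)
    finally show "(\<Sum>r=1..m. \<Sum>t=1..N. x J - x (J(r := t))) = real N * x J"
      by (simp add: x_def sum_distrib_left)
  qed
  also have "\<dots> \<le> real (2 * q + 1) / 2 * (\<Sum>r=1..m. Ex (\<lambda>J. Ej (\<lambda>j. 4 * (c r)\<^sup>2 * x J ^ (2 * q))))"
  proof (intro mult_left_mono sum_mono avg_mono)
    fix r J j assume r: "r \<in> {1..m}" and J: "J \<in> \<Omega>" and j: "j \<in> {1..N}"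
    have "\<bar>f (J r) - f j\<bar> \<le> 2" using f1[OF Omega_range[OF J r]] f1[OF j] by linarith
    then have "(f (J r) - f j)\<^sup>2 \<le> 4" using abs_le_square_iff[of "f (J r) - f j" 2] by simp
    then have "(c r)\<^sup>2 * (f (J r) - f j)\<^sup>2 \<le> (c r)\<^sup>2 * 4" by (intro mult_left_mono) auto
    then have "x J ^ (2 * q) * ((c r)\<^sup>2 * (f (J r) - f j)\<^sup>2) \<le> x J ^ (2 * q) * ((c r)\<^sup>2 * 4)"
      by (rule mult_left_mono) simp
    then show "x J ^ (2 * q) * (x J - x (J(r := j)))\<^sup>2 \<le> 4 * (c r)\<^sup>2 * x J ^ (2 * q)"
      unfolding dx[OF r] power_mult_distrib by (simp only: mult_ac)
  qed auto
  also have "\<dots> = real (2 * q + 1) / 2 * (4 * s * Ex (\<lambda>J. x J ^ (2 * q)))"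
    by (simp only: Ej_const avg_cmult s_def sum_distrib_left[symmetric] sum_distrib_right[symmetric])
  also have "\<dots> = real (2 * q + 1) * 2 * s * Ex (\<lambda>J. x J ^ (2 * q))" by simp
  also have "\<dots> \<le> (4 * real Q * s) * (4 * real Q * s) ^ q"
  proof (rule mult_mono)
    have "real (2 * q + 1) * 2 \<le> 4 * real Q" using Suc.prems by simp
    then show "real (2 * q + 1) * 2 * s \<le> 4 * real Q * s" using s by (rule mult_right_mono)
    show "Ex (\<lambda>J. x J ^ (2 * q)) \<le> (4 * real Q * s) ^ q" using Suc by (simp add: x_def s_def)
  qed (use s in \<open>auto intro!: avg_nonneg\<close>)
  finally show ?case by (simp add: x_def s_def)
qed

end

section \<open>Samples of an isotropic family of unimodular vectors\<close>

lemma sum_diff_upd: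
  fixes g :: "nat \<Rightarrow> nat \<Rightarrow> 'a::ab_group_add"
  assumes "finite R" "r \<in> R"
  shows "(\<Sum>i\<in>R. g i (J i)) - (\<Sum>i\<in>R. g i ((J(r := t)) i)) = g r (J r) - g r t"
proof -
  have "(\<Sum>i\<in>R. g i (J i)) - (\<Sum>i\<in>R. g i ((J(r := t)) i))
    = (\<Sum>i\<in>R. if r = i then g r (J r) - g r t else 0)"
    unfolding sum_subtractf[symmetric] by (intro sum.cong) auto
  then show ?thesis using assms by (simp add: sum.delta)
qed

context index_set
begin

text \<open>This turns a moment bound into an operator norm bound:
  \<open>quadratic_form_power_le\<close> is scaled to arbitrary \<open>x\<close> and the root of
  order \<open>2 * Suc p\<close> is taken. Operator norms occur only in this form.\<close>

lemma quadratic_form_le: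
  assumes A: "herm A" and L: "\<Lambda> \<ge> 0" and bound: "hs (pw A (Suc p)) \<le> \<Lambda> ^ (2 * Suc p)"
  shows "cmod (\<Sum>i\<in>K. cnj (x i) * av A x i) \<le> \<Lambda> * nv x"
proof (cases "nv x = 0")
  case True
  then have "x i = 0" if "i \<in> K" for i
    using that finite_K by (auto simp: nv_def sum_nonneg_eq_0_iff)
  then show ?thesis using True by simp
next
  case False
  then have pos: "nv x > 0" using nv_nonneg[of x] by simp
  define y where "y i = x i / of_real (sqrt (nv x))" for i
  have "nv y = nv x / nv x"
    using pos by (subst (1) nv_def) (simp add: y_def norm_divide power_divide sum_divide_distrib[symmetric] flip: nv_def)
  then have y1: "nv y = 1" using pos by simp
  have x: "x i = of_real (sqrt (nv x)) * y i" for i using pos by (simp add: y_def)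
  have "cmod (\<Sum>i\<in>K. cnj (y i) * av A y i) ^ (2 * Suc p) \<le> \<Lambda> ^ (2 * Suc p)"
    using quadratic_form_power_le[OF A y1, of p] bound by linarith
  moreover have "2 * Suc p = Suc (2 * p + 1)" by simp
  ultimately have le: "cmod (\<Sum>i\<in>K. cnj (y i) * av A y i) \<le> \<Lambda>"
    using L power_le_imp_le_base by metis
  have "(\<Sum>i\<in>K. cnj (x i) * av A x i) = of_real (nv x) * (\<Sum>i\<in>K. cnj (y i) * av A y i)"
  proof -
    have "av A x i = of_real (sqrt (nv x)) * av A y i" for i
      unfolding av_def sum_distrib_left by (subst (1) x) (simp add: mult_ac)
    then have "cnj (x i) * av A x i = of_real (sqrt (nv x)) * of_real (sqrt (nv x)) * (cnj (y i) * av A y i)" for i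
      by (subst (1) x) (simp add: mult_ac)
    moreover have "complex_of_real (sqrt (nv x)) * of_real (sqrt (nv x)) = of_real (nv x)"
      using pos by (simp flip: of_real_mult)
    ultimately show ?thesis by (simp add: sum_distrib_left)
  qed
  then show ?thesis using le pos by (simp add: norm_mult mult.commute)
qed

text \<open>Each row of \<open>W\<close>, conjugated, contributes one value of the quadratic form of
  \<open>A\<close>.\<close>

lemma ip_mm_quadratic_le:
  assumes "\<And>x. cmod (\<Sum>i\<in>K. cnj (x i) * av A x i) \<le> \<Lambda> * nv x"
  shows "ip (mm W A) W \<le> \<Lambda> * hs W"
proof -
  have "ip (mm W A) W = (\<Sum>i\<in>K. Re (\<Sum>t\<in>K. W i t * av A (\<lambda>j. cnj (W i j)) t))"
  proof -
    have "(\<Sum>j\<in>K. (\<Sum>t\<in>K. W i t * A t j) * cnj (W i j)) = (\<Sum>t\<in>K. W i t * av A (\<lambda>j. cnj (W i j)) t)" for i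
      unfolding av_def sum_distrib_left sum_distrib_right by (subst sum.swap) (simp add: mult.assoc)
    then show ?thesis by (simp only: ip_def mm_def Re_sum[symmetric])
  qed
  also have "\<dots> \<le> (\<Sum>i\<in>K. \<Lambda> * nv (\<lambda>j. cnj (W i j)))"
  proof (rule sum_mono)
    fix i
    show "Re (\<Sum>t\<in>K. W i t * av A (\<lambda>j. cnj (W i j)) t) \<le> \<Lambda> * nv (\<lambda>j. cnj (W i j))"
      using order_trans[OF complex_Re_le_cmod assms[of "\<lambda>j. cnj (W i j)"]] by simp
  qed
  also have "\<dots> = \<Lambda> * hs W" by (simp add: nv_def hs_eq sum_distrib_left)
  finally show ?thesis .
qed

lemma mm_add_right: "mm C (\<lambda>i j. A i j + B i j) = (\<lambda>i j. mm C A i j + mm C B i j)"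
  by (intro ext) (simp add: mm_def sum.distrib distrib_left)

lemma ip_add_left: "ip (\<lambda>i j. A i j + B i j) C = ip A C + ip B C"
  by (simp add: ip_def distrib_right sum.distrib)

lemma ip_mm_eye: "ip (mm W (\<lambda>i j. of_real c * eye i j)) W = c * hs W"
proof -
  have "mm W (\<lambda>i j. of_real c * eye i j) i j = of_real c * W i j" if "j \<in> K" for i j
  proof -
    have "mm W (\<lambda>i j. of_real c * eye i j) i j = (\<Sum>t\<in>K. of_real c * W i t * eye t j)"
      by (simp add: mm_def mult_ac)
    then show ?thesis using that sum_eye_right[of "\<lambda>t. of_real c * W i t" j] by simp
  qed
  then show ?thesis by (simp add: ip_def sum_distrib_left algebra_simps)
qed

lemma hs_scale: "hs (\<lambda>i j. of_real c * A i j) = c\<^sup>2 * hs A"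
  by (simp add: hs_eq norm_mult power_mult_distrib sum_distrib_left)

lemma mm_scale: "mm W (\<lambda>i j. of_real c * A i j) = (\<lambda>i j. of_real c * mm W A i j)"
  by (intro ext) (simp add: mm_def sum_distrib_left mult_ac)

lemma av_eye: "i \<in> K \<Longrightarrow> av eye v i = v i"
  by (simp add: av_def sum_eye_left)

lemma nv_av_eye: "nv (av eye v) = nv v"
  by (simp add: nv_def av_eye)

lemma hs_eye: "hs eye = real (card K)"
proof -
  have "hs eye = (\<Sum>i\<in>K. \<Sum>j\<in>K. if i = j then 1 else 0)"
    unfolding hs_eq by (intro sum.cong refl) (auto simp: eye_def)
  then show ?thesis using finite_K by (simp add: sum.delta)
qed

end

context sampling
begin

definition Pr :: "((nat \<Rightarrow> nat) \<Rightarrow> bool) \<Rightarrow> real" where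
  "Pr P = Ex (\<lambda>J. if P J then 1 else 0)"

lemma Pr_nonneg: "0 \<le> Pr P"
  unfolding Pr_def by (rule avg_nonneg) simp

lemma Pr_mono: "(\<And>J. J \<in> \<Omega> \<Longrightarrow> P J \<Longrightarrow> Q J) \<Longrightarrow> Pr P \<le> Pr Q"
  unfolding Pr_def by (rule avg_mono) simp

lemma Pr_disj: "Pr (\<lambda>J. P J \<or> Q J) \<le> Pr P + Pr Q"
  unfolding Pr_def avg_add[symmetric] by (rule avg_mono) simp

lemma Pr_bex: "finite I \<Longrightarrow> Pr (\<lambda>J. \<exists>i\<in>I. P i J) \<le> (\<Sum>i\<in>I. Pr (P i))"
proof (induction I rule: finite_induct)
  case empty
  then show ?case by (simp add: Pr_def Ex_const)
next
  case (insert i I)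
  then show ?case using Pr_disj[of "P i" "\<lambda>J. \<exists>i\<in>I. P i J"] by simp
qed

lemma markov:
  assumes "\<And>J. J \<in> \<Omega> \<Longrightarrow> 0 \<le> f J" "t > 0"
  shows "Pr (\<lambda>J. t \<le> f J) \<le> Ex f / t"
proof -
  have "Pr (\<lambda>J. t \<le> f J) \<le> Ex (\<lambda>J. (1 / t) * f J)"
    unfolding Pr_def using assms by (intro avg_mono) auto
  then show ?thesis unfolding avg_cmult by simp
qed

end

text \<open>\<open>K\<close> is going to be the set of non-constant columns: a constant column
  violates \<open>u_mean\<close>. Removing it is the reason for asking \<open>card K \<le> k\<close>
  instead of equality.\<close>

locale frame = sampling K N m for K :: "nat set" and N m :: nat +
  fixes u :: "nat \<Rightarrow> nat \<Rightarrow> complex" and k :: nat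
  assumes card_K: "card K \<le> k"
    and k_pos: "k \<ge> 1"
    and u_supp: "s \<notin> K \<Longrightarrow> u j s = 0"
    and u_unit: "s \<in> K \<Longrightarrow> cmod (u j s) = 1"
    and u_mean: "(\<Sum>j=1..N. u j s) = 0"
    and u_iso: "s \<in> K \<Longrightarrow> t \<in> K \<Longrightarrow> (\<Sum>j=1..N. u j s * cnj (u j t)) = (if s = t then of_nat N else 0)"
begin

lemma nv_u: "nv (u j) \<le> real k"
  using card_K by (simp add: nv_def u_unit)

lemma u_iso_eye: "(\<Sum>j=1..N. u j s * cnj (u j t)) = of_real (real N) * eye s t"
proof (cases "s \<in> K \<and> t \<in> K")
  case True
  then show ?thesis using u_iso[of s t] by (simp add: eye_def)
next
  case False
  then have z: "u j s * cnj (u j t) = 0" for j using u_supp by auto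
  show ?thesis using False unfolding z by (auto simp: eye_def)
qed

text \<open>Isotropy says that \<open>u u*\<close> has mean one. A fresh row therefore sees
  \<open>W\<close> only through its Hilbert-Schmidt norm, with no dimensional factor.\<close>

lemma Ej_nv: "Ej (\<lambda>j. nv (av W (u j))) = hs W"
proof -
  have "(\<Sum>j=1..N. 1 * nv (av W (u j))) = real N * hs W"
    unfolding sum_nv_av ip_mm_eye[symmetric] u_iso_eye[symmetric] by simp
  then show ?thesis using N_pos by (simp add: avg_def)
qed

definition lincomb :: "(nat \<Rightarrow> real) \<Rightarrow> (nat \<Rightarrow> nat) \<Rightarrow> nat \<Rightarrow> complex" where
  "lincomb c J s = (\<Sum>r=1..m. of_real (c r) * u (J r) s)"

text \<open>The squared norm is a sum of at most \<open>2 k\<close> squares of real scalar sums, one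
  for each real or imaginary part of a coordinate. Jensen's inequality over these parts costs
  \<open>(2 k)^q\<close>.\<close>

lemma subgaussian:
  assumes q: "q \<ge> 1"
  shows "Ex (\<lambda>J. nv (lincomb c J) ^ q) \<le> (8 * real k * real q * (\<Sum>r=1..m. (c r)\<^sup>2)) ^ q"
proof -
  define s where "s = (\<Sum>r=1..m. (c r)\<^sup>2)"
  define part where "part b z = (if b then Re z else Im z)" for b :: bool and z
  define A where "A = K \<times> (UNIV :: bool set)"
  define x where "x a J = (\<Sum>r=1..m. c r * part (snd a) (u (J r) (fst a)))" for a J
  have finA: "finite A" using finite_K by (simp add: A_def)
  have cA: "card A = 2 * card K" by (simp add: A_def card_cartesian_product)
  have part_sum: "part b (\<Sum>i\<in>I. f i) = (\<Sum>i\<in>I. part b (f i))" for b I and f :: "nat \<Rightarrow> complex"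
    by (simp add: part_def)
  have x_eq: "x a J = part (snd a) (lincomb c J (fst a))" for a J
    unfolding lincomb_def part_sum x_def by (intro sum.cong refl) (simp add: part_def)
  have nv: "nv (lincomb c J) = (\<Sum>a\<in>A. (x a J)\<^sup>2)" for J
  proof -
    have "(\<Sum>a\<in>A. (x a J)\<^sup>2) = (\<Sum>i\<in>K. \<Sum>b\<in>UNIV. (part b (lincomb c J i))\<^sup>2)"
      by (simp add: A_def x_eq sum.cartesian_product case_prod_beta)
    then show ?thesis by (simp add: nv_def part_def UNIV_bool cmod_power2 add.commute)
  qed
  have each: "Ex (\<lambda>J. ((x a J)\<^sup>2) ^ q) \<le> (4 * real q * s) ^ q" if "a \<in> A" for a
  proof -
    have "Ex (\<lambda>J. x a J ^ (2 * q)) \<le> (4 * real q * s) ^ q"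
      unfolding x_def s_def
    proof (rule subgaussian_scalar)
      show "\<bar>part (snd a) (u j (fst a))\<bar> \<le> 1" for j
        using u_unit[of "fst a" j] that abs_Re_le_cmod[of "u j (fst a)"] abs_Im_le_cmod[of "u j (fst a)"]
        by (auto simp: part_def A_def)
      show "(\<Sum>j=1..N. part (snd a) (u j (fst a))) = 0"
        unfolding part_sum[symmetric] u_mean by (simp add: part_def)
    qed simp
    then show ?thesis by (simp only: power_mult)
  qed
  have s0: "s \<ge> 0" by (simp add: s_def sum_nonneg)
  have "Ex (\<lambda>J. nv (lincomb c J) ^ q) \<le> Ex (\<lambda>J. real (card A) ^ q * avg A (\<lambda>a. ((x a J)\<^sup>2) ^ q))"
    unfolding nv using finA q by (intro avg_mono power_sum_le) auto
  also have "\<dots> = real (card A) ^ q * avg A (\<lambda>a. Ex (\<lambda>J. ((x a J)\<^sup>2) ^ q))"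
    unfolding avg_cmult by (simp add: avg_def sum_divide_distrib[symmetric])
      (subst sum.swap, simp)
  also have "\<dots> \<le> real (card A) ^ q * avg A (\<lambda>a. (4 * real q * s) ^ q)"
    using each by (intro mult_left_mono avg_mono) auto
  also have "\<dots> \<le> real (card A) ^ q * (4 * real q * s) ^ q"
    using finA s0 by (intro mult_left_mono avg_const_le) auto
  also have "\<dots> \<le> (2 * real k) ^ q * (4 * real q * s) ^ q"
    using s0 cA card_K by (intro mult_right_mono power_mono) auto
  also have "\<dots> = (8 * real k * real q * s) ^ q"
  proof -
    have "(2 * real k) * (4 * real q * s) = 8 * real k * real q * s" by simp
    then show ?thesis by (simp only: power_mult_distrib[symmetric])
  qed
  finally show ?thesis unfolding s_def .
qed

text \<open>Markov's inequality at order \<open>q\<close>; the level is 8 times the scale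
  \<open>8 k q s\<close> of the moment bound, which yields \<open>8^(-q)\<close>.\<close>

lemma subgaussian_tail:
  assumes q: "q \<ge> 1" and s: "(\<Sum>r=1..m. (c r)\<^sup>2) \<le> s" "s > 0"
  shows "Pr (\<lambda>J. 64 * real k * real q * s \<le> nv (lincomb c J)) \<le> 1 / 8 ^ q"
proof -
  define t where "t = 64 * real k * real q * s"
  have t: "t > 0" using k_pos q s by (simp add: t_def)
  have "Pr (\<lambda>J. t \<le> nv (lincomb c J)) \<le> Pr (\<lambda>J. t ^ q \<le> nv (lincomb c J) ^ q)"
    using t by (intro Pr_mono power_mono) auto
  also have "\<dots> \<le> Ex (\<lambda>J. nv (lincomb c J) ^ q) / t ^ q"
    using t nv_nonneg by (intro markov) auto
  also have "\<dots> \<le> (8 * real k * real q * s) ^ q / t ^ q"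
  proof (rule divide_right_mono)
    have "(8 * real k * real q * (\<Sum>r=1..m. (c r)\<^sup>2)) ^ q \<le> (8 * real k * real q * s) ^ q"
      using s by (intro power_mono mult_left_mono mult_nonneg_nonneg sum_nonneg) auto
    then show "Ex (\<lambda>J. nv (lincomb c J) ^ q) \<le> (8 * real k * real q * s) ^ q"
      using subgaussian[OF q, of c] by linarith
  qed (use t in auto)
  also have "\<dots> = 1 / 8 ^ q"
  proof -
    have "8 * real k * real q * s / t = 1 / 8" using k_pos q s by (simp add: t_def)
    then show ?thesis by (metis power_divide power_one)
  qed
  finally show ?thesis by (simp add: t_def)
qed

text \<open>Needed for two weights: \<open>b r = P r r\<close> gives the diagonal part of the form,
  and \<open>b r = 1\<close> controls the norm of the sampled matrix, on which the chaos estimate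
  depends.\<close>

definition weighted :: "(nat \<Rightarrow> real) \<Rightarrow> (nat \<Rightarrow> nat) \<Rightarrow> cmat" where
  "weighted b J i j = (\<Sum>r=1..m. of_real (b r) * (u (J r) i * cnj (u (J r) j))) - of_real (\<Sum>r=1..m. b r) * eye i j"

lemma herm_weighted: "herm (weighted b J)"
proof (rule hermI)
  show "weighted b J j i = cnj (weighted b J i j)" for i j
    by (auto simp: weighted_def eye_def mult.commute)
  show "weighted b J i j = 0" if "i \<notin> K" for i j
    using that by (simp add: weighted_def eye_def u_supp)
qed

lemma sum_nv_weighted:
  "(\<Sum>r=1..m. b r * nv (av W (u (J r)))) = ip (mm W (weighted b J)) W + (\<Sum>r=1..m. b r) * hs W"
proof -
  have "(\<lambda>i j. \<Sum>r=1..m. of_real (b r) * (u (J r) i * cnj (u (J r) j)))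
    = (\<lambda>i j. weighted b J i j + of_real (\<Sum>r=1..m. b r) * eye i j)"
    by (intro ext) (simp add: weighted_def)
  then show ?thesis
    unfolding sum_nv_av by (simp only: mm_add_right ip_add_left ip_mm_eye)
qed

context
  fixes b :: "nat \<Rightarrow> real" and B \<beta> :: real
  assumes b: "\<And>r. r \<in> {1..m} \<Longrightarrow> 0 \<le> b r \<and> b r \<le> B"
    and B: "B > 0"
    and beta: "\<beta> = (\<Sum>r=1..m. b r)"
begin

lemma beta_nonneg: "\<beta> \<ge> 0"
  unfolding beta using b by (intro sum_nonneg) auto

text \<open>Replacing row \<open>r\<close> changes the matrix by \<open>b r\<close> times a
  difference of two rank-one matrices. Bounding \<open>(b r)^2\<close> by \<open>B * b r\<close>
  retains one weight, so that the sum over \<open>r\<close> is again of the kind evaluated by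
  \<open>sum_nv_weighted\<close>.\<close>

lemma weighted_step:
  "Ex (\<lambda>J. hs (pw (weighted b J) (Suc M))) \<le> real (2 * M + 1) * real k * B *
    Ex (\<lambda>J. (\<Sum>r=1..m. b r * nv (av (pw (weighted b J) M) (u (J r)))) + \<beta> * hs (pw (weighted b J) M))"
proof -
  define Y where "Y = weighted b"
  have dY: "Y J - Y (J(r := t)) = (\<lambda>i j. of_real (b r) * (outer (u (J r)) (u (J r)) - outer (u t) (u t)) i j)"
    if "r \<in> {1..m}" for J r t
    unfolding Y_def weighted_def
    using sum_diff_upd[OF _ that, of "\<lambda>r t. of_real (b r) * (u t _ * cnj (u t _))" J t]
    by (intro ext) (simp add: outer_def right_diff_distrib)
  have "1 * Ex (\<lambda>J. hs (pw (Y J) (Suc M))) \<le> real (2 * M + 1) / 2 *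
    (\<Sum>r=1..m. Ex (\<lambda>J. Ej (\<lambda>j. hs (mm (pw (Y J) M) (Y J - Y (J(r := j)))))))"
  proof (rule stein)
    show "herm (Y J)" for J unfolding Y_def by (rule herm_weighted)
    fix J i j
    have "(\<Sum>r=1..m. \<Sum>t=1..N. (Y J - Y (J(r := t))) i j)
      = (\<Sum>r=1..m. \<Sum>t=1..N. of_real (b r) * (u (J r) i * cnj (u (J r) j) - u t i * cnj (u t j)))"
      by (intro sum.cong refl) (subst dY, auto simp: outer_def)
    also have "\<dots> = (\<Sum>r=1..m. of_real (b r) * (of_nat N * (u (J r) i * cnj (u (J r) j)) - of_real (real N) * eye i j))"
      unfolding sum_distrib_left[symmetric] sum_subtractf u_iso_eye by (simp add: mult.left_commute)
    also have "\<dots> = of_real (real N) * ((\<Sum>r=1..m. of_real (b r) * (u (J r) i * cnj (u (J r) j)))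
      - (\<Sum>r=1..m. of_real (b r) * eye i j))"
      by (simp add: sum_distrib_left sum_subtractf algebra_simps)
    finally show "(\<Sum>r=1..m. \<Sum>t=1..N. (Y J - Y (J(r := t))) i j) = of_real (1 * real N) * Y J i j"
      by (simp add: Y_def weighted_def sum_distrib_right)
  qed
  also have "(\<Sum>r=1..m. Ex (\<lambda>J. Ej (\<lambda>j. hs (mm (pw (Y J) M) (Y J - Y (J(r := j)))))))
    \<le> (\<Sum>r=1..m. Ex (\<lambda>J. 2 * real k * B * (b r * nv (av (pw (Y J) M) (u (J r))) + b r * hs (pw (Y J) M))))"
  proof (intro sum_mono avg_mono)
    fix r J assume r: "r \<in> {1..m}"
    define W where "W = pw (Y J) M"
    define v where "v = u (J r)"
    have "hs (mm W (Y J - Y (J(r := t)))) \<le> 2 * real k * B * (b r * nv (av W v)) + 2 * real k * B * b r * nv (av W (u t))" for t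
    proof -
      have "hs (mm W (Y J - Y (J(r := t)))) = (b r)\<^sup>2 * hs (mm W (outer v v) - mm W (outer (u t) (u t)))"
        unfolding dY[OF r] mm_scale hs_scale mm_diff_right v_def by (simp add: fun_diff_def)
      also have "\<dots> \<le> (b r)\<^sup>2 * (2 * hs (mm W (outer v v)) + 2 * hs (mm W (outer (u t) (u t))))"
        by (intro mult_left_mono hs_diff_le) auto
      also have "\<dots> = (b r)\<^sup>2 * (2 * (nv (av W v) * nv v) + 2 * (nv (av W (u t)) * nv (u t)))"
        by (simp add: mm_outer hs_outer)
      also have "\<dots> \<le> (B * b r) * (2 * (nv (av W v) * real k) + 2 * (nv (av W (u t)) * real k))"
        using b[OF r] B nv_nonneg nv_u unfolding v_def power2_eq_square
        by (intro mult_mono add_mono mult_left_mono mult_right_mono add_nonneg_nonneg mult_nonneg_nonneg) auto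
      finally show ?thesis by (simp add: algebra_simps)
    qed
    then have "Ej (\<lambda>t. hs (mm W (Y J - Y (J(r := t))))) \<le>
      Ej (\<lambda>t. 2 * real k * B * (b r * nv (av W v)) + 2 * real k * B * b r * nv (av W (u t)))"
      by (intro avg_mono)
    also have "\<dots> = 2 * real k * B * (b r * nv (av W v) + b r * hs W)"
      unfolding avg_add avg_cmult Ej_nv Ej_const by (simp add: algebra_simps)
    finally show "Ej (\<lambda>t. hs (mm (pw (Y J) M) (Y J - Y (J(r := t))))) \<le>
      2 * real k * B * (b r * nv (av (pw (Y J) M) (u (J r))) + b r * hs (pw (Y J) M))"
      by (simp add: W_def v_def)
  qed
  also have "\<dots> = 2 * real k * B * Ex (\<lambda>J. (\<Sum>r=1..m. b r * nv (av (pw (Y J) M) (u (J r)))) + \<beta> * hs (pw (Y J) M))"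
    unfolding avg_cmult sum_distrib_left[symmetric] avg_sum[symmetric] beta
    by (simp only: sum.distrib sum_distrib_right)
  finally show ?thesis by (simp add: Y_def mult_left_mono)
qed

text \<open>Rudelson's inequality in moment form. Starting the recursion at \<open>M = 0\<close>
  with the Hilbert-Schmidt norm keeps the bound independent of the dimension.\<close>

lemma weighted_moment:
  assumes M: "Suc M \<le> p" and a: "a = 2 * real p * real k * B"
  shows "Ex (\<lambda>J. hs (pw (weighted b J) (Suc M))) \<le> (a\<^sup>2 + 4 * a * \<beta>) ^ M * (2 * (real k)\<^sup>2 * B * \<beta>)"
  using M
proof (induction M)
  case 0
  have "Ex (\<lambda>J. hs (pw (weighted b J) (Suc 0))) \<le> real (2 * 0 + 1) * real k * B *
    Ex (\<lambda>J. (\<Sum>r=1..m. b r * nv (av (pw (weighted b J) 0) (u (J r)))) + \<beta> * hs (pw (weighted b J) 0))"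
    by (rule weighted_step)
  also have "\<dots> \<le> real (2 * 0 + 1) * real k * B * Ex (\<lambda>J. (\<Sum>r=1..m. b r * real k) + \<beta> * real k)"
    using b B nv_u card_K beta_nonneg
    by (intro mult_left_mono avg_mono add_mono sum_mono) (auto simp: nv_av_eye hs_eye)
  also have "\<dots> = 2 * (real k)\<^sup>2 * B * \<beta>"
    by (simp add: Ex_const beta sum_distrib_right[symmetric] power2_eq_square)
  finally show ?case by simp
next
  case (Suc M)
  define S where "S n J = hs (pw (weighted b J) n)" for n J
  define T where "T J = ip (pw (weighted b J) (Suc M)) (pw (weighted b J) (Suc (Suc M)))" for J
  have a0: "a > 0" using a B k_pos Suc.prems by simp
  \<comment> \<open>Here the recursion closes: the sum over the rows is the odd moment
    \<open>T\<close> of the same matrix plus a multiple of its even moment.\<close>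
  have sumT: "(\<Sum>r=1..m. b r * nv (av (pw (weighted b J) (Suc M)) (u (J r)))) = T J + \<beta> * S (Suc M) J" for J
    unfolding sum_nv_weighted pw_Suc2[OF herm_weighted] T_def S_def beta
    by (simp only: ip_commute)
  have "Ex (S (Suc (Suc M))) \<le> real (2 * Suc M + 1) * real k * B * Ex (\<lambda>J. (T J + \<beta> * S (Suc M) J) + \<beta> * S (Suc M) J)"
    using weighted_step[of "Suc M"] unfolding sumT S_def[symmetric] .
  also have "\<dots> \<le> a * Ex (\<lambda>J. (T J + \<beta> * S (Suc M) J) + \<beta> * S (Suc M) J)"
  proof (rule mult_right_mono)
    show "real (2 * Suc M + 1) * real k * B \<le> a"
      unfolding a using B Suc.prems by (intro mult_right_mono) auto
    show "0 \<le> Ex (\<lambda>J. (T J + \<beta> * S (Suc M) J) + \<beta> * S (Suc M) J)"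
      unfolding sumT[symmetric] unfolding S_def using b nv_nonneg hs_nonneg beta_nonneg
      by (intro avg_nonneg add_nonneg_nonneg sum_nonneg mult_nonneg_nonneg) auto
  qed
  also have "\<dots> = Ex (\<lambda>J. a * T J + 2 * a * \<beta> * S (Suc M) J)"
    unfolding avg_cmult[symmetric] by (simp add: algebra_simps)
  \<comment> \<open>With weight \<open>a\<close> exactly half of the top moment stays on the right,
    and it is then absorbed on the left.\<close>
  also have "\<dots> \<le> Ex (\<lambda>J. (a\<^sup>2 / 2 + 2 * a * \<beta>) * S (Suc M) J + (1/2) * S (Suc (Suc M)) J)"
  proof (rule avg_mono)
    fix J
    have "a * (2 * T J) \<le> a * (a * S (Suc M) J + S (Suc (Suc M)) J / a)"
      unfolding T_def S_def using a0 by (intro mult_left_mono two_ip_le) auto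
    then show "a * T J + 2 * a * \<beta> * S (Suc M) J \<le> (a\<^sup>2 / 2 + 2 * a * \<beta>) * S (Suc M) J + (1/2) * S (Suc (Suc M)) J"
      using a0 by (simp add: algebra_simps power2_eq_square)
  qed
  also have "\<dots> = (a\<^sup>2 / 2 + 2 * a * \<beta>) * Ex (S (Suc M)) + (1/2) * Ex (S (Suc (Suc M)))"
    by (simp only: avg_add avg_cmult)
  finally have "Ex (S (Suc (Suc M))) \<le> (a\<^sup>2 + 4 * a * \<beta>) * Ex (S (Suc M))"
    by (simp add: algebra_simps)
  also have "\<dots> \<le> (a\<^sup>2 + 4 * a * \<beta>) * ((a\<^sup>2 + 4 * a * \<beta>) ^ M * (2 * (real k)\<^sup>2 * B * \<beta>))"
    using Suc a0 beta_nonneg unfolding S_def by (intro mult_left_mono) auto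
  finally show ?case by (simp add: S_def[abs_def] mult.assoc del: pw.simps)
qed

text \<open>Markov's inequality for \<open>tr Y^(2p)\<close>, with \<open>9^(-p)\<close> coming from
  the factor 9 in \<open>L\<close>. The starting moment \<open>2 k^2 B \<beta>\<close> divided by
  \<open>A \<ge> 4 k^2 B^2\<close> leaves at most \<open>\<beta> / B\<close>, an effective
  dimension, as prefactor.\<close>

lemma weighted_tail:
  assumes p: "p \<ge> 1" and a: "a = 2 * real p * real k * B" and L: "9 * (a\<^sup>2 + 4 * a * \<beta>) \<le> \<Lambda>\<^sup>2" "\<Lambda> > 0"
  shows "Pr (\<lambda>J. \<not> (\<forall>x. cmod (\<Sum>i\<in>K. cnj (x i) * av (weighted b J) x i) \<le> \<Lambda> * nv x)) \<le> \<beta> / B / 9 ^ p"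
proof -
  define A where "A = a\<^sup>2 + 4 * a * \<beta>"
  obtain M where M: "p = Suc M" using p by (cases p) auto
  have a0: "a > 0" using a B k_pos p by simp
  have A: "A \<ge> 4 * (real k)\<^sup>2 * B\<^sup>2" "A > 0"
  proof -
    have "(2 * real k * B)\<^sup>2 \<le> a\<^sup>2" unfolding a using p B by (intro power_mono mult_right_mono) auto
    moreover have "0 \<le> 4 * a * \<beta>" using a0 beta_nonneg by simp
    moreover have "4 * (real k)\<^sup>2 * B\<^sup>2 = (2 * real k * B)\<^sup>2" by (simp add: power_mult_distrib)
    ultimately show "A \<ge> 4 * (real k)\<^sup>2 * B\<^sup>2" unfolding A_def by linarith
    show "A > 0" using a0 beta_nonneg by (simp add: A_def add_pos_nonneg)
  qed
  have L0: "(9 * A) ^ p \<le> \<Lambda> ^ (2 * p)"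
    unfolding power_mult using A L by (intro power_mono) (auto simp: A_def)
  have "Pr (\<lambda>J. \<not> (\<forall>x. cmod (\<Sum>i\<in>K. cnj (x i) * av (weighted b J) x i) \<le> \<Lambda> * nv x))
    \<le> Pr (\<lambda>J. \<Lambda> ^ (2 * p) \<le> hs (pw (weighted b J) p))"
  proof (rule Pr_mono)
    fix J assume "\<not> (\<forall>x. cmod (\<Sum>i\<in>K. cnj (x i) * av (weighted b J) x i) \<le> \<Lambda> * nv x)"
    then have "\<not> hs (pw (weighted b J) (Suc M)) \<le> \<Lambda> ^ (2 * Suc M)"
      using quadratic_form_le[OF herm_weighted] L by (meson less_eq_real_def)
    then show "\<Lambda> ^ (2 * p) \<le> hs (pw (weighted b J) p)" unfolding M by linarith
  qed
  also have "\<dots> \<le> Ex (\<lambda>J. hs (pw (weighted b J) p)) / \<Lambda> ^ (2 * p)"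
    using L hs_nonneg by (intro markov) auto
  also have "\<dots> \<le> (A ^ M * (2 * (real k)\<^sup>2 * B * \<beta>)) / \<Lambda> ^ (2 * p)"
    using weighted_moment[of M p a] a L unfolding M A_def by (intro divide_right_mono) auto
  also have "\<dots> \<le> (A ^ M * (2 * (real k)\<^sup>2 * B * \<beta>)) / (9 * A) ^ p"
    using L0 L(2) A beta_nonneg B by (intro divide_left_mono mult_pos_pos) (auto intro!: mult_nonneg_nonneg)
  also have "\<dots> = (2 * (real k)\<^sup>2 * B * \<beta>) / A / 9 ^ p"
    using A by (simp add: M power_mult_distrib field_simps)
  also have "\<dots> \<le> \<beta> / B / 9 ^ p"
  proof (rule divide_right_mono)
    have "\<beta> * (2 * (real k)\<^sup>2 * B\<^sup>2) \<le> \<beta> * A"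
    proof (rule mult_left_mono[OF _ beta_nonneg])
      have "(real k)\<^sup>2 * B\<^sup>2 \<ge> 0" by simp
      then show "2 * (real k)\<^sup>2 * B\<^sup>2 \<le> A" using A(1) by linarith
    qed
    then show "2 * (real k)\<^sup>2 * B * \<beta> / A \<le> \<beta> / B"
      using A B by (simp add: field_simps power2_eq_square)
  qed simp
  finally show ?thesis .
qed

end

end

section \<open>The off-diagonal chaos of a projection\<close>

text \<open>Because the entry \<open>R r r\<close> vanishes, no product of a changed
  \<open>x\<close> with a changed \<open>y\<close> occurs, and the increment is linear in each
  change.\<close>

lemma bilinear_upd:
  fixes R :: "nat \<Rightarrow> nat \<Rightarrow> 'a::comm_ring"
  assumes I: "finite I" "r \<in> I" and R: "R r r = 0"
    and eq: "\<And>i. i \<in> I \<Longrightarrow> i \<noteq> r \<Longrightarrow> x' i = x i \<and> y' i = y i"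
  shows "(\<Sum>i\<in>I. \<Sum>j\<in>I. R i j * (x i * y j)) - (\<Sum>i\<in>I. \<Sum>j\<in>I. R i j * (x' i * y' j))
    = (x r - x' r) * (\<Sum>j\<in>I. R r j * y j) + (\<Sum>i\<in>I. R i r * x i) * (y r - y' r)"
proof -
  have "R i j * (x i * y j) - R i j * (x' i * y' j)
    = (if i = r then (x r - x' r) * (R r j * y j) else 0) + (if j = r then R i r * x i * (y r - y' r) else 0)"
    if "i \<in> I" "j \<in> I" for i j
    using eq[OF that(1)] eq[OF that(2)] R by (auto simp: algebra_simps)
  then have "(\<Sum>i\<in>I. \<Sum>j\<in>I. R i j * (x i * y j)) - (\<Sum>i\<in>I. \<Sum>j\<in>I. R i j * (x' i * y' j))
    = (\<Sum>i\<in>I. \<Sum>j\<in>I. (if i = r then (x r - x' r) * (R r j * y j) else 0) + (if j = r then R i r * x i * (y r - y' r) else 0))"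
    unfolding sum_subtractf[symmetric] by (intro sum.cong refl) auto
  also have "\<dots> = (\<Sum>i\<in>I. if i = r then \<Sum>j\<in>I. (x r - x' r) * (R r j * y j) else 0)
    + (\<Sum>i\<in>I. \<Sum>j\<in>I. if j = r then R i r * x i * (y r - y' r) else 0)"
    unfolding sum.distrib by (intro arg_cong2[of _ _ _ _ "(+)"] sum.cong refl) auto
  also have "\<dots> = (\<Sum>j\<in>I. (x r - x' r) * (R r j * y j)) + (\<Sum>i\<in>I. R i r * x i * (y r - y' r))"
    using I by (simp add: sum.delta)
  finally show ?thesis by (simp only: sum_distrib_left sum_distrib_right)
qed

locale projected_frame = frame K N m u k for K :: "nat set" and N m :: nat
    and u :: "nat \<Rightarrow> nat \<Rightarrow> complex" and k :: nat +
  fixes P :: "nat \<Rightarrow> nat \<Rightarrow> real" and d :: real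
  assumes P_sym: "P r q = P q r"
    and P_idem: "r \<in> {1..m} \<Longrightarrow> t \<in> {1..m} \<Longrightarrow> (\<Sum>q=1..m. P r q * P q t) = P r t"
    and P_diag: "r \<in> {1..m} \<Longrightarrow> P r r \<le> d"
    and d_pos: "0 < d" and d_le: "d \<le> 1"
begin

definition R :: "nat \<Rightarrow> nat \<Rightarrow> real" where
  "R r q = (if q = r then 0 else P r q)"

definition Z :: "(nat \<Rightarrow> nat) \<Rightarrow> cmat" where
  "Z J i j = (\<Sum>r=1..m. \<Sum>q=1..m. of_real (R r q) * (u (J r) i * cnj (u (J q) j)))"

abbreviation h :: "(nat \<Rightarrow> nat) \<Rightarrow> nat \<Rightarrow> nat \<Rightarrow> complex" where
  "h J r \<equiv> lincomb (R r) J"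

lemma R_sym: "R r q = R q r"
  by (simp add: R_def P_sym)

text \<open>For a projection the squared norm of row \<open>r\<close> equals \<open>P r r\<close>;
  deleting the diagonal entry only lowers it.\<close>

lemma R_sq_sum: assumes "r \<in> {1..m}" shows "(\<Sum>q=1..m. (R r q)\<^sup>2) \<le> d"
proof -
  have "(\<Sum>q=1..m. (R r q)\<^sup>2) \<le> (\<Sum>q=1..m. P r q * P q r)"
  proof (rule sum_mono)
    show "(R r q)\<^sup>2 \<le> P r q * P q r" for q
      by (subst P_sym[of q r]) (simp add: R_def power2_eq_square)
  qed
  then show ?thesis using P_idem[OF assms assms] P_diag[OF assms] by simp
qed

lemma P_diag_nonneg: assumes "r \<in> {1..m}" shows "0 \<le> P r r"
proof -
  have "P r r = (\<Sum>q=1..m. (P r q)\<^sup>2)"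
    unfolding P_idem[OF assms assms, symmetric] power2_eq_square by (intro sum.cong refl) (simp only: P_sym)
  then show ?thesis by (simp add: sum_nonneg)
qed

lemma Z_eq: "Z J i j = (\<Sum>r=1..m. u (J r) i * cnj (h J r j))"
  by (simp add: Z_def lincomb_def sum_distrib_left mult_ac)

lemma Z_eq': "Z J i j = (\<Sum>r=1..m. h J r i * cnj (u (J r) j))"
  unfolding Z_def lincomb_def sum_distrib_right
  by (subst sum.swap) (simp add: R_sym mult_ac)

lemma herm_Z: "herm (Z J)"
proof (rule hermI)
  show "Z J j i = cnj (Z J i j)" for i j
    unfolding Z_eq[of J j i] Z_eq'[of J i j] by (simp add: mult.commute)
  show "Z J i j = 0" if "i \<notin> K" for i j
    using that by (simp add: Z_def u_supp)
qed

lemma Z_diff: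
  assumes "r \<in> {1..m}"
  shows "Z J - Z (J(r := t)) = (\<lambda>i j. outer (\<lambda>i. u (J r) i - u t i) (h J r) i j
    + outer (h J r) (\<lambda>i. u (J r) i - u t i) i j)"
proof (intro ext)
  fix i j
  have "(Z J - Z (J(r := t))) i j = (u (J r) i - u t i) * (\<Sum>q=1..m. of_real (R r q) * cnj (u (J q) j))
     + (\<Sum>q=1..m. of_real (R q r) * u (J q) i) * (cnj (u (J r) j) - cnj (u t j))"
    using bilinear_upd[of "{1..m}" r "\<lambda>r q. of_real (R r q)" "\<lambda>q. u ((J(r := t)) q) i" "\<lambda>q. u (J q) i"
      "\<lambda>q. cnj (u ((J(r := t)) q) j)" "\<lambda>q. cnj (u (J q) j)"] assms
    by (simp add: Z_def R_def)
  then show "(Z J - Z (J(r := t))) i j = outer (\<lambda>i. u (J r) i - u t i) (h J r) i j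
    + outer (h J r) (\<lambda>i. u (J r) i - u t i) i j"
    by (simp add: outer_def lincomb_def R_sym[of _ r])
qed

text \<open>With \<open>W = pw (Z J) M\<close> this bounds the sum over \<open>r\<close> of
  \<open>hs (mm W (Z J - Z J'))\<close>, averaged over the new row. The constants come from using
  \<open>|a + b|^2 \<le> 2 |a|^2 + 2 |b|^2\<close> for the two outer products and for the difference
  of the old and the new row.\<close>

definition \<Phi> :: "nat \<Rightarrow> (nat \<Rightarrow> nat) \<Rightarrow> real" where
  "\<Phi> M J = (\<Sum>r=1..m. 4 * nv (h J r) * (nv (av (pw (Z J) M) (u (J r))) + hs (pw (Z J) M))
    + 8 * real k * nv (av (pw (Z J) M) (h J r)))"

lemma Phi_nonneg: "0 \<le> \<Phi> M J"
  unfolding \<Phi>_def using nv_nonneg hs_nonneg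
  by (intro sum_nonneg add_nonneg_nonneg mult_nonneg_nonneg) auto

text \<open>Every term of \<open>Z\<close> contains two sampled rows and is counted once for each of
  them, so the averaged differences give \<open>2 Z\<close>. The constant
  \<open>\<gamma> = 2\<close> turns the usual denominator 2 into 4.\<close>

lemma chaos_step:
  "Ex (\<lambda>J. hs (pw (Z J) (Suc M))) \<le> real (2 * M + 1) / 4 * Ex (\<Phi> M)"
proof -
  have "2 * Ex (\<lambda>J. hs (pw (Z J) (Suc M))) \<le> real (2 * M + 1) / 2 *
    (\<Sum>r=1..m. Ex (\<lambda>J. Ej (\<lambda>j. hs (mm (pw (Z J) M) (Z J - Z (J(r := j)))))))"
  proof (rule stein)
    show "herm (Z J)" for J by (rule herm_Z)
    fix J i j
    have "(\<Sum>r=1..m. \<Sum>t=1..N. (Z J - Z (J(r := t))) i j)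
      = (\<Sum>r=1..m. \<Sum>t=1..N. (u (J r) i - u t i) * cnj (h J r j) + h J r i * cnj (u (J r) j - u t j))"
      by (intro sum.cong refl) (subst Z_diff, auto simp: outer_def)
    also have "\<dots> = (\<Sum>r=1..m. of_nat N * (u (J r) i * cnj (h J r j)) + of_nat N * (h J r i * cnj (u (J r) j)))"
    proof (intro sum.cong refl)
      fix r
      have 1: "(\<Sum>t=1..N. u (J r) i - u t i) = of_nat N * u (J r) i" for i
        unfolding sum_subtractf u_mean by simp
      show "(\<Sum>t=1..N. (u (J r) i - u t i) * cnj (h J r j) + h J r i * cnj (u (J r) j - u t j))
        = of_nat N * (u (J r) i * cnj (h J r j)) + of_nat N * (h J r i * cnj (u (J r) j))"
        unfolding sum.distrib sum_distrib_left[symmetric] sum_distrib_right[symmetric] cnj_sum[symmetric] 1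
        by (simp add: mult_ac)
    qed
    also have "\<dots> = of_real (2 * real N) * Z J i j"
      unfolding sum.distrib sum_distrib_left[symmetric] Z_eq[symmetric] Z_eq'[symmetric] by simp
    finally show "(\<Sum>r=1..m. \<Sum>t=1..N. (Z J - Z (J(r := t))) i j) = of_real (2 * real N) * Z J i j" .
  qed
  also have "(\<Sum>r=1..m. Ex (\<lambda>J. Ej (\<lambda>j. hs (mm (pw (Z J) M) (Z J - Z (J(r := j)))))))
    \<le> (\<Sum>r=1..m. Ex (\<lambda>J. 4 * nv (h J r) * (nv (av (pw (Z J) M) (u (J r))) + hs (pw (Z J) M))
    + 8 * real k * nv (av (pw (Z J) M) (h J r))))"
  proof (intro sum_mono avg_mono)
    fix r J assume r: "r \<in> {1..m}"
    define W where "W = pw (Z J) M"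
    define v where "v = u (J r)"
    define g where "g = h J r"
    have "hs (mm W (Z J - Z (J(r := t)))) \<le> (4 * nv g * nv (av W v) + 8 * real k * nv (av W g)) + 4 * nv g * nv (av W (u t))" for t
    proof -
      define a where "a = (\<lambda>i. v i - u t i)"
      have "hs (mm W (Z J - Z (J(r := t)))) = hs (\<lambda>i j. mm W (outer a g) i j + mm W (outer g a) i j)"
        unfolding Z_diff[OF r] mm_add_right a_def v_def g_def by simp
      also have "\<dots> \<le> 2 * (nv (av W a) * nv g) + 2 * (nv (av W g) * nv a)"
        using hs_add_le[of "mm W (outer a g)" "mm W (outer g a)"] by (simp add: mm_outer hs_outer)
      also have "\<dots> \<le> 2 * ((2 * nv (av W v) + 2 * nv (av W (u t))) * nv g) + 2 * (nv (av W g) * (4 * real k))"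
      proof (intro add_mono mult_left_mono mult_right_mono)
        show "nv (av W a) \<le> 2 * nv (av W v) + 2 * nv (av W (u t))"
          unfolding a_def av_diff by (rule nv_diff_le)
        show "nv a \<le> 4 * real k"
          using nv_diff_le[of v "u t"] nv_u[of "J r"] nv_u[of t] unfolding a_def v_def by linarith
      qed (use nv_nonneg in auto)
      finally show ?thesis by (simp add: algebra_simps)
    qed
    then have "Ej (\<lambda>t. hs (mm W (Z J - Z (J(r := t))))) \<le>
      Ej (\<lambda>t. (4 * nv g * nv (av W v) + 8 * real k * nv (av W g)) + 4 * nv g * nv (av W (u t)))"
      by (intro avg_mono)
    also have "\<dots> = 4 * nv g * (nv (av W v) + hs W) + 8 * real k * nv (av W g)"
      unfolding avg_add avg_cmult Ej_nv Ej_const by (simp add: algebra_simps)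
    finally show "Ej (\<lambda>t. hs (mm (pw (Z J) M) (Z J - Z (J(r := t))))) \<le>
      4 * nv (h J r) * (nv (av (pw (Z J) M) (u (J r))) + hs (pw (Z J) M))
      + 8 * real k * nv (av (pw (Z J) M) (h J r))"
      by (simp add: W_def v_def g_def)
  qed
  also have "\<dots> = Ex (\<Phi> M)" unfolding avg_sum[symmetric] \<Phi>_def ..
  finally show ?thesis by (simp add: mult_left_mono)
qed

text \<open>Put \<open>g r = h J r + P r r u (J r)\<close>, the projection applied to all sampled
  rows. Since \<open>P\<close> is idempotent, the sum of \<open>g r (g r)*\<close> equals
  \<open>Z\<close> plus the diagonal terms, so the vectors \<open>h J r\<close> lead back to
  \<open>Z\<close> itself. The factor \<open>4 d\<close> collects \<open>2 d\<close> from that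
  diagonal and \<open>2 d\<close> from passing between \<open>g\<close> and
  \<open>h\<close>.\<close>

lemma sum_nv_h:
  "(\<Sum>r=1..m. nv (av W (h J r))) \<le>
    2 * ip (mm W (Z J)) W + 4 * d * (\<Sum>r=1..m. nv (av W (u (J r))))"
proof -
  define g where "g r = lincomb (P r) J" for r
  have h: "h J r = (\<lambda>i. g r i - of_real (P r r) * u (J r) i)" if "r \<in> {1..m}" for r
  proof
    fix i
    have "g r i - of_real (P r r) * u (J r) i
      = g r i - (\<Sum>q=1..m. if q = r then of_real (P r r) * u (J r) i else 0)"
      using that by (simp add: sum.delta)
    also have "\<dots> = h J r i"
      unfolding g_def lincomb_def sum_subtractf[symmetric] by (intro sum.cong) (auto simp: R_def)
    finally show "h J r i = g r i - of_real (P r r) * u (J r) i" ..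
  qed
  have G: "(\<Sum>r=1..m. of_real 1 * (g r i * cnj (g r j)))
    = Z J i j + (\<Sum>r=1..m. of_real (P r r) * (u (J r) i * cnj (u (J r) j)))" for i j
  proof -
    have "(\<Sum>r=1..m. of_real 1 * (g r i * cnj (g r j)))
      = (\<Sum>r=1..m. \<Sum>q=1..m. \<Sum>t=1..m. of_real (P r q * P r t) * (u (J q) i * cnj (u (J t) j)))"
      unfolding g_def lincomb_def cnj_sum sum_product by (simp add: sum_distrib_left mult_ac)
    also have "\<dots> = (\<Sum>q=1..m. \<Sum>t=1..m. \<Sum>r=1..m. of_real (P r q * P r t) * (u (J q) i * cnj (u (J t) j)))"
      by (rule sum_swap3)
    also have "\<dots> = (\<Sum>q=1..m. \<Sum>t=1..m. of_real (P q t) * (u (J q) i * cnj (u (J t) j)))"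
    proof (intro sum.cong refl)
      fix q t assume "q \<in> {1..m}" "t \<in> {1..m}"
      from P_idem[OF this] have "(\<Sum>r=1..m. P r q * P r t) = P q t" by (simp add: P_sym[of q])
      then show "(\<Sum>r=1..m. of_real (P r q * P r t) * (u (J q) i * cnj (u (J t) j)))
        = of_real (P q t) * (u (J q) i * cnj (u (J t) j))"
        unfolding sum_distrib_right[symmetric] of_real_sum[symmetric] by simp
    qed
    also have "\<dots> = (\<Sum>q=1..m. (\<Sum>t=1..m. of_real (R q t) * (u (J q) i * cnj (u (J t) j)))
       + (\<Sum>t=1..m. if t = q then of_real (P q q) * (u (J q) i * cnj (u (J q) j)) else 0))"
      unfolding sum.distrib[symmetric] by (intro sum.cong refl) (auto simp: R_def)
    also have "\<dots> = Z J i j + (\<Sum>r=1..m. of_real (P r r) * (u (J r) i * cnj (u (J r) j)))"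
      unfolding sum.distrib Z_def by (simp add: sum.delta)
    finally show ?thesis .
  qed
  have g2: "(\<Sum>r=1..m. nv (av W (g r))) = ip (mm W (Z J)) W + (\<Sum>r=1..m. P r r * nv (av W (u (J r))))"
    using sum_nv_av[of "\<lambda>_. 1" W g "{1..m}"] unfolding G mm_add_right ip_add_left sum_nv_av[symmetric] by simp
  have "(\<Sum>r=1..m. nv (av W (h J r))) \<le> (\<Sum>r=1..m. 2 * nv (av W (g r)) + 2 * d * nv (av W (u (J r))))"
  proof (rule sum_mono)
    fix r assume r: "r \<in> {1..m}"
    have "nv (av W (\<lambda>i. of_real (P r r) * u (J r) i)) = (P r r)\<^sup>2 * nv (av W (u (J r)))"
    proof -
      have "av W (\<lambda>i. of_real (P r r) * u (J r) i) = (\<lambda>i. of_real (P r r) * av W (u (J r)) i)"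
        by (intro ext) (simp add: av_def sum_distrib_left mult_ac)
      then show ?thesis by (simp add: nv_def norm_mult power_mult_distrib sum_distrib_left)
    qed
    also have "\<dots> \<le> d * nv (av W (u (J r)))"
    proof (rule mult_right_mono)
      have "(P r r)\<^sup>2 \<le> d * 1" unfolding power2_eq_square
        using P_diag[OF r] P_diag_nonneg[OF r] d_le d_pos by (intro mult_mono) auto
      then show "(P r r)\<^sup>2 \<le> d" by simp
    qed (rule nv_nonneg)
    finally show "nv (av W (h J r)) \<le> 2 * nv (av W (g r)) + 2 * d * nv (av W (u (J r)))"
      using nv_diff_le[of "av W (g r)" "av W (\<lambda>i. of_real (P r r) * u (J r) i)"]
      unfolding h[OF r] av_diff by linarith
  qed
  also have "\<dots> = 2 * (ip (mm W (Z J)) W + (\<Sum>r=1..m. P r r * nv (av W (u (J r))))) + 2 * d * (\<Sum>r=1..m. nv (av W (u (J r))))"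
    unfolding g2[symmetric] by (simp add: sum.distrib sum_distrib_left)
  also have "\<dots> \<le> 2 * (ip (mm W (Z J)) W + (\<Sum>r=1..m. d * nv (av W (u (J r))))) + 2 * d * (\<Sum>r=1..m. nv (av W (u (J r))))"
    using P_diag nv_nonneg d_pos by (intro add_mono mult_left_mono sum_mono mult_right_mono) auto
  finally show ?thesis unfolding sum_distrib_left[symmetric] by (simp only: algebra_simps)
qed

lemma cmod_h_sq_le: "r \<in> {1..m} \<Longrightarrow> (cmod (h J r s))\<^sup>2 \<le> real m"
proof -
  assume r: "r \<in> {1..m}"
  have "(cmod (h J r s))\<^sup>2 \<le> (\<Sum>q=1..m. (R r q)\<^sup>2) * (\<Sum>q=1..m. (cmod (u (J q) s))\<^sup>2)"
    using cmod_sum_mult_sq_le[of "\<lambda>q. of_real (R r q)" "\<lambda>q. u (J q) s" "{1..m}"] by (simp add: lincomb_def)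
  also have "\<dots> \<le> 1 * (\<Sum>q=1..m. 1)"
  proof (intro mult_mono sum_mono)
    show "(cmod (u (J q) s))\<^sup>2 \<le> 1" for q
      using u_unit[of s "J q"] u_supp[of s "J q"] by (cases "s \<in> K") auto
  qed (use R_sq_sum[OF r] d_le in \<open>auto intro: sum_nonneg\<close>)
  finally show ?thesis by simp
qed

lemma nv_h_le: "r \<in> {1..m} \<Longrightarrow> nv (h J r) \<le> real k * real m"
proof -
  assume r: "r \<in> {1..m}"
  have "nv (h J r) \<le> (\<Sum>i\<in>K. real m)" unfolding nv_def by (intro sum_mono cmod_h_sq_le r)
  also have "\<dots> \<le> real k * real m" using card_K by (simp add: mult_right_mono)
  finally show ?thesis .
qed

text \<open>Entrywise Cauchy-Schwarz. The bound holds for every sample and is meant for the unlikely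
  event, where polynomial size is enough.\<close>

lemma hs_Z_le: "hs (Z J) \<le> (real k)\<^sup>2 * real m ^ 3"
proof -
  have "(cmod (Z J i j))\<^sup>2 \<le> real m ^ 3" for i j
  proof -
    have "(cmod (Z J i j))\<^sup>2 \<le> (\<Sum>r=1..m. (cmod (u (J r) i))\<^sup>2) * (\<Sum>r=1..m. (cmod (cnj (h J r j)))\<^sup>2)"
      unfolding Z_eq by (rule cmod_sum_mult_sq_le)
    also have "\<dots> \<le> (\<Sum>r=1..m. 1) * (\<Sum>r=1..m. real m)"
    proof (intro mult_mono sum_mono)
      show "(cmod (u (J q) s))\<^sup>2 \<le> 1" for q s
        using u_unit[of s "J q"] u_supp[of s "J q"] by (cases "s \<in> K") auto
      show "(cmod (cnj (h J r j)))\<^sup>2 \<le> real m" if "r \<in> {1..m}" for r using cmod_h_sq_le[OF that] by simp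
    qed (auto intro: sum_nonneg)
    finally show ?thesis by (simp add: power3_eq_cube)
  qed
  then have "hs (Z J) \<le> (\<Sum>i\<in>K. \<Sum>j\<in>K. real m ^ 3)" unfolding hs_eq by (intro sum_mono)
  also have "\<dots> = (real (card K))\<^sup>2 * real m ^ 3" by (simp add: power2_eq_square)
  also have "\<dots> \<le> (real k)\<^sup>2 * real m ^ 3" using card_K by (intro mult_right_mono power_mono) auto
  finally show ?thesis .
qed

text \<open>The second clause says that the largest eigenvalue of the sum of the
  \<open>u (J r) (u (J r))*\<close> is at most \<open>lam\<close>. Quantifying over all
  \<open>W\<close> lets it be applied directly to the powers of \<open>Z\<close>.\<close>

definition good :: "real \<Rightarrow> real \<Rightarrow> (nat \<Rightarrow> nat) \<Rightarrow> bool" where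
  "good \<tau> lam J \<longleftrightarrow> (\<forall>r\<in>{1..m}. nv (h J r) \<le> \<tau>) \<and>
    (\<forall>W. (\<Sum>r=1..m. nv (av W (u (J r)))) \<le> lam * hs W)"

text \<open>The signed odd moment comes from \<open>sum_nv_h\<close> for every sample and is kept in
  both cases; the event only decides how the remaining terms are bounded. Off the event
  \<open>40 = 8 + 32\<close> adds the trivial bounds for the two groups of terms.\<close>

lemma Phi_le:
  assumes "\<tau> \<ge> 0" "lam \<ge> 0" "M \<ge> 1"
  shows "\<Phi> M J \<le> (4 * \<tau> * (lam + real m) + 32 * real k * d * lam) * hs (pw (Z J) M)
    + 16 * real k * ip (pw (Z J) M) (pw (Z J) (Suc M))
    + (if good \<tau> lam J then 0 else 40 * (real k)\<^sup>2 * (real m)\<^sup>2 * ((real k)\<^sup>2 * real m ^ 3) ^ M)"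
proof -
  define W where "W = pw (Z J) M"
  define S where "S = hs W"
  define A where "A = (\<Sum>r=1..m. nv (av W (u (J r))))"
  have S0: "S \<ge> 0" unfolding S_def by (rule hs_nonneg)
  have A0: "A \<ge> 0" unfolding A_def by (intro sum_nonneg nv_nonneg)
  have ipW: "ip (mm W (Z J)) W = ip (pw (Z J) M) (pw (Z J) (Suc M))"
    unfolding W_def pw_Suc2[OF herm_Z] by (rule ip_commute)
  have main: "\<Phi> M J \<le> (\<Sum>r=1..m. 4 * nv (h J r) * (nv (av W (u (J r))) + S)) + 8 * real k * (2 * ip (mm W (Z J)) W + 4 * d * A)"
    unfolding \<Phi>_def sum.distrib W_def[symmetric] S_def[symmetric] sum_distrib_left[symmetric]
    unfolding A_def by (intro add_left_mono mult_left_mono sum_nv_h) auto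
  show ?thesis
  proof (cases "good \<tau> lam J")
    case True
    have "(\<Sum>r=1..m. 4 * nv (h J r) * (nv (av W (u (J r))) + S)) \<le> (\<Sum>r=1..m. 4 * \<tau> * (nv (av W (u (J r))) + S))"
      using True S0 nv_nonneg unfolding good_def
      by (intro sum_mono mult_right_mono mult_left_mono add_nonneg_nonneg) auto
    also have "\<dots> = 4 * \<tau> * (A + real m * S)" by (simp add: A_def sum.distrib flip: sum_distrib_left)
    also have "\<dots> \<le> 4 * \<tau> * (lam * S + real m * S)"
      using True assms unfolding good_def A_def S_def by (intro mult_left_mono add_right_mono) auto
    finally have 1: "(\<Sum>r=1..m. 4 * nv (h J r) * (nv (av W (u (J r))) + S)) \<le> 4 * \<tau> * (lam * S + real m * S)" .
    have "8 * real k * (2 * ip (mm W (Z J)) W + 4 * d * A) \<le> 8 * real k * (2 * ip (mm W (Z J)) W + 4 * d * (lam * S))"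
      using True d_pos unfolding good_def A_def S_def by (intro mult_left_mono add_left_mono) auto
    then show ?thesis using main 1 True unfolding ipW[symmetric] unfolding W_def[symmetric] S_def[symmetric]
      by (simp add: algebra_simps)
  next
    case False
    have m1: "real m ^ 1 \<le> real m ^ 2" by (cases "m = 0") (auto simp: power2_eq_square)
    have nvu: "nv (av W (u (J r))) \<le> real k * S" for r
      using nv_av_le[of W "u (J r)"] mult_left_mono[OF nv_u[of "J r"] S0]
      unfolding S_def mult.commute[of "real k"] by linarith
    have Ak: "A \<le> real m * (real k * S)"
      using sum_mono[of "{1..m}" "\<lambda>r. nv (av W (u (J r)))" "\<lambda>r. real k * S"] nvu by (simp add: A_def)
    have kk: "real k * S + S \<le> 2 * real k * S"
      using mult_right_mono[OF _ S0, of 1 "real k"] k_pos by linarith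
    have "(\<Sum>r=1..m. 4 * nv (h J r) * (nv (av W (u (J r))) + S)) \<le> (\<Sum>r=1..m. 4 * (real k * real m) * (2 * real k * S))"
    proof (intro sum_mono mult_mono)
      show "nv (av W (u (J r))) + S \<le> 2 * real k * S" for r using nvu[of r] kk by linarith
    qed (use S0 nv_nonneg nv_h_le in auto)
    also have "\<dots> = 8 * (real k)\<^sup>2 * (real m)\<^sup>2 * S" by (simp add: power2_eq_square)
    finally have 1: "(\<Sum>r=1..m. 4 * nv (h J r) * (nv (av W (u (J r))) + S)) \<le> 8 * (real k)\<^sup>2 * (real m)\<^sup>2 * S" .
    have "32 * real k * (d * A) \<le> 32 * real k * (1 * (real m * (real k * S)))"
      using d_le d_pos A0 Ak by (intro mult_left_mono mult_mono) auto
    also have "\<dots> = 32 * (real k)\<^sup>2 * S * real m ^ 1" by (simp add: power2_eq_square)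
    also have "\<dots> \<le> 32 * (real k)\<^sup>2 * S * (real m)\<^sup>2" using S0 by (intro mult_left_mono m1) auto
    finally have 2: "32 * real k * (d * A) \<le> 32 * (real k)\<^sup>2 * S * (real m)\<^sup>2" .
    have "S \<le> ((real k)\<^sup>2 * real m ^ 3) ^ M"
    proof -
      obtain n where n: "M = Suc n" using assms by (cases M) auto
      have "S \<le> hs (Z J) ^ M" unfolding S_def W_def n by (rule hs_pw_le[OF herm_Z])
      also have "\<dots> \<le> ((real k)\<^sup>2 * real m ^ 3) ^ M" by (intro power_mono hs_Z_le hs_nonneg)
      finally show ?thesis .
    qed
    then have 3: "40 * (real k)\<^sup>2 * (real m)\<^sup>2 * S \<le> 40 * (real k)\<^sup>2 * (real m)\<^sup>2 * ((real k)\<^sup>2 * real m ^ 3) ^ M"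
      by (intro mult_left_mono) auto
    have 4: "0 \<le> (4 * \<tau> * (lam + real m) + 32 * real k * d * lam) * S"
      using assms d_pos S0 by auto
    have "\<Phi> M J \<le> 16 * real k * ip (mm W (Z J)) W + 40 * (real k)\<^sup>2 * (real m)\<^sup>2 * S"
      using main 1 2 by (simp add: algebra_simps)
    then show ?thesis using 3 4 False unfolding ipW[symmetric] unfolding W_def[symmetric] S_def[symmetric] by simp
  qed
qed

end

context projected_frame
begin

text \<open>For \<open>M = 0\<close> the weight matrix is the identity, so the mean of
  \<open>nv (h J r)\<close> suffices and no exceptional event has to be removed.\<close>

lemma chaos_base: "Ex (\<lambda>J. hs (pw (Z J) (Suc 0))) \<le> 32 * (real k)\<^sup>2 * real m * d"
proof -
  have "Ex (\<lambda>J. hs (pw (Z J) (Suc 0))) \<le> real (2 * 0 + 1) / 4 * Ex (\<Phi> 0)"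
    by (rule chaos_step)
  also have "\<dots> \<le> 1 / 4 * Ex (\<lambda>J. \<Sum>r=1..m. 16 * real k * nv (h J r) ^ 1)"
  proof -
    have "\<Phi> 0 J \<le> (\<Sum>r=1..m. 16 * real k * nv (h J r) ^ 1)" for J
      unfolding \<Phi>_def
    proof (rule sum_mono)
      fix r
      have "4 * nv (h J r) * (nv (u (J r)) + real (card K)) \<le> 4 * nv (h J r) * (real k + real k)"
        using nv_nonneg nv_u card_K by (intro mult_left_mono add_mono) auto
      then show "4 * nv (h J r) * (nv (av (pw (Z J) 0) (u (J r))) + hs (pw (Z J) 0)) + 8 * real k * nv (av (pw (Z J) 0) (h J r))
        \<le> 16 * real k * nv (h J r) ^ 1"
        by (simp add: nv_av_eye hs_eye algebra_simps)
    qed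
    then show ?thesis by (simp add: avg_mono)
  qed
  also have "\<dots> = 1 / 4 * (\<Sum>r=1..m. 16 * real k * Ex (\<lambda>J. nv (h J r) ^ 1))"
    unfolding avg_sum avg_cmult ..
  also have "\<dots> \<le> 1 / 4 * (\<Sum>r=1..m. 16 * real k * (8 * real k * d))"
  proof (intro mult_left_mono sum_mono)
    fix r assume r: "r \<in> {1..m}"
    have "Ex (\<lambda>J. nv (h J r) ^ 1) \<le> (8 * real k * real 1 * (\<Sum>q=1..m. (R r q)\<^sup>2)) ^ 1"
      by (rule subgaussian) simp
    also have "\<dots> \<le> 8 * real k * d"
      using R_sq_sum[OF r] by (simp add: mult_left_mono)
    finally show "Ex (\<lambda>J. nv (h J r) ^ 1) \<le> 8 * real k * d" .
  qed auto
  also have "\<dots> = 32 * (real k)\<^sup>2 * real m * d" by (simp add: power2_eq_square)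
  finally show ?thesis .
qed

text \<open>Off the good event the chaos is bounded trivially by a power of \<open>k\<close> and \<open>m\<close>; the factor
  \<open>m\<^sup>3\<^sup>p\<close> in the assumption \<open>bad\<close> absorbs the power of \<open>m\<close>.\<close>

lemma chaos_moment:
  assumes tau: "\<tau> \<ge> 0" "lam \<ge> 0" and m: "m \<ge> 1"
    and A: "A = 4 * real p * \<tau> * (lam + real m) + 32 * real p * real k * d * lam + 64 * (real p)\<^sup>2 * (real k)\<^sup>2"
    and bad: "Pr (\<lambda>J. \<not> good \<tau> lam J) * real m ^ (3 * p) \<le> 1"
    and M: "Suc M \<le> p"
  shows "Ex (\<lambda>J. hs (pw (Z J) (Suc M))) \<le> A ^ Suc M * (real m + real (Suc M))"
  using M
proof (induction M)
  case 0
  have p: "real p \<ge> 1" using 0 by simp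
  have "64 * 1 * (real k)\<^sup>2 \<le> 64 * (real p)\<^sup>2 * (real k)\<^sup>2"
    using p by (intro mult_right_mono mult_left_mono) (auto simp: one_le_power)
  moreover have "0 \<le> 4 * real p * \<tau> * (lam + real m) + 32 * real p * real k * d * lam"
    using tau d_pos by auto
  ultimately have A64: "64 * (real k)\<^sup>2 \<le> A" unfolding A by linarith
  have "Ex (\<lambda>J. hs (pw (Z J) (Suc 0))) \<le> 32 * (real k)\<^sup>2 * real m * d" by (rule chaos_base)
  also have "\<dots> \<le> 32 * (real k)\<^sup>2 * real m * 1" using d_le by (intro mult_left_mono) auto
  also have "\<dots> \<le> A * (real m + 1)"
  proof -
    have "0 \<le> (real k)\<^sup>2" by simp
    then have "32 * (real k)\<^sup>2 \<le> A" "0 \<le> A" using A64 by linarith+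
    then show ?thesis unfolding mult_1_right by (intro mult_mono) auto
  qed
  finally show ?case by simp
next
  case (Suc M)
  define S where "S n J = hs (pw (Z J) n)" for n J
  define T where "T J = ip (pw (Z J) (Suc M)) (pw (Z J) (Suc (Suc M)))" for J
  define C where "C = 4 * \<tau> * (lam + real m) + 32 * real k * d * lam"
  define E where "E = 40 * (real k)\<^sup>2 * (real m)\<^sup>2 * ((real k)\<^sup>2 * real m ^ 3) ^ Suc M"
  \<comment> \<open>The coefficient \<open>16 k\<close> of the odd moment times
    \<open>p / 2\<close>. Used as its own weight in \<open>two_ip_le\<close> it again leaves half of
    the top moment, and \<open>c^2\<close> is the last summand of \<open>A\<close>.\<close>
  define c where "c = 8 * real p * real k"
  define Pb where "Pb = Pr (\<lambda>J. \<not> good \<tau> lam J)"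
  have p: "real p \<ge> 1" using Suc by simp
  have c0: "c > 0" using p k_pos by (simp add: c_def)
  have C0: "C \<ge> 0" using tau d_pos by (simp add: C_def)
  have AC: "A = real p * C + c\<^sup>2" by (simp add: A C_def c_def power_mult_distrib algebra_simps)
  have Ac: "c\<^sup>2 \<le> A" using C0 by (simp add: AC)
  have A0: "A \<ge> 0" using Ac by (meson order_trans zero_le_power2)
  have S0: "Ex (S n) \<ge> 0" for n unfolding S_def by (intro avg_nonneg hs_nonneg)
  have "Ex (S (Suc (Suc M))) \<le> real (2 * Suc M + 1) / 4 * Ex (\<Phi> (Suc M))"
    unfolding S_def by (rule chaos_step)
  also have "\<dots> \<le> real p / 2 * Ex (\<Phi> (Suc M))"
    using Suc.prems Phi_nonneg by (intro mult_right_mono avg_nonneg) auto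
  also have "\<dots> = Ex (\<lambda>J. real p / 2 * \<Phi> (Suc M) J)" by (simp only: avg_cmult)
  also have "\<dots> \<le> Ex (\<lambda>J. (real p / 2 * C + c\<^sup>2 / 2) * S (Suc M) J + (1/2) * S (Suc (Suc M)) J
      + (real p / 2 * E) * (if \<not> good \<tau> lam J then 1 else 0))"
  proof (rule avg_mono)
    fix J
    have "real p / 2 * \<Phi> (Suc M) J \<le> real p / 2 * (C * S (Suc M) J + 16 * real k * T J + (if good \<tau> lam J then 0 else E))"
      using Phi_le[OF tau, of "Suc M" J] unfolding C_def S_def T_def E_def by (intro mult_left_mono) auto
    also have "\<dots> = real p / 2 * C * S (Suc M) J + c * T J + (real p / 2 * E) * (if \<not> good \<tau> lam J then 1 else 0)"
      by (simp add: c_def algebra_simps)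
    finally have 1: "real p / 2 * \<Phi> (Suc M) J \<le> real p / 2 * C * S (Suc M) J + c * T J + (real p / 2 * E) * (if \<not> good \<tau> lam J then 1 else 0)" .
    have "c * (2 * T J) \<le> c * (c * S (Suc M) J + S (Suc (Suc M)) J / c)"
      unfolding T_def S_def using c0 by (intro mult_left_mono two_ip_le) auto
    also have "\<dots> = c\<^sup>2 * S (Suc M) J + S (Suc (Suc M)) J"
      using c0 by (simp add: distrib_left power2_eq_square)
    finally show "real p / 2 * \<Phi> (Suc M) J \<le> (real p / 2 * C + c\<^sup>2 / 2) * S (Suc M) J + (1/2) * S (Suc (Suc M)) J
      + (real p / 2 * E) * (if \<not> good \<tau> lam J then 1 else 0)"
      using 1 unfolding distrib_right by linarith
  qed
  also have "\<dots> = (real p / 2 * C + c\<^sup>2 / 2) * Ex (S (Suc M)) + (1/2) * Ex (S (Suc (Suc M))) + (real p / 2 * E) * Pb"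
    by (simp only: avg_add avg_cmult Pb_def Pr_def)
  finally have "Ex (S (Suc (Suc M))) \<le> A * Ex (S (Suc M)) + real p * E * Pb"
    unfolding AC by (simp add: algebra_simps)
  also have "\<dots> \<le> A * (A ^ Suc M * (real m + real (Suc M))) + A ^ Suc (Suc M)"
  proof (intro add_mono mult_left_mono A0)
    show "Ex (S (Suc M)) \<le> A ^ Suc M * (real m + real (Suc M))" using Suc by (simp add: S_def[abs_def])
    have Pb0: "Pb \<ge> 0" unfolding Pb_def by (rule Pr_nonneg)
    have k2: "(real k)\<^sup>2 \<le> A"
    proof -
      have "(1 * real k)\<^sup>2 \<le> c\<^sup>2" unfolding c_def using p by (intro power_mono mult_right_mono) auto
      then show ?thesis using Ac by simp
    qed
    have pk: "real p * 40 * (real k)\<^sup>2 \<le> A"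
    proof -
      have "real p * 40 * (real k)\<^sup>2 \<le> (real p * 64 * real p) * (real k)\<^sup>2"
        using p by (intro mult_right_mono) auto
      also have "\<dots> = c\<^sup>2" by (simp add: c_def power2_eq_square)
      finally show ?thesis using Ac by linarith
    qed
    \<comment> \<open>All powers of \<open>k\<close> go into \<open>A\<close>. The powers of
      \<open>m\<close> go into \<open>bad\<close>, since \<open>Suc (Suc M) \<le> p\<close> gives
      \<open>2 + 3 * Suc M \<le> 3 * p\<close>.\<close>
    have "real p * E * Pb = (real p * 40 * (real k)\<^sup>2) * (((real k)\<^sup>2) ^ Suc M) * ((real m)\<^sup>2 * (real m ^ 3) ^ Suc M) * Pb"
      unfolding E_def power_mult_distrib by (simp only: mult_ac)
    also have "\<dots> \<le> A * A ^ Suc M * ((real m)\<^sup>2 * (real m ^ 3) ^ Suc M) * Pb"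
      using pk k2 A0 Pb0 by (intro mult_right_mono mult_mono power_mono) auto
    also have "(real m)\<^sup>2 * (real m ^ 3) ^ Suc M = real m ^ (2 + 3 * Suc M)"
      by (simp only: power_add power_mult)
    also have "A * A ^ Suc M * real m ^ (2 + 3 * Suc M) * Pb \<le> A * A ^ Suc M * real m ^ (3 * p) * Pb"
      using A0 Pb0 m Suc.prems by (intro mult_right_mono mult_left_mono power_increasing) auto
    also have "\<dots> \<le> A ^ Suc (Suc M)"
      using mult_left_mono[OF bad, of "A ^ Suc (Suc M)"] A0 by (simp add: Pb_def mult_ac)
    finally show "real p * E * Pb \<le> A ^ Suc (Suc M)" .
  qed
  also have "\<dots> = A ^ Suc (Suc M) * (real m + real (Suc (Suc M)))" by (simp add: algebra_simps)
  finally show ?case by (simp add: S_def[abs_def] del: pw.simps)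
qed

text \<open>The first level is that of \<open>subgaussian_tail\<close> with row norm at most
  \<open>d\<close>, followed by a union bound over the rows. The second is
  \<open>m + \<Lambda>\<close> with \<open>\<Lambda> = 3 (a + 2 m)\<close> and
  \<open>a = 2 q k\<close>, a choice that satisfies
  \<open>9 (a^2 + 4 a m) \<le> \<Lambda>^2\<close>.\<close>

lemma good_prob:
  assumes q: "q \<ge> 1" and m: "m \<ge> 1"
  shows "Pr (\<lambda>J. \<not> good (64 * real k * real q * d) (7 * real m + 6 * real q * real k) J)
    \<le> real m / 8 ^ q + real m / 9 ^ q"
proof -
  define \<tau> where "\<tau> = 64 * real k * real q * d"
  define a where "a = 2 * real q * real k * 1"
  define \<Lambda> where "\<Lambda> = 3 * (a + 2 * real m)"
  define Q where "Q J \<longleftrightarrow> (\<forall>x. cmod (\<Sum>i\<in>K. cnj (x i) * av (weighted (\<lambda>_. 1) J) x i) \<le> \<Lambda> * nv x)" for J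
  have 1: "Pr (\<lambda>J. \<exists>r\<in>{1..m}. \<tau> \<le> nv (h J r)) \<le> real m / 8 ^ q"
  proof -
    have "Pr (\<lambda>J. \<exists>r\<in>{1..m}. \<tau> \<le> nv (h J r)) \<le> (\<Sum>r\<in>{1..m}. Pr (\<lambda>J. \<tau> \<le> nv (h J r)))"
      by (rule Pr_bex) simp
    also have "\<dots> \<le> (\<Sum>r\<in>{1..m}. 1 / 8 ^ q)"
      unfolding \<tau>_def by (intro sum_mono subgaussian_tail q R_sq_sum d_pos)
    finally show ?thesis by simp
  qed
  have a0: "a \<ge> 0" by (simp add: a_def)
  have 2: "Pr (\<lambda>J. \<not> Q J) \<le> real m / 1 / 9 ^ q"
    unfolding Q_def
  proof (rule weighted_tail)
    show "9 * (a\<^sup>2 + 4 * a * real m) \<le> \<Lambda>\<^sup>2"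
      unfolding \<Lambda>_def power_mult_distrib by (simp add: power2_eq_square algebra_simps)
    show "\<Lambda> > 0" using a0 m by (simp add: \<Lambda>_def)
  qed (use q in \<open>auto simp: a_def\<close>)
  have "Pr (\<lambda>J. \<not> good \<tau> (7 * real m + 6 * real q * real k) J)
    \<le> Pr (\<lambda>J. (\<exists>r\<in>{1..m}. \<tau> \<le> nv (h J r)) \<or> \<not> Q J)"
  proof (rule Pr_mono, rule ccontr)
    fix J assume ng: "\<not> good \<tau> (7 * real m + 6 * real q * real k) J"
      and "\<not> ((\<exists>r\<in>{1..m}. \<tau> \<le> nv (h J r)) \<or> \<not> Q J)"
    then have hr: "\<forall>r\<in>{1..m}. nv (h J r) \<le> \<tau>" and Q: "Q J" by force+
    have "(\<Sum>r=1..m. nv (av W (u (J r)))) \<le> (7 * real m + 6 * real q * real k) * hs W" for W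
    proof -
      have "(\<Sum>r=1..m. 1 * nv (av W (u (J r)))) = ip (mm W (weighted (\<lambda>_. 1) J)) W + (\<Sum>r=1..m. 1) * hs W"
        by (rule sum_nv_weighted)
      also have "\<dots> \<le> \<Lambda> * hs W + (\<Sum>r=1..m. 1) * hs W"
        using Q unfolding Q_def by (intro add_right_mono ip_mm_quadratic_le) auto
      finally show ?thesis by (simp add: \<Lambda>_def a_def algebra_simps)
    qed
    then show False using ng hr unfolding good_def by auto
  qed
  also have "\<dots> \<le> Pr (\<lambda>J. \<exists>r\<in>{1..m}. \<tau> \<le> nv (h J r)) + Pr (\<lambda>J. \<not> Q J)"
    by (rule Pr_disj)
  finally show ?thesis using 1 2 by (simp add: \<tau>_def)
qed

text \<open>\<open>A\<close> is the constant of \<open>chaos_moment\<close> with the levels of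
  \<open>good_prob\<close> at order \<open>q = 4 p^2\<close>: hence \<open>256 = 4 * 64\<close> and
  \<open>24 = 4 * 6\<close>. The factor 4 in \<open>q\<close> is sufficient because
  \<open>p (3 p + 1) \<le> 4 p^2\<close>.\<close>

lemma chaos_tail:
  assumes p: "p \<ge> 1" and m: "m \<ge> 1" and mp: "real m \<le> 3 ^ p"
    and A: "A = 4 * real p * (256 * real k * (real p)\<^sup>2 * d) * (8 * real m + 24 * (real p)\<^sup>2 * real k)
      + 32 * real p * real k * d * (7 * real m + 24 * (real p)\<^sup>2 * real k) + 64 * (real p)\<^sup>2 * (real k)\<^sup>2"
    and L: "9 * A \<le> \<Lambda>\<^sup>2" "\<Lambda> > 0"
  shows "Pr (\<lambda>J. \<not> (\<forall>x. cmod (\<Sum>i\<in>K. cnj (x i) * av (Z J) x i) \<le> \<Lambda> * nv x)) \<le> (real m + real p) / 9 ^ p"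
proof -
  \<comment> \<open>Beating \<open>m\<^sup>3\<^sup>p\<close>, with \<open>m\<close> exponential in \<open>p\<close>, takes tails of quadratic order in \<open>p\<close>; this costs the third logarithm.\<close>
  define q where "q = 4 * p\<^sup>2"
  define \<tau> where "\<tau> = 64 * real k * real q * d"
  define lam where "lam = 7 * real m + 6 * real q * real k"
  have q: "q \<ge> 1" using p by (simp add: q_def)
  have "Pr (\<lambda>J. \<not> good \<tau> lam J) * real m ^ (3 * p) \<le> (real m / 8 ^ q + real m / 9 ^ q) * real m ^ (3 * p)"
    unfolding \<tau>_def lam_def by (intro mult_right_mono good_prob q m) auto
  also have "\<dots> \<le> (real m / 8 ^ q + real m / 8 ^ q) * real m ^ (3 * p)"
    by (intro mult_right_mono add_left_mono divide_left_mono power_mono) auto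
  also have "\<dots> = 2 * real m ^ (3 * p + 1) / 8 ^ q" by simp
  also have "\<dots> \<le> 2 * 3 ^ q / 8 ^ q"
  proof (intro divide_right_mono mult_left_mono)
    have "real m ^ (3 * p + 1) \<le> (3 ^ p) ^ (3 * p + 1)" by (intro power_mono mp) auto
    also have "\<dots> = 3 ^ (p * (3 * p + 1))" by (rule power_mult[symmetric])
    also have "\<dots> \<le> 3 ^ q"
    proof (rule power_increasing)
      have "p * 1 \<le> p * p" using p by (intro mult_left_mono) auto
      then show "p * (3 * p + 1) \<le> q" by (simp add: q_def power2_eq_square algebra_simps)
    qed simp
    finally show "real m ^ (3 * p + 1) \<le> 3 ^ q" .
  qed auto
  also have "\<dots> \<le> 1"
  proof -
    have "(2::real) ^ 1 \<le> 2 ^ q" by (rule power_increasing[OF q]) simp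
    then have "2 * 3 ^ q \<le> (2::real) ^ q * 3 ^ q" by (intro mult_right_mono) auto
    also have "\<dots> = 6 ^ q" by (simp flip: power_mult_distrib)
    also have "\<dots> \<le> 8 ^ q" by (rule power_mono) auto
    finally show ?thesis by simp
  qed
  finally have bad: "Pr (\<lambda>J. \<not> good \<tau> lam J) * real m ^ (3 * p) \<le> 1" .
  have A': "A = 4 * real p * \<tau> * (lam + real m) + 32 * real p * real k * d * lam + 64 * (real p)\<^sup>2 * (real k)\<^sup>2"
    by (simp add: A \<tau>_def lam_def q_def algebra_simps)
  obtain M where M: "p = Suc M" using p by (cases p) auto
  have "64 * (real p)\<^sup>2 * (real k)\<^sup>2 > 0" using p k_pos by simp
  then have A0: "A > 0" unfolding A using d_pos by (intro add_nonneg_pos) auto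
  have L0: "(9 * A) ^ p \<le> \<Lambda> ^ (2 * p)"
    unfolding power_mult using A0 L by (intro power_mono) auto
  have "Pr (\<lambda>J. \<not> (\<forall>x. cmod (\<Sum>i\<in>K. cnj (x i) * av (Z J) x i) \<le> \<Lambda> * nv x))
    \<le> Pr (\<lambda>J. \<Lambda> ^ (2 * p) \<le> hs (pw (Z J) p))"
  proof (rule Pr_mono)
    fix J assume "\<not> (\<forall>x. cmod (\<Sum>i\<in>K. cnj (x i) * av (Z J) x i) \<le> \<Lambda> * nv x)"
    then have "\<not> hs (pw (Z J) (Suc M)) \<le> \<Lambda> ^ (2 * Suc M)"
      using quadratic_form_le[OF herm_Z] L by (meson less_eq_real_def)
    then show "\<Lambda> ^ (2 * p) \<le> hs (pw (Z J) p)" unfolding M by linarith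
  qed
  also have "\<dots> \<le> Ex (\<lambda>J. hs (pw (Z J) p)) / \<Lambda> ^ (2 * p)"
    using L hs_nonneg by (intro markov) auto
  also have "\<dots> \<le> (A ^ p * (real m + real p)) / \<Lambda> ^ (2 * p)"
  proof (rule divide_right_mono)
    show "Ex (\<lambda>J. hs (pw (Z J) p)) \<le> A ^ p * (real m + real p)"
      using chaos_moment[OF _ _ m A' bad, of M] d_pos unfolding M \<tau>_def lam_def by simp
  qed (use L in auto)
  also have "\<dots> \<le> (A ^ p * (real m + real p)) / (9 * A) ^ p"
    using L0 L(2) A0 by (intro divide_left_mono mult_pos_pos) auto
  also have "\<dots> = (real m + real p) / 9 ^ p"
    using A0 by (simp add: power_mult_distrib)
  finally show ?thesis .
qed

text \<open>A deterministic identity: \<open>P\<close> is \<open>R\<close> plus its diagonal, and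
  the diagonal part is recentred by the trace.\<close>

lemma form_eq:
  defines "F \<equiv> \<lambda>J x r. \<Sum>i\<in>K. cnj (x i) * u (J r) i"
  shows "(\<Sum>r=1..m. \<Sum>q=1..m. of_real (P r q) * (F J x r * cnj (F J x q)))
    = (\<Sum>i\<in>K. cnj (x i) * av (Z J) x i) + (\<Sum>i\<in>K. cnj (x i) * av (weighted (\<lambda>r. P r r) J) x i)
      + of_real ((\<Sum>r=1..m. P r r) * nv x)"
proof -
  have FF: "F J x r * cnj (F J x q) = (\<Sum>i\<in>K. \<Sum>j\<in>K. cnj (x i) * (u (J r) i * cnj (u (J q) j)) * x j)" for r q
    unfolding F_def cnj_sum sum_product by (simp add: mult_ac)
  have Z: "(\<Sum>i\<in>K. cnj (x i) * av (Z J) x i) = (\<Sum>r=1..m. \<Sum>q=1..m. of_real (R r q) * (F J x r * cnj (F J x q)))"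
  proof -
    have "(\<Sum>i\<in>K. cnj (x i) * av (Z J) x i)
      = (\<Sum>i\<in>K. \<Sum>j\<in>K. \<Sum>r=1..m. \<Sum>q=1..m. of_real (R r q) * (cnj (x i) * (u (J r) i * cnj (u (J q) j)) * x j))"
      by (simp add: av_def Z_def sum_distrib_left sum_distrib_right mult_ac)
    also have "\<dots> = (\<Sum>r=1..m. \<Sum>q=1..m. \<Sum>i\<in>K. \<Sum>j\<in>K. of_real (R r q) * (cnj (x i) * (u (J r) i * cnj (u (J q) j)) * x j))"
      by (rule sum_swap4)
    finally show ?thesis unfolding FF sum_distrib_left .
  qed
  have W: "(\<Sum>i\<in>K. cnj (x i) * av (weighted (\<lambda>r. P r r) J) x i)
    = (\<Sum>r=1..m. of_real (P r r) * (F J x r * cnj (F J x r))) - of_real ((\<Sum>r=1..m. P r r) * nv x)"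
  proof -
    have "av (weighted (\<lambda>r. P r r) J) x i = (\<Sum>j\<in>K. (\<Sum>r=1..m. of_real (P r r) * (u (J r) i * cnj (u (J r) j))) * x j)
       - of_real (\<Sum>r=1..m. P r r) * x i" if "i \<in> K" for i
    proof -
      have "(\<Sum>j\<in>K. of_real (\<Sum>r=1..m. P r r) * eye i j * x j) = of_real (\<Sum>r=1..m. P r r) * x i"
        unfolding mult.assoc sum_distrib_left[symmetric] using that by (simp only: sum_eye_left if_True)
      then show ?thesis
        unfolding av_def weighted_def left_diff_distrib sum_subtractf by simp
    qed
    then have "(\<Sum>i\<in>K. cnj (x i) * av (weighted (\<lambda>r. P r r) J) x i)
      = (\<Sum>i\<in>K. cnj (x i) * (\<Sum>j\<in>K. (\<Sum>r=1..m. of_real (P r r) * (u (J r) i * cnj (u (J r) j))) * x j))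
       - (\<Sum>i\<in>K. cnj (x i) * (of_real (\<Sum>r=1..m. P r r) * x i))"
      unfolding sum_subtractf[symmetric] right_diff_distrib[symmetric] by (intro sum.cong refl) simp
    moreover have "(\<Sum>i\<in>K. cnj (x i) * (of_real (\<Sum>r=1..m. P r r) * x i)) = of_real ((\<Sum>r=1..m. P r r) * nv x)"
      unfolding nv_def of_real_mult of_real_sum[of _ K] complex_norm_square sum_distrib_left
      by (intro sum.cong refl) (simp only: mult_ac)
    moreover have "(\<Sum>i\<in>K. cnj (x i) * (\<Sum>j\<in>K. (\<Sum>r=1..m. of_real (P r r) * (u (J r) i * cnj (u (J r) j))) * x j))
      = (\<Sum>r=1..m. of_real (P r r) * (F J x r * cnj (F J x r)))"
    proof -
      have "(\<Sum>i\<in>K. cnj (x i) * (\<Sum>j\<in>K. (\<Sum>r=1..m. of_real (P r r) * (u (J r) i * cnj (u (J r) j))) * x j))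
        = (\<Sum>i\<in>K. \<Sum>j\<in>K. \<Sum>r=1..m. of_real (P r r) * (cnj (x i) * (u (J r) i * cnj (u (J r) j)) * x j))"
        by (simp add: sum_distrib_left sum_distrib_right mult_ac)
      also have "\<dots> = (\<Sum>r=1..m. \<Sum>i\<in>K. \<Sum>j\<in>K. of_real (P r r) * (cnj (x i) * (u (J r) i * cnj (u (J r) j)) * x j))"
        by (rule sum_swap3[symmetric])
      finally show ?thesis unfolding FF sum_distrib_left .
    qed
    ultimately show ?thesis by simp
  qed
  have "(\<Sum>r=1..m. \<Sum>q=1..m. of_real (P r q) * (F J x r * cnj (F J x q)))
    = (\<Sum>r=1..m. (\<Sum>q=1..m. of_real (R r q) * (F J x r * cnj (F J x q)))
       + (\<Sum>q=1..m. if q = r then of_real (P r r) * (F J x r * cnj (F J x r)) else 0))"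
    unfolding sum.distrib[symmetric] by (intro sum.cong refl) (auto simp: R_def)
  also have "\<dots> = (\<Sum>r=1..m. \<Sum>q=1..m. of_real (R r q) * (F J x r * cnj (F J x q)))
       + (\<Sum>r=1..m. of_real (P r r) * (F J x r * cnj (F J x r)))"
    unfolding sum.distrib by (simp add: sum.delta)
  finally show ?thesis unfolding Z W by simp
qed

lemma form_concentration:
  assumes p: "p \<ge> 1" and m: "m \<ge> 1" and mp: "real m \<le> 3 ^ p" and \<beta>: "\<beta> = (\<Sum>r=1..m. P r r)"
    and chaos: "9 * (4 * real p * (256 * real k * (real p)\<^sup>2 * d) * (8 * real m + 24 * (real p)\<^sup>2 * real k)
      + 32 * real p * real k * d * (7 * real m + 24 * (real p)\<^sup>2 * real k) + 64 * (real p)\<^sup>2 * (real k)\<^sup>2) \<le> \<Lambda>\<^sup>2"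
    and diag: "9 * ((2 * real p * real k * d)\<^sup>2 + 4 * (2 * real p * real k * d) * \<beta>) \<le> \<Lambda>\<^sup>2" and L: "\<Lambda> > 0"
  shows "Pr (\<lambda>J. \<not> (\<forall>x. cmod ((\<Sum>r=1..m. \<Sum>q=1..m. of_real (P r q) *
      ((\<Sum>i\<in>K. cnj (x i) * u (J r) i) * cnj (\<Sum>i\<in>K. cnj (x i) * u (J q) i))) - of_real (\<beta> * nv x))
      \<le> 2 * \<Lambda> * nv x)) \<le> (real m + real p + \<beta> / d) / 9 ^ p"
proof -
  define Q1 where "Q1 J \<longleftrightarrow> (\<forall>x. cmod (\<Sum>i\<in>K. cnj (x i) * av (Z J) x i) \<le> \<Lambda> * nv x)" for J
  define Q2 where "Q2 J \<longleftrightarrow> (\<forall>x. cmod (\<Sum>i\<in>K. cnj (x i) * av (weighted (\<lambda>r. P r r) J) x i) \<le> \<Lambda> * nv x)" for J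
  have "Pr (\<lambda>J. \<not> Q1 J) \<le> (real m + real p) / 9 ^ p"
    unfolding Q1_def by (rule chaos_tail[OF p m mp refl chaos L])
  moreover have "Pr (\<lambda>J. \<not> Q2 J) \<le> \<beta> / d / 9 ^ p"
    unfolding Q2_def
    using P_diag P_diag_nonneg by (intro weighted_tail[OF _ d_pos \<beta> p refl diag L]) auto
  moreover have "Pr (\<lambda>J. \<not> (\<forall>x. cmod ((\<Sum>r=1..m. \<Sum>q=1..m. of_real (P r q) *
      ((\<Sum>i\<in>K. cnj (x i) * u (J r) i) * cnj (\<Sum>i\<in>K. cnj (x i) * u (J q) i))) - of_real (\<beta> * nv x))
      \<le> 2 * \<Lambda> * nv x)) \<le> Pr (\<lambda>J. \<not> Q1 J \<or> \<not> Q2 J)"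
  proof (rule Pr_mono, rule ccontr)
    fix J
    assume n: "\<not> (\<forall>x. cmod ((\<Sum>r=1..m. \<Sum>q=1..m. of_real (P r q) *
      ((\<Sum>i\<in>K. cnj (x i) * u (J r) i) * cnj (\<Sum>i\<in>K. cnj (x i) * u (J q) i))) - of_real (\<beta> * nv x))
      \<le> 2 * \<Lambda> * nv x)" and "\<not> (\<not> Q1 J \<or> \<not> Q2 J)"
    then have Q: "Q1 J" "Q2 J" by auto
    have "cmod ((\<Sum>i\<in>K. cnj (x i) * av (Z J) x i) + (\<Sum>i\<in>K. cnj (x i) * av (weighted (\<lambda>r. P r r) J) x i))
      \<le> \<Lambda> * nv x + \<Lambda> * nv x" for x
      using Q unfolding Q1_def Q2_def by (intro norm_triangle_mono) auto
    then show False using n unfolding form_eq \<beta> by (simp add: mult.assoc)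
  qed
  ultimately show ?thesis
    using Pr_disj[of "\<lambda>J. \<not> Q1 J" "\<lambda>J. \<not> Q2 J"] by (simp add: add_divide_distrib)
qed

end

section \<open>The right singular vectors of the inverse difference matrix\<close>

text \<open>Two orthonormal sequences intertwined by the difference operator. The quadratic form
  \<open>v\<^sup>2 + u\<^sup>2 - u v / s\<close> is a first integral of the recurrence; its value
  \<open>(4 - 1 / s\<^sup>2) / (2m + 1)\<close> follows by summing it over \<open>{1..m}\<close>.\<close>

lemma difference_recurrence:
  fixes u v :: "nat \<Rightarrow> real"
  assumes u0: "u 0 = 0" and vm: "v (Suc m) = 0" and s: "s > 0" and m: "m \<ge> 1"
    and V: "\<And>i. i < m \<Longrightarrow> v (Suc i) = s * (u (Suc i) - u i)"
    and U: "\<And>i. i < m \<Longrightarrow> u (Suc i) = s * (v (Suc i) - v (Suc (Suc i)))"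
    and nv: "(\<Sum>i=1..m. (v i)\<^sup>2) = 1" and nu: "(\<Sum>i=1..m. (u i)\<^sup>2) = 1"
  shows "(\<Sum>i=1..m. v i)\<^sup>2 = (4 * s\<^sup>2 - 1) / (2 * real m + 1)"
    and "i \<in> {1..m} \<Longrightarrow> (v i)\<^sup>2 \<le> 4 / (2 * real m + 1)"
proof -
  define Q where "Q i = (v i)\<^sup>2 + (u i)\<^sup>2 - u i * v i / s" for i
  define C where "C = (v 1)\<^sup>2"
  have stepV: "v (Suc i) = v i - u i / s" if "i \<in> {1..m}" for i
    using U[of "i - 1"] that s by (cases i) (auto simp: field_simps)
  have stepU: "u (Suc i) = u i + v (Suc i) / s" if "i < m" for i
    using V[OF that] s by (simp add: field_simps)
  have u1: "u 1 = v 1 / s" using stepU[of 0] u0 m by simp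
  have QC: "Q i = C" if "i \<in> {1..m}" for i
    using that
  proof (induction i)
    case (Suc i)
    show ?case
    proof (cases "i = 0")
      case True
      then show ?thesis using u1 by (simp add: Q_def C_def power2_eq_square)
    next
      case False
      then have i: "i \<in> {1..m}" "i < m" using Suc.prems by auto
      have "Q (Suc i) - Q i = 0"
        unfolding Q_def stepU[OF i(2)] stepV[OF i(1)] using s
        by (simp add: field_simps power2_eq_square)
      then show ?thesis using Suc.IH i by simp
    qed
  qed simp
  \<comment> \<open>The boundary value \<open>v (Suc m) = 0\<close> reduces the first integral at
    \<open>m\<close> to \<open>(u m)^2\<close>. Since the partial sums of \<open>v\<close> are
    \<open>s * u n\<close>, this also determines the square of the full sum.\<close>
  have um: "(u m)\<^sup>2 = C"
  proof -
    have "v m = u m / s" using stepV[of m] vm m by simp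
    then have "Q m = (u m)\<^sup>2" by (simp add: Q_def power2_eq_square)
    then show ?thesis using QC[of m] m by simp
  qed
  define W where "W = (\<Sum>i=1..m. u i * v i / s)"
  have "real m * C = (\<Sum>i=1..m. Q i)" using QC by simp
  also have "\<dots> = 2 - W" unfolding Q_def sum.distrib sum_subtractf W_def nv nu by simp
  finally have mC: "real m * C = 2 - W" .
  \<comment> \<open>A second relation between \<open>C\<close> and \<open>W\<close>: the numbers
    \<open>u i / s\<close> are the decrements of \<open>v\<close>, and their squares telescope up to
    mixed terms. Together with \<open>mC\<close> it determines \<open>C\<close>.\<close>
  have "1 / s\<^sup>2 = (\<Sum>i=1..m. (u i / s)\<^sup>2)"
    by (simp add: power_divide sum_divide_distrib[symmetric] nu[simplified])
  also have "\<dots> = (\<Sum>i=1..m. (v (Suc i))\<^sup>2 - (v i)\<^sup>2 + 2 * (u i * v i / s))"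
    by (intro sum.cong refl) (simp add: stepV power2_eq_square algebra_simps)
  also have "\<dots> = (v (Suc m))\<^sup>2 - (v 1)\<^sup>2 + 2 * W"
    unfolding sum.distrib W_def sum_distrib_left
    using sum_Suc_diff[of 1 m "\<lambda>i. (v i)\<^sup>2"] m by simp
  finally have W: "2 * W = 1 / s\<^sup>2 + C" using vm by (simp add: C_def)
  have C: "C * (2 * real m + 1) = 4 - 1 / s\<^sup>2" using mC W by (simp add: algebra_simps)
  then have C': "C = (4 - 1 / s\<^sup>2) / (2 * real m + 1)" by (simp add: field_simps)
  have "(\<Sum>i=1..n. v i) = s * u n" if "n \<le> m" for n
    using that by (induction n) (auto simp: u0 V algebra_simps)
  then have "(\<Sum>i=1..m. v i)\<^sup>2 = s\<^sup>2 * C" using um by (simp add: power_mult_distrib)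
  then show "(\<Sum>i=1..m. v i)\<^sup>2 = (4 * s\<^sup>2 - 1) / (2 * real m + 1)"
  proof -
    have "s\<^sup>2 * (4 - 1 / s\<^sup>2) = 4 * s\<^sup>2 - 1" using s by (simp add: field_simps)
    then show ?thesis using \<open>(\<Sum>i=1..m. v i)\<^sup>2 = s\<^sup>2 * C\<close> unfolding C' times_divide_eq_right by simp
  qed
  assume i: "i \<in> {1..m}"
  show "(v i)\<^sup>2 \<le> 4 / (2 * real m + 1)"
  proof (cases "C = 0")
    \<comment> \<open>Here \<open>4 - 1 / s^2\<close> vanishes too and cannot be cancelled. The
      recurrence then starts from \<open>v 1 = 0\<close> and annihilates both sequences, against the
      normalisation.\<close>
    case True
    have "v j = 0 \<and> u j = 0" if "j \<in> {1..m}" for j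
      using that
    proof (induction j)
      case (Suc j)
      show ?case
      proof (cases "j = 0")
        case True
        then show ?thesis using \<open>C = 0\<close> u1 by (simp add: C_def)
      next
        case False
        then have "j \<in> {1..m}" "j < m" using Suc.prems by auto
        then show ?thesis using Suc.IH stepV[of j] stepU[of j] by simp
      qed
    qed simp
    then show ?thesis using nv by simp
  next
    case False
    then have C0: "C > 0" by (simp add: C_def)
    have "C = (u i - v i / (2 * s))\<^sup>2 + (v i)\<^sup>2 * (1 - 1 / (4 * s\<^sup>2))"
      unfolding QC[OF i, symmetric] Q_def using s by (simp add: power2_eq_square field_simps)
    moreover have "(v i)\<^sup>2 * (4 - 1 / s\<^sup>2) / 4 = (v i)\<^sup>2 * (1 - 1 / (4 * s\<^sup>2))"
      using s by (simp add: field_simps)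
    ultimately have "(v i)\<^sup>2 * (4 - 1 / s\<^sup>2) / 4 \<le> C"
      using zero_le_power2[of "u i - v i / (2 * s)"] by linarith
    then have "C * ((v i)\<^sup>2 * (2 * real m + 1)) \<le> C * 4" unfolding C[symmetric] by (simp add: mult_ac)
    then have "(v i)\<^sup>2 * (2 * real m + 1) \<le> 4" using C0 by simp
    then show ?thesis by (simp add: field_simps)
  qed
qed

lemma sum_sq_orthonormal:
  fixes U :: "nat \<Rightarrow> nat \<Rightarrow> real"
  assumes "\<And>a b. a \<in> A \<Longrightarrow> b \<in> A \<Longrightarrow> (\<Sum>i\<in>I. U i a * U i b) = (if a = b then 1 else 0)" "finite A"
  shows "(\<Sum>i\<in>I. (\<Sum>a\<in>A. U i a * c a)\<^sup>2) = (\<Sum>a\<in>A. (c a)\<^sup>2)"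
proof -
  have "(\<Sum>i\<in>I. (\<Sum>a\<in>A. U i a * c a)\<^sup>2) = (\<Sum>i\<in>I. \<Sum>a\<in>A. \<Sum>b\<in>A. c a * c b * (U i a * U i b))"
    by (simp add: power2_eq_square sum_product mult_ac)
  also have "\<dots> = (\<Sum>a\<in>A. \<Sum>b\<in>A. \<Sum>i\<in>I. c a * c b * (U i a * U i b))"
    by (subst sum.swap) (intro sum.cong refl sum.swap)
  also have "\<dots> = (\<Sum>a\<in>A. \<Sum>b\<in>A. if a = b then c a * c a else 0)"
    unfolding sum_distrib_left[symmetric] using assms(1) by (intro sum.cong refl) auto
  finally show ?thesis using assms(2) by (simp add: sum.delta power2_eq_square)
qed

locale svd =
  fixes m :: nat and U S V :: "nat \<Rightarrow> nat \<Rightarrow> real"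
  assumes svd: "is_svd_of_Dinv m U S V" and m_pos: "m \<ge> 1"
begin

lemma V_ortho: "a \<in> {1..m} \<Longrightarrow> b \<in> {1..m} \<Longrightarrow> (\<Sum>i=1..m. V i a * V i b) = (if a = b then 1 else 0)"
  using svd unfolding is_svd_of_Dinv_def mmul_def transp_mat_def id_mat_def by blast

lemma U_ortho: "a \<in> {1..m} \<Longrightarrow> b \<in> {1..m} \<Longrightarrow> (\<Sum>i=1..m. U i a * U i b) = (if a = b then 1 else 0)"
  using svd unfolding is_svd_of_Dinv_def mmul_def transp_mat_def id_mat_def by blast

lemma S_nonneg: "a \<in> {1..m} \<Longrightarrow> 0 \<le> S a a"
  using svd unfolding is_svd_of_Dinv_def by blast

lemma S_le: "a \<in> {1..m} \<Longrightarrow> S a a \<le> S 1 1"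
  using svd m_pos unfolding is_svd_of_Dinv_def by auto

definition B :: "nat \<Rightarrow> nat \<Rightarrow> real" where
  "B i j = (\<Sum>a=1..m. U i a * S a a * V j a)"

text \<open>\<open>B\<close> is the product \<open>U S V^T\<close>, and \<open>D B = 1\<close> says
  that its consecutive rows differ by unit vectors. Hence \<open>B\<close> is the summation matrix,
  with ones on and below the diagonal.\<close>

lemma B_eq: assumes "i \<in> {1..m}" "j \<in> {1..m}" shows "B i j = (if j \<le> i then 1 else 0)"
proof -
  have US: "mmul m U S i b = U i b * S b b" if "b \<in> {1..m}" for i b
  proof -
    have "mmul m U S i b = (\<Sum>t=1..m. if t = b then U i b * S b b else 0)"
      unfolding mmul_def using svd that unfolding is_svd_of_Dinv_def
      by (intro sum.cong refl) (metis mult_zero_right)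
    then show ?thesis using that by (simp add: sum.delta)
  qed
  have Bm: "mmul m (mmul m U S) (transp_mat V) i j = B i j" for i j
    unfolding B_def using US by (subst mmul_def) (simp add: transp_mat_def)
  have rec: "B i j - (if i = 1 then 0 else B (i - 1) j) = (if i = j then 1 else 0)"
    if "i \<in> {1..m}" "j \<in> {1..m}" for i j
  proof -
    have "(\<Sum>t=1..m. diff_mat i t * B t j)
      = (\<Sum>t=1..m. (if t = i then B i j else 0) - (if t = i - 1 then B (i - 1) j else 0))"
      using that by (intro sum.cong refl) (auto simp: diff_mat_def)
    also have "\<dots> = B i j - (if i = 1 then 0 else B (i - 1) j)"
      unfolding sum_subtractf using that by (auto simp: sum.delta)
    finally have "(\<Sum>t=1..m. diff_mat i t * B t j) = B i j - (if i = 1 then 0 else B (i - 1) j)" .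
    moreover have "mmul m diff_mat (mmul m (mmul m U S) (transp_mat V)) i j = id_mat i j"
      using svd that unfolding is_svd_of_Dinv_def by blast
    ultimately show ?thesis
      unfolding mmul_def[of m diff_mat] Bm by (simp add: id_mat_def)
  qed
  show ?thesis using assms(1)
  proof (induction i)
    case (Suc i)
    then show ?case
      using rec[OF Suc.prems assms(2)] assms(2) by (cases "i = 0") (auto split: if_splits)
  qed simp
qed

text \<open>The relation \<open>B V = U S\<close>, read as a formula for partial sums; its transpose
  gives tail sums of \<open>U\<close> in the same way. The empty sum is separate because
  \<open>U 0 a\<close> is unconstrained.\<close>

lemma sum_V: assumes "a \<in> {1..m}" "i \<le> m" shows "(\<Sum>j=1..i. V j a) = (if i = 0 then 0 else S a a * U i a)"
proof (cases "i = 0")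
  case False
  then have i: "i \<in> {1..m}" using assms by auto
  have "(\<Sum>j=1..i. V j a) = (\<Sum>j=1..m. B i j * V j a)"
    using i assms by (intro sum.mono_neutral_cong_left) (auto simp: B_eq)
  also have "\<dots> = (\<Sum>j=1..m. \<Sum>b=1..m. U i b * S b b * (V j b * V j a))"
    unfolding B_def sum_distrib_right by (intro sum.cong refl) (simp only: mult_ac)
  also have "\<dots> = (\<Sum>b=1..m. \<Sum>j=1..m. U i b * S b b * (V j b * V j a))" by (rule sum.swap)
  also have "\<dots> = (\<Sum>b=1..m. if b = a then U i a * S a a else 0)"
    unfolding sum_distrib_left[symmetric] using assms by (intro sum.cong refl) (auto simp: V_ortho simp del: One_nat_def)
  also have "\<dots> = S a a * U i a" using assms by (simp add: sum.delta)
  finally show ?thesis using False by simp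
qed simp

lemma sum_U: assumes "a \<in> {1..m}" "j \<in> {1..m}" shows "(\<Sum>i=j..m. U i a) = S a a * V j a"
proof -
  have "(\<Sum>i=j..m. U i a) = (\<Sum>i=1..m. B i j * U i a)"
    using assms by (intro sum.mono_neutral_cong_left) (auto simp: B_eq)
  also have "\<dots> = (\<Sum>i=1..m. \<Sum>b=1..m. V j b * S b b * (U i b * U i a))"
    unfolding B_def sum_distrib_right by (intro sum.cong refl) (simp only: mult_ac)
  also have "\<dots> = (\<Sum>b=1..m. \<Sum>i=1..m. V j b * S b b * (U i b * U i a))" by (rule sum.swap)
  also have "\<dots> = (\<Sum>b=1..m. if b = a then V j a * S a a else 0)"
    unfolding sum_distrib_left[symmetric] using assms by (intro sum.cong refl) (auto simp: U_ortho simp del: One_nat_def)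
  also have "\<dots> = S a a * V j a" using assms by (simp add: sum.delta)
  finally show ?thesis .
qed

lemma S_pos: assumes a: "a \<in> {1..m}" shows "S a a > 0"
proof (rule ccontr)
  assume "\<not> S a a > 0"
  then have "S a a = 0" using S_nonneg[OF a] by simp
  then have z: "(\<Sum>j=1..i. V j a) = 0" if "i \<le> m" for i using sum_V[OF a that] by simp
  have "V (Suc i) a = 0" if "Suc i \<le> m" for i
    using z[OF that] z[of i] that by simp
  then have "V j a = 0" if "j \<in> {1..m}" for j using that by (cases j) auto
  then show False using V_ortho[OF a a] by simp
qed

lemma recurrence:
  assumes a: "a \<in> {1..m}"
  shows "(\<Sum>i=1..m. V i a)\<^sup>2 = (4 * (S a a)\<^sup>2 - 1) / (2 * real m + 1)"
    and "i \<in> {1..m} \<Longrightarrow> (V i a)\<^sup>2 \<le> 4 / (2 * real m + 1)"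
proof -
  \<comment> \<open>The values \<open>U 0 a\<close> and \<open>V (Suc m) a\<close> lie outside the
    matrices and are arbitrary; they are replaced by the boundary values zero of the
    recurrence.\<close>
  define u where "u i = (if i = 0 then 0 else U i a)" for i
  define v where "v i = (if i = Suc m then 0 else V i a)" for i
  have V: "v (Suc i) = S a a * (u (Suc i) - u i)" if "i < m" for i
    using sum_V[OF a, of i] sum_V[OF a, of "Suc i"] that by (auto simp: u_def v_def right_diff_distrib)
  have U: "u (Suc i) = S a a * (v (Suc i) - v (Suc (Suc i)))" if "i < m" for i
  proof -
    have "(\<Sum>i=Suc i..m. U i a) = U (Suc i) a + (\<Sum>i=Suc (Suc i)..m. U i a)"
      using that by (simp add: sum.atLeast_Suc_atMost)
    moreover have "(\<Sum>i=Suc (Suc i)..m. U i a) = S a a * v (Suc (Suc i))"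
      using sum_U[OF a, of "Suc (Suc i)"] that by (cases "Suc i = m") (auto simp: v_def)
    ultimately show ?thesis using sum_U[OF a, of "Suc i"] that
      by (simp add: u_def v_def right_diff_distrib)
  qed
  have v: "v i = V i a" "u i = U i a" if "i \<in> {1..m}" for i using that by (auto simp: u_def v_def)
  have nv: "(\<Sum>i=1..m. (v i)\<^sup>2) = 1" "(\<Sum>i=1..m. (u i)\<^sup>2) = 1"
    using V_ortho[OF a a] U_ortho[OF a a] by (simp_all add: v power2_eq_square)
  have *: "u 0 = 0" "v (Suc m) = 0" by (simp_all add: u_def v_def)
  note rec = difference_recurrence[OF * S_pos[OF a] m_pos V U nv]
  show "(\<Sum>i=1..m. V i a)\<^sup>2 = (4 * (S a a)\<^sup>2 - 1) / (2 * real m + 1)"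
    using rec(1) by (simp add: v)
  show "i \<in> {1..m} \<Longrightarrow> (V i a)\<^sup>2 \<le> 4 / (2 * real m + 1)"
    using rec(2)[of i] by (simp add: v)
qed

text \<open>Summation maps the all-ones vector, of squared norm \<open>m\<close>, to the vector with
  entries \<open>1, ..., m\<close>, whose squared norm is at least \<open>m^3 / 3\<close>. The
  quotient is a lower bound for the largest squared singular value.\<close>

lemma S1_sq_ge: "(S 1 1)\<^sup>2 \<ge> (real m)\<^sup>2 / 3"
proof -
  define w where "w a = (\<Sum>j=1..m. V j a)" for a
  have bessel: "(\<Sum>a=1..m. (w a)\<^sup>2) \<le> real m"
  proof -
    have "0 \<le> (\<Sum>j=1..m. (1 - (\<Sum>a=1..m. V j a * w a))\<^sup>2)" by (intro sum_nonneg) auto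
    also have "\<dots> = (\<Sum>j=1..m. 1 - 2 * (\<Sum>a=1..m. V j a * w a) + (\<Sum>a=1..m. V j a * w a)\<^sup>2)"
      by (simp add: power2_eq_square algebra_simps)
    also have "\<dots> = real m - 2 * (\<Sum>j=1..m. \<Sum>a=1..m. V j a * w a) + (\<Sum>a=1..m. (w a)\<^sup>2)"
      using sum_sq_orthonormal[where A = "{1..m}" and I = "{1..m}" and U = V and c = w] V_ortho
      by (simp add: sum.distrib sum_subtractf sum_distrib_left)
    also have "(\<Sum>j=1..m. \<Sum>a=1..m. V j a * w a) = (\<Sum>a=1..m. (w a)\<^sup>2)"
      by (subst sum.swap) (simp add: w_def power2_eq_square sum_distrib_right)
    finally show ?thesis by simp
  qed
  have Bi: "(\<Sum>a=1..m. U i a * (S a a * w a)) = real i" if "i \<in> {1..m}" for i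
  proof -
    have "(\<Sum>a=1..m. U i a * (S a a * w a)) = (\<Sum>j=1..m. B i j)"
      unfolding B_def by (subst sum.swap) (simp add: w_def sum_distrib_left mult_ac)
    also have "\<dots> = (\<Sum>j=1..i. 1)"
      using that by (intro sum.mono_neutral_cong_right) (auto simp: B_eq)
    finally show ?thesis by simp
  qed
  have sq: "(\<Sum>i=1..n. (real i)\<^sup>2) \<ge> real n ^ 3 / 3" for n
    by (induction n) (auto simp: power2_eq_square power3_eq_cube field_simps)
  have "real m ^ 3 / 3 \<le> (\<Sum>i=1..m. (real i)\<^sup>2)" by (rule sq)
  also have "\<dots> = (\<Sum>i=1..m. (\<Sum>a=1..m. U i a * (S a a * w a))\<^sup>2)" using Bi by simp
  also have "\<dots> = (\<Sum>a=1..m. (S a a * w a)\<^sup>2)"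
    by (rule sum_sq_orthonormal) (auto simp: U_ortho simp del: One_nat_def)
  also have "\<dots> \<le> (\<Sum>a=1..m. (S 1 1)\<^sup>2 * (w a)\<^sup>2)"
    unfolding power_mult_distrib using S_nonneg S_le by (intro sum_mono mult_right_mono power_mono) auto
  also have "\<dots> \<le> (S 1 1)\<^sup>2 * real m"
    unfolding sum_distrib_left[symmetric] by (intro mult_left_mono bessel) auto
  finally show ?thesis using m_pos by (simp add: power3_eq_cube power2_eq_square field_simps)
qed

lemma sum_V1_sq_ge: "(\<Sum>i=1..m. V i 1)\<^sup>2 \<ge> (4 * (real m)\<^sup>2 / 3 - 1) / (2 * real m + 1)"
proof -
  have "(4 * (real m)\<^sup>2 / 3 - 1) / (2 * real m + 1) \<le> (4 * (S 1 1)\<^sup>2 - 1) / (2 * real m + 1)"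
    using S1_sq_ge by (intro divide_right_mono) auto
  then show ?thesis using recurrence(1)[of 1] m_pos by simp
qed

end

section \<open>Row samples of a harmonic frame\<close>

lemma cnorm_sq: "(cnorm n x)\<^sup>2 = (\<Sum>i=1..n. (cmod (x i))\<^sup>2)"
  by (simp add: cnorm_def sum_nonneg)

lemma sum_powers_root_unity:
  fixes z :: complex
  assumes "z ^ N = 1" "z \<noteq> 1"
  shows "(\<Sum>j=1..N. z ^ j) = 0"
proof -
  have "(\<Sum>j=1..N. z ^ j) = z * (\<Sum>i<N. z ^ i)"
    by (simp add: sum.atLeast1_atMost_eq sum_distrib_left)
  then show ?thesis using geometric_sum[OF assms(2), of N] assms(1) by simp
qed

text \<open>The assumption \<open>9 * l \<le> m\<close> comes from \<open>l \<le> m / pi^2\<close>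
  and \<open>pi > 3\<close>.\<close>

locale harmonic_setup = svd m U S V for m :: nat and U S V :: "nat \<Rightarrow> nat \<Rightarrow> real" +
  fixes N k l :: nat and \<omega> :: "nat \<Rightarrow> nat"
  assumes N_pos: "N \<ge> 1" and k_pos: "k \<ge> 1" and l_pos: "l \<ge> 1"
    and inj: "inj_on \<omega> {1..k}" and range: "\<omega> ` {1..k} \<subseteq> {1..N}" and l_le: "9 * l \<le> m"
begin

text \<open>Frequencies lie in \<open>{1..N}\<close>, so the constant column is the one with
  \<open>\<omega> s = N\<close>, and injectivity allows at most one.\<close>

definition K :: "nat set" where
  "K = {s \<in> {1..k}. \<omega> s \<noteq> N}"

definition \<zeta> :: "nat \<Rightarrow> complex" where
  "\<zeta> s = cis (2 * pi * real (\<omega> s) / real N)"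

definition u :: "nat \<Rightarrow> nat \<Rightarrow> complex" where
  "u j s = (if s \<in> K then cnj (harmonic_frame N \<omega> j s) else 0)"

definition P :: "nat \<Rightarrow> nat \<Rightarrow> real" where
  "P r q = (\<Sum>a=1..l. V r a * V q a)"

definition d :: real where
  "d = 2 * real l / real m"

lemma l_sub: "a \<in> {1..l} \<Longrightarrow> a \<in> {1..m}"
  using l_le by auto

lemma harmonic_eq: "harmonic_frame N \<omega> j s = \<zeta> s ^ j"
proof -
  have "harmonic_frame N \<omega> j s = exp (\<i> * of_real (real j * (2 * pi * real (\<omega> s) / real N)))"
    unfolding harmonic_frame_def by (rule arg_cong[where f = exp]) (simp add: mult_ac)
  also have "\<dots> = cis (real j * (2 * pi * real (\<omega> s) / real N))" by (simp only: cis_conv_exp)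
  finally show ?thesis by (simp only: \<zeta>_def Complex.DeMoivre)
qed

lemma zeta_root: "\<zeta> s ^ N = 1"
proof -
  have "\<zeta> s ^ N = cis (2 * pi * real (\<omega> s))" using N_pos by (simp add: \<zeta>_def Complex.DeMoivre)
  then show ?thesis by (simp add: cis_multiple_2pi)
qed

lemma cmod_zeta: "cmod (\<zeta> s) = 1"
  by (simp add: \<zeta>_def)

lemma omega_K: assumes "s \<in> K" shows "1 \<le> \<omega> s" "\<omega> s < N"
proof -
  have "\<omega> s \<in> {1..N}" using assms range unfolding K_def by blast
  moreover have "\<omega> s \<noteq> N" using assms by (simp add: K_def)
  ultimately show "1 \<le> \<omega> s" "\<omega> s < N" by auto
qed

lemma inj_roots: "inj_on (\<lambda>a. cis (2 * pi * real a / real N)) {..<N}"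
  using Complex.bij_betw_roots_unity[of N] N_pos by (simp add: bij_betw_def)

lemma zeta_inj:
  assumes "s \<in> K" "t \<in> K" "\<zeta> s = \<zeta> t" shows "s = t"
proof -
  have "\<omega> s = \<omega> t"
    using inj_onD[OF inj_roots, of "\<omega> s" "\<omega> t"] assms omega_K by (simp add: \<zeta>_def)
  moreover have "s \<in> {1..k}" "t \<in> {1..k}" using assms by (simp_all add: K_def)
  ultimately show ?thesis using inj inj_onD by metis
qed

lemma zeta_neq_1: assumes "s \<in> K" shows "\<zeta> s \<noteq> 1"
proof
  assume "\<zeta> s = 1"
  then have "\<omega> s = 0"
    using inj_onD[OF inj_roots, of "\<omega> s" 0] omega_K[OF assms] by (simp add: \<zeta>_def)
  then show False using omega_K[OF assms] by simp
qed

lemma cnj_zeta_mult: "cnj (\<zeta> s) * \<zeta> t = 1 \<longleftrightarrow> \<zeta> s = \<zeta> t"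
proof -
  have "\<zeta> s * cnj (\<zeta> s) = 1" using complex_norm_square[of "\<zeta> s"] cmod_zeta by simp
  then show ?thesis by (metis mult.commute mult.left_commute mult_cancel_left mult_1_right zero_neq_one mult_zero_left)
qed

text \<open>Mean zero and isotropy are geometric sums over nontrivial \<open>N\<close>-th roots of
  unity; idempotence of \<open>P\<close> is the orthonormality of the columns of
  \<open>V\<close>.\<close>

sublocale pf: projected_frame K N m u k P d
proof unfold_locales
  show "finite K" by (simp add: K_def)
  show "1 \<le> N" by (rule N_pos)
  have "K \<subseteq> {1..k}" by (auto simp: K_def)
  then show "card K \<le> k" using card_mono[of "{1..k}" K] by simp
  show "1 \<le> k" by (rule k_pos)
  show "u j s = 0" if "s \<notin> K" for s j using that by (simp add: u_def)
  show "cmod (u j s) = 1" if "s \<in> K" for s j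
    using that by (simp add: u_def harmonic_eq norm_power cmod_zeta)
  show "(\<Sum>j=1..N. u j s) = 0" for s
  proof (cases "s \<in> K")
    case True
    then have "(\<Sum>j=1..N. u j s) = (\<Sum>j=1..N. cnj (\<zeta> s) ^ j)" by (simp add: u_def harmonic_eq)
    also have "\<dots> = 0"
    proof (rule sum_powers_root_unity)
      show "cnj (\<zeta> s) ^ N = 1" using zeta_root[of s] by (metis complex_cnj_one complex_cnj_power)
      show "cnj (\<zeta> s) \<noteq> 1" using zeta_neq_1[OF True] by (metis complex_cnj_one complex_cnj_cancel_iff)
    qed
    finally show ?thesis .
  qed (simp add: u_def)
  show "(\<Sum>j=1..N. u j s * cnj (u j t)) = (if s = t then of_nat N else 0)" if "s \<in> K" "t \<in> K" for s t
  proof -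
    have "(\<Sum>j=1..N. u j s * cnj (u j t)) = (\<Sum>j=1..N. (cnj (\<zeta> s) * \<zeta> t) ^ j)"
      using that by (simp add: u_def harmonic_eq power_mult_distrib)
    also have "\<dots> = (if s = t then of_nat N else 0)"
    proof (cases "s = t")
      case True
      then show ?thesis using cnj_zeta_mult[of s t] by simp
    next
      case False
      have "(\<Sum>j=1..N. (cnj (\<zeta> s) * \<zeta> t) ^ j) = 0"
      proof (rule sum_powers_root_unity)
        show "(cnj (\<zeta> s) * \<zeta> t) ^ N = 1"
          using zeta_root by (metis complex_cnj_one complex_cnj_power mult_1 power_mult_distrib)
        show "cnj (\<zeta> s) * \<zeta> t \<noteq> 1" using zeta_inj[OF that] False cnj_zeta_mult by auto
      qed
      then show ?thesis using False by simp
    qed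
    finally show ?thesis .
  qed
  show "P r q = P q r" for r q by (simp add: P_def mult.commute)
  show "(\<Sum>q=1..m. P r q * P q t) = P r t" for r t
  proof -
    have "(\<Sum>q=1..m. P r q * P q t) = (\<Sum>q=1..m. \<Sum>a=1..l. \<Sum>b=1..l. V r a * V t b * (V q a * V q b))"
      by (simp add: P_def sum_product mult_ac)
    also have "\<dots> = (\<Sum>a=1..l. \<Sum>b=1..l. \<Sum>q=1..m. V r a * V t b * (V q a * V q b))"
      by (rule sum_swap3)
    also have "\<dots> = (\<Sum>a=1..l. \<Sum>b=1..l. if a = b then V r a * V t a else 0)"
      unfolding sum_distrib_left[symmetric] by (intro sum.cong refl) (simp add: V_ortho[OF l_sub l_sub] del: One_nat_def)
    finally show ?thesis by (simp add: P_def sum.delta)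
  qed
  have m: "real m > 0" using m_pos by simp
  show "P r r \<le> d" if "r \<in> {1..m}" for r
  proof -
    have "P r r = (\<Sum>a=1..l. (V r a)\<^sup>2)" by (simp add: P_def power2_eq_square)
    also have "\<dots> \<le> (\<Sum>a=1..l. 4 / (2 * real m + 1))" using recurrence(2) l_sub that by (intro sum_mono) blast
    also have "\<dots> = real l * (4 / (2 * real m + 1))" by simp
    also have "\<dots> \<le> real l * (2 / real m)" using m by (intro mult_left_mono) (auto simp: field_simps)
    finally show ?thesis by (simp add: d_def mult.commute)
  qed
  show "0 < d" using l_pos m by (simp add: d_def)
  show "d \<le> 1" using l_le m by (simp add: d_def field_simps)
qed

lemma trace_P: "(\<Sum>r=1..m. P r r) = real l"
proof -
  have "(\<Sum>r=1..m. P r r) = (\<Sum>a=1..l. \<Sum>r=1..m. V r a * V r a)"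
    unfolding P_def by (rule sum.swap)
  also have "\<dots> = (\<Sum>a=1..l. 1)"
    by (intro sum.cong refl) (simp add: V_ortho[OF l_sub l_sub] del: One_nat_def)
  finally show ?thesis by simp
qed

section \<open>The constant column and the splitting of the sampled operator\<close>

definition w :: "nat \<Rightarrow> real" where
  "w a = (\<Sum>r=1..m. V r a)"

text \<open>The projection \<open>P 1\<close> of the all-ones vector. Its entries are the
  coefficients with which the sampled rows enter the inner product of the constant column with the
  other columns.\<close>

definition e :: "nat \<Rightarrow> real" where
  "e r = (\<Sum>a=1..l. V r a * w a)"

abbreviation w2 :: real where
  "w2 \<equiv> (\<Sum>a=1..l. (w a)\<^sup>2)"

lemma sum_e_sq: "(\<Sum>r=1..m. (e r)\<^sup>2) = w2"
  unfolding e_def by (rule sum_sq_orthonormal) (auto simp: V_ortho[OF l_sub l_sub] simp del: One_nat_def)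

text \<open>One column is enough: the first right singular vector carries about
  \<open>2 m / 3\<close> of the squared norm \<open>m\<close> of the all-ones vector, and
  \<open>m \<ge> 9 l\<close>.\<close>

lemma w2_ge: "w2 \<ge> 2 * real l"
proof -
  have m9: "real m \<ge> 9 * real l" using l_le by linarith
  then have m9': "real m \<ge> 9" using l_pos by simp
  have "2 * real l * (2 * real m + 1) \<le> 2 * (real m / 9) * (2 * real m + 1)"
    using m9 by (intro mult_right_mono mult_left_mono) auto
  also have "\<dots> \<le> 4 * (real m)\<^sup>2 / 3 - 1"
  proof -
    define t where "t = real m * real m"
    have t: "9 * real m \<le> t" unfolding t_def using m9' by (intro mult_right_mono) auto
    have "2 * (real m / 9) * (2 * real m + 1) = (4 * t + 2 * real m) / 9"
      by (simp add: t_def algebra_simps)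
    also have "\<dots> \<le> 4 * t / 3 - 1" using t m9' by simp
    finally show ?thesis by (simp add: t_def power2_eq_square)
  qed
  finally have "2 * real l \<le> (4 * (real m)\<^sup>2 / 3 - 1) / (2 * real m + 1)"
    by (simp add: pos_le_divide_eq)
  also have "\<dots> \<le> (w 1)\<^sup>2" unfolding w_def by (rule sum_V1_sq_ge)
  also have "\<dots> \<le> w2" using l_pos by (intro member_le_sum) auto
  finally show ?thesis .
qed

definition f :: "(nat \<Rightarrow> nat) \<Rightarrow> (nat \<Rightarrow> complex) \<Rightarrow> nat \<Rightarrow> complex" where
  "f J x r = (\<Sum>s\<in>K. harmonic_frame N \<omega> (J r) s * x s)"

definition y :: "(nat \<Rightarrow> nat) \<Rightarrow> (nat \<Rightarrow> complex) \<Rightarrow> nat \<Rightarrow> complex" where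
  "y J x a = (\<Sum>r=1..m. of_real (V r a) * f J x r)"

lemma f_eq: "f J x r = cnj (\<Sum>i\<in>K. cnj (x i) * u (J r) i)"
  by (simp add: f_def u_def mult.commute)

lemma norm_y_sq:
  "of_real (\<Sum>a=1..l. (cmod (y J x a))\<^sup>2) = (\<Sum>r=1..m. \<Sum>q=1..m. of_real (P r q) *
      ((\<Sum>i\<in>K. cnj (x i) * u (J r) i) * cnj (\<Sum>i\<in>K. cnj (x i) * u (J q) i)))"
proof -
  have "of_real (\<Sum>a=1..l. (cmod (y J x a))\<^sup>2) = (\<Sum>a=1..l. cnj (y J x a) * y J x a)"
    unfolding of_real_sum complex_norm_square by (simp only: mult.commute)
  also have "\<dots> = (\<Sum>a=1..l. \<Sum>r=1..m. \<Sum>q=1..m. of_real (V r a * V q a) * (cnj (f J x r) * f J x q))"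
    unfolding y_def cnj_sum sum_product by (simp add: mult_ac)
  also have "\<dots> = (\<Sum>r=1..m. \<Sum>q=1..m. \<Sum>a=1..l. of_real (V r a * V q a) * (cnj (f J x r) * f J x q))"
    by (rule sum_swap3)
  finally show ?thesis unfolding P_def of_real_sum sum_distrib_right f_eq complex_cnj_cnj .
qed

text \<open>The index set has at most one element, so this is the coordinate of \<open>x\<close> at
  the constant column, or 0 if there is none.\<close>

definition c :: "(nat \<Rightarrow> complex) \<Rightarrow> complex" where
  "c x = (\<Sum>s\<in>{1..k} - K. x s)"

lemma harmonic_const: assumes "s \<in> {1..k} - K" shows "harmonic_frame N \<omega> j s = 1"
proof -
  have "\<omega> s = N" using assms by (auto simp: K_def)
  then have "\<zeta> s = 1" using N_pos by (simp add: \<zeta>_def)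
  then show ?thesis by (simp add: harmonic_eq)
qed

lemma VlT_F_apply: "cmat_vec k (VlT_F m V (harmonic_frame N \<omega>) J) x a = y J x a + c x * of_real (w a)"
proof -
  have "cmat_vec k (VlT_F m V (harmonic_frame N \<omega>) J) x a
    = (\<Sum>s=1..k. \<Sum>r=1..m. of_real (V r a) * (harmonic_frame N \<omega> (J r) s * x s))"
    by (simp add: cmat_vec_def VlT_F_def sum_distrib_right mult.assoc)
  also have "\<dots> = (\<Sum>s\<in>K. \<Sum>r=1..m. of_real (V r a) * (harmonic_frame N \<omega> (J r) s * x s))
    + (\<Sum>s\<in>{1..k} - K. \<Sum>r=1..m. of_real (V r a) * (harmonic_frame N \<omega> (J r) s * x s))"
    by (subst sum.subset_diff[of K]) (auto simp: K_def)
  also have "(\<Sum>s\<in>K. \<Sum>r=1..m. of_real (V r a) * (harmonic_frame N \<omega> (J r) s * x s)) = y J x a"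
    unfolding y_def f_def sum_distrib_left by (rule sum.swap)
  also have "(\<Sum>s\<in>{1..k} - K. \<Sum>r=1..m. of_real (V r a) * (harmonic_frame N \<omega> (J r) s * x s))
    = (\<Sum>s\<in>{1..k} - K. x s * of_real (w a))"
    unfolding w_def of_real_sum sum_distrib_left
    by (intro sum.cong refl) (simp add: harmonic_const mult.commute)
  finally show ?thesis by (simp add: c_def sum_distrib_right)
qed

lemma cnorm_split: "(cnorm k x)\<^sup>2 = pf.nv x + (cmod (c x))\<^sup>2"
proof -
  have "(cmod (c x))\<^sup>2 = (\<Sum>s\<in>{1..k} - K. (cmod (x s))\<^sup>2)"
  proof (cases "{1..k} - K = {}")
    case True
    show ?thesis unfolding c_def True by simp
  next
    case False
    then obtain s where s: "s \<in> {1..k} - K" by blast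
    have "{1..k} - K = {s}"
    proof (intro equalityI subsetI)
      fix t assume t: "t \<in> {1..k} - K"
      then have "\<omega> s = \<omega> t" using s by (auto simp: K_def)
      then show "t \<in> {s}" using inj_onD[OF inj, of s t] s t by simp
    qed (use s in auto)
    then show ?thesis by (simp add: c_def)
  qed
  then show ?thesis unfolding cnorm_sq pf.nv_def
    by (subst sum.subset_diff[of K]) (auto simp: K_def)
qed

text \<open>The second clause controls the inner product of \<open>V_l^T 1\<close> with the
  remaining columns, through Cauchy-Schwarz against \<open>lincomb e J\<close>.\<close>

definition good_sample :: "nat \<Rightarrow> real \<Rightarrow> (nat \<Rightarrow> nat) \<Rightarrow> bool" where
  "good_sample p \<Lambda> J \<longleftrightarrow>
    (\<forall>x. \<bar>(\<Sum>a=1..l. (cmod (y J x a))\<^sup>2) - real l * pf.nv x\<bar> \<le> 2 * \<Lambda> * pf.nv x) \<and>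
    pf.nv (pf.lincomb e J) \<le> 64 * real k * real p * w2"

lemma good_sample_prob:
  assumes p: "p \<ge> 1" and mp: "real m \<le> 3 ^ p"
    and chaos: "9 * (4 * real p * (256 * real k * (real p)\<^sup>2 * d) * (8 * real m + 24 * (real p)\<^sup>2 * real k)
      + 32 * real p * real k * d * (7 * real m + 24 * (real p)\<^sup>2 * real k) + 64 * (real p)\<^sup>2 * (real k)\<^sup>2) \<le> \<Lambda>\<^sup>2"
    and diag: "9 * ((2 * real p * real k * d)\<^sup>2 + 4 * (2 * real p * real k * d) * real l) \<le> \<Lambda>\<^sup>2" and L: "\<Lambda> > 0"
  shows "pf.Pr (\<lambda>J. \<not> good_sample p \<Lambda> J) \<le> (3 / 2 * real m + real p) / 9 ^ p + 1 / 8 ^ p"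
proof -
  have eq: "\<bar>(\<Sum>a=1..l. (cmod (y J x a))\<^sup>2) - real l * pf.nv x\<bar> = cmod ((\<Sum>r=1..m. \<Sum>q=1..m. of_real (P r q) *
      ((\<Sum>i\<in>K. cnj (x i) * u (J r) i) * cnj (\<Sum>i\<in>K. cnj (x i) * u (J q) i))) - of_real (real l * pf.nv x))" for J x
    unfolding norm_y_sq[symmetric] of_real_diff[symmetric] norm_of_real ..
  have "pf.Pr (\<lambda>J. \<not> (\<forall>x. \<bar>(\<Sum>a=1..l. (cmod (y J x a))\<^sup>2) - real l * pf.nv x\<bar> \<le> 2 * \<Lambda> * pf.nv x))
    \<le> (real m + real p + real l / d) / 9 ^ p"
    unfolding eq using pf.form_concentration[OF p m_pos mp trace_P[symmetric] chaos diag L] .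
  also have "real l / d = real m / 2" using l_pos m_pos by (simp add: d_def)
  finally have 1: "pf.Pr (\<lambda>J. \<not> (\<forall>x. \<bar>(\<Sum>a=1..l. (cmod (y J x a))\<^sup>2) - real l * pf.nv x\<bar> \<le> 2 * \<Lambda> * pf.nv x))
    \<le> (3 / 2 * real m + real p) / 9 ^ p" by (simp add: algebra_simps)
  have 2: "pf.Pr (\<lambda>J. 64 * real k * real p * w2 \<le> pf.nv (pf.lincomb e J)) \<le> 1 / 8 ^ p"
    using w2_ge l_pos by (intro pf.subgaussian_tail p) (auto simp: sum_e_sq[simplified])
  have "pf.Pr (\<lambda>J. \<not> good_sample p \<Lambda> J) \<le>
    pf.Pr (\<lambda>J. \<not> (\<forall>x. \<bar>(\<Sum>a=1..l. (cmod (y J x a))\<^sup>2) - real l * pf.nv x\<bar> \<le> 2 * \<Lambda> * pf.nv x)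
      \<or> 64 * real k * real p * w2 \<le> pf.nv (pf.lincomb e J))"
    unfolding good_sample_def using linorder_le_cases by (intro pf.Pr_mono) blast
  also note pf.Pr_disj
  finally show ?thesis using 1 2 by linarith
qed

text \<open>Half of \<open>|c x|^2 w2\<close> absorbs the cross term. The other half is at least
  \<open>l |c x|^2\<close> because \<open>w2 \<ge> 2 l\<close>, so the constant coordinate is
  stretched as much as required. In the cross term \<open>w2\<close> cancels, since \<open>e\<close>
  has squared norm \<open>w2\<close>.\<close>

lemma good_sample_lower:
  assumes g: "good_sample p \<Lambda> J" and L: "\<Lambda> \<ge> 0" and x: "cnorm k x = 1"
  shows "real l - 2 * \<Lambda> - 128 * real k * real p
    \<le> (cnorm l (cmat_vec k (VlT_F m V (harmonic_frame N \<omega>) J) x))\<^sup>2"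
proof -
  define Y where "Y = (\<Sum>a=1..l. (cmod (y J x a))\<^sup>2)"
  define X where "X = (\<Sum>a=1..l. y J x a * of_real (w a))"
  have cross: "(cmod X)\<^sup>2 \<le> pf.nv x * (64 * real k * real p * w2)"
  proof -
    have "X = (\<Sum>a=1..l. \<Sum>r=1..m. of_real (V r a * w a) * f J x r)"
      unfolding X_def y_def sum_distrib_right by (intro sum.cong refl) (simp add: mult_ac)
    also have "\<dots> = (\<Sum>r=1..m. \<Sum>a=1..l. of_real (V r a * w a) * f J x r)" by (rule sum.swap)
    also have "\<dots> = (\<Sum>r=1..m. \<Sum>s\<in>K. of_real (e r) * (cnj (u (J r) s) * x s))"
      unfolding sum_distrib_left[symmetric] sum_distrib_right[symmetric] of_real_sum[symmetric] e_def[symmetric]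
      by (simp add: f_def u_def cong: sum.cong)
    also have "\<dots> = (\<Sum>s\<in>K. \<Sum>r=1..m. of_real (e r) * (cnj (u (J r) s) * x s))" by (rule sum.swap)
    also have "\<dots> = (\<Sum>s\<in>K. x s * cnj (pf.lincomb e J s))"
      by (simp add: pf.lincomb_def sum_distrib_left mult_ac)
    finally have "(cmod X)\<^sup>2 \<le> pf.nv x * pf.nv (pf.lincomb e J)"
      using cmod_sum_mult_sq_le[of x "\<lambda>s. cnj (pf.lincomb e J s)" K] by (simp add: pf.nv_def)
    also have "\<dots> \<le> pf.nv x * (64 * real k * real p * w2)"
      using g pf.nv_nonneg unfolding good_sample_def by (intro mult_left_mono) auto
    finally show ?thesis .
  qed
  have "(cnorm l (cmat_vec k (VlT_F m V (harmonic_frame N \<omega>) J) x))\<^sup>2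
    = (\<Sum>a=1..l. (cmod (y J x a))\<^sup>2 + (cmod (c x))\<^sup>2 * (w a)\<^sup>2 + 2 * Re (cnj (c x) * (y J x a * of_real (w a))))"
    unfolding cnorm_sq VlT_F_apply cmod_power2
    by (intro sum.cong refl) (simp add: power2_eq_square algebra_simps)
  also have "\<dots> = Y + (cmod (c x))\<^sup>2 * w2 + 2 * Re (cnj (c x) * X)"
    unfolding sum.distrib Y_def X_def sum_distrib_left Re_sum by simp
  finally have M: "(cnorm l (cmat_vec k (VlT_F m V (harmonic_frame N \<omega>) J) x))\<^sup>2
    = Y + (cmod (c x))\<^sup>2 * w2 + 2 * Re (cnj (c x) * X)" .
  have "\<bar>Re (cnj (c x) * X)\<bar> \<le> cmod (c x) * cmod X"
    using abs_Re_le_cmod[of "cnj (c x) * X"] by (simp add: norm_mult)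
  moreover have "2 * (cmod (c x) * cmod X) \<le> 1 / 2 * (cmod (c x))\<^sup>2 * w2 + 128 * real k * real p * pf.nv x"
  proof -
    have wp: "w2 > 0" using w2_ge l_pos by simp
    have "0 \<le> (cmod (c x) * w2 - 2 * cmod X)\<^sup>2 / (2 * w2)" using wp by simp
    also have "\<dots> = 1 / 2 * (cmod (c x))\<^sup>2 * w2 + 2 * (cmod X)\<^sup>2 / w2 - 2 * (cmod (c x) * cmod X)"
      using wp by (simp add: power2_eq_square field_simps)
    also have "2 * (cmod X)\<^sup>2 / w2 \<le> 2 * (pf.nv x * (64 * real k * real p * w2)) / w2"
      using cross wp by (intro divide_right_mono mult_left_mono) auto
    also have "\<dots> = 128 * real k * real p * pf.nv x" using wp by simp
    finally show ?thesis by simp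
  qed
  moreover have "Y \<ge> (real l - 2 * \<Lambda>) * pf.nv x"
    using g unfolding good_sample_def Y_def by (simp add: abs_le_iff algebra_simps) 
  moreover have "1 / 2 * (cmod (c x))\<^sup>2 * w2 \<ge> (cmod (c x))\<^sup>2 * real l"
    using mult_left_mono[OF w2_ge, of "1 / 2 * (cmod (c x))\<^sup>2"] by simp
  ultimately have "(real l - 2 * \<Lambda> - 128 * real k * real p) * pf.nv x + real l * (cmod (c x))\<^sup>2
    \<le> (cnorm l (cmat_vec k (VlT_F m V (harmonic_frame N \<omega>) J) x))\<^sup>2"
    unfolding M by (simp add: algebra_simps)
  moreover have "(real l - 2 * \<Lambda> - 128 * real k * real p) * (cmod (c x))\<^sup>2 \<le> real l * (cmod (c x))\<^sup>2"
  proof (rule mult_right_mono)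
    have "0 \<le> 128 * real k * real p" by simp
    then show "real l - 2 * \<Lambda> - 128 * real k * real p \<le> real l" using L by linarith
  qed simp
  moreover have "(real l - 2 * \<Lambda> - 128 * real k * real p) * pf.nv x
    + (real l - 2 * \<Lambda> - 128 * real k * real p) * (cmod (c x))\<^sup>2 = real l - 2 * \<Lambda> - 128 * real k * real p"
    unfolding distrib_left[symmetric] cnorm_split[symmetric] x by simp
  ultimately show ?thesis by linarith
qed

lemma good_sample_upper:
  assumes g: "good_sample p \<Lambda> J" and x: "cnorm k x = 1"
    and ones: "\<not> (\<exists>s\<in>{1..k}. \<forall>j\<in>{1..N}. harmonic_frame N \<omega> j s = 1)"
  shows "(cnorm l (cmat_vec k (VlT_F m V (harmonic_frame N \<omega>) J) x))\<^sup>2 \<le> real l + 2 * \<Lambda>"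
proof -
  have "{1..k} - K = {}" using ones harmonic_const by blast
  then have c0: "c x = 0" unfolding c_def by (metis sum.empty)
  have "(cnorm l (cmat_vec k (VlT_F m V (harmonic_frame N \<omega>) J) x))\<^sup>2 = (\<Sum>a=1..l. (cmod (y J x a))\<^sup>2)"
    unfolding cnorm_sq VlT_F_apply c0 by simp
  moreover have "pf.nv x = 1" using cnorm_split[of x] x c0 by simp
  moreover have "\<bar>(\<Sum>a=1..l. (cmod (y J x a))\<^sup>2) - real l * pf.nv x\<bar> \<le> 2 * \<Lambda> * pf.nv x"
    using g unfolding good_sample_def by blast
  ultimately show ?thesis by simp
qed

lemma row_sample_prob_eq: "row_sample_prob N m Q = pf.Pr Q"
proof -
  have "(\<Sum>J\<in>pf.\<Omega>. if Q J then 1 else 0 :: real) = real (card {J \<in> pf.\<Omega>. Q J})"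
    using pf.finite_Omega by (simp add: sum.inter_filter[symmetric] flip: of_nat_sum)
  then show ?thesis
    by (simp add: row_sample_prob_def pf.Pr_def avg_def pf.card_Omega) (simp add: pf.\<Omega>_def)
qed

end

section \<open>Extremal singular values and the numerical constants\<close>

lemma cnorm_nonneg: "0 \<le> cnorm n x"
  by (simp add: cnorm_def sum_nonneg)

text \<open>Ensures that the infima and suprema defining singular values range over nonempty
  sets.\<close>

lemma exists_unit_vector: "n \<ge> 1 \<Longrightarrow> \<exists>x. cnorm n x = 1"
proof
  assume n: "n \<ge> 1"
  have "(\<Sum>i=1..n. (cmod (if i = 1 then 1 else 0))\<^sup>2) = (\<Sum>i=1..n. if i = 1 then 1 else 0)"
    by (intro sum.cong) auto
  then show "cnorm n (\<lambda>i. if i = 1 then 1 else 0) = 1"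
    using n by (simp add: cnorm_def sum.delta)
qed

lemma sigma_min_nonneg:
  assumes "l \<ge> 1" "k \<ge> 1" shows "0 \<le> sigma_min l k A"
  unfolding sigma_min_def
  using exists_unit_vector[OF assms(1)] exists_unit_vector[OF assms(2)]
  by (auto intro!: cInf_greatest simp: cnorm_nonneg)

lemma sigma_min_ge:
  assumes "1 \<le> k" "k \<le> l" and "\<And>x. cnorm k x = 1 \<Longrightarrow> b \<le> (cnorm l (cmat_vec k A x))\<^sup>2"
  shows "sqrt b \<le> sigma_min l k A"
proof -
  have "sqrt b \<le> cnorm l (cmat_vec k A x)" if "cnorm k x = 1" for x
    using assms(3)[OF that] cnorm_nonneg real_le_lsqrt by (metis real_sqrt_le_iff real_sqrt_unique)
  then show ?thesis
    unfolding sigma_min_def using assms exists_unit_vector[OF assms(1)]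
    by (auto intro!: cInf_greatest)
qed

lemma sigma_max_le:
  assumes "1 \<le> k" and "\<And>x. cnorm k x = 1 \<Longrightarrow> (cnorm l (cmat_vec k A x))\<^sup>2 \<le> b"
  shows "sigma_max l k A \<le> sqrt b"
proof -
  have "cnorm l (cmat_vec k A x) \<le> sqrt b" if "cnorm k x = 1" for x
    using assms(2)[OF that] by (rule real_le_rsqrt)
  then show ?thesis
    unfolding sigma_max_def using exists_unit_vector[OF assms(1)]
    by (auto intro!: cSup_least)
qed

text \<open>As \<open>e^2 \<le> 8\<close>, both \<open>8^p\<close> and \<open>9^p\<close> dominate
  \<open>e^(2p)\<close>. One factor \<open>e^p\<close> pays for \<open>m\<close> and for
  \<open>1 + p\<close>, the other is at least \<open>m / \<epsilon>\<close>; the total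
  \<open>5/2 * \<epsilon> / m\<close> is below \<open>\<epsilon>\<close>.\<close>

lemma tail_numerics:
  fixes m \<epsilon> :: real
  assumes eps: "0 < \<epsilon>" "\<epsilon> \<le> 1" and m: "m \<ge> 9" and p: "m / \<epsilon> \<le> exp (real p)"
  shows "(3 / 2 * m + real p) / 9 ^ p + 1 / 8 ^ p < \<epsilon>"
proof -
  define E where "E = exp (real p)"
  have E0: "E > 0" by (simp add: E_def)
  have "(exp 1)\<^sup>2 \<le> (272 / 100 :: real)\<^sup>2" using e_less_272 by (intro power_mono) auto
  then have e8: "(exp 1)\<^sup>2 \<le> (8::real)" by (simp add: power2_eq_square)
  have E2: "E\<^sup>2 = ((exp 1)\<^sup>2) ^ p"
    by (simp add: E_def exp_of_nat_mult[symmetric] power_mult[symmetric] exp_double[symmetric] mult.commute)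
  have "E\<^sup>2 \<le> 8 ^ p" unfolding E2 by (intro power_mono e8) auto
  moreover have "E\<^sup>2 \<le> 9 ^ p" unfolding E2 using e8 by (intro power_mono) auto
  ultimately have "(3 / 2 * m + real p) / 9 ^ p + 1 / 8 ^ p \<le> (3 / 2 * m + real p) / E\<^sup>2 + 1 / E\<^sup>2"
    using m E0 by (intro add_mono divide_left_mono) auto
  also have "\<dots> = 3 / 2 * (m / E\<^sup>2) + (1 + real p) / E\<^sup>2" by (simp add: add_divide_distrib)
  also have "\<dots> \<le> 3 / 2 * (m / E\<^sup>2) + E / E\<^sup>2"
    unfolding E_def by (intro add_left_mono divide_right_mono exp_ge_add_one_self) auto
  also have "\<dots> = 3 / 2 * (m / E\<^sup>2) + 1 / E" using E0 by (simp add: power2_eq_square)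
  also have "3 / 2 * (m / E\<^sup>2) + 1 / E \<le> 3 / 2 * (1 / E) + 1 / E"
  proof -
    have "m * \<epsilon> \<le> m * 1" using eps m by (intro mult_left_mono) auto
    then have "m \<le> m / \<epsilon>" using eps by (simp add: pos_le_divide_eq)
    then have "m \<le> E" using p by (simp add: E_def)
    then have "m / E\<^sup>2 \<le> E / E\<^sup>2" by (intro divide_right_mono) auto
    then show ?thesis using E0 by (simp add: power2_eq_square)
  qed
  also have "\<dots> = 5 / 2 * (1 / E)" by simp
  also have "\<dots> \<le> 5 / 2 * (\<epsilon> / m)"
    using p eps m E0 unfolding E_def[symmetric] by (simp add: field_simps)
  also have "\<dots> < \<epsilon>" using m eps by (simp add: field_simps)
  finally show ?thesis .
qed

text \<open>Each \<open>m\<close> meets a \<open>d\<close>, and \<open>d m = 2 l\<close> removes it;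
  where \<open>d\<close> remains it is bounded by 1. Then \<open>16832 = 16384 + 448\<close> and
  \<open>25408 = 24576 + 768 + 64\<close>.\<close>

lemma chaos_numerics:
  fixes k p l m :: real
  assumes k: "k \<ge> 1" and p: "p \<ge> 1" and l: "l \<ge> 1" and m: "9 * l \<le> m" and d: "d = 2 * l / m"
    and X: "X = k * p ^ 3"
  shows "4 * p * (256 * k * p\<^sup>2 * d) * (8 * m + 24 * p\<^sup>2 * k) + 32 * p * k * d * (7 * m + 24 * p\<^sup>2 * k)
      + 64 * p\<^sup>2 * k\<^sup>2 \<le> 16832 * (X * l) + 25408 * X\<^sup>2"
    and "(2 * p * k * d)\<^sup>2 + 4 * (2 * p * k * d) * l \<le> 8 * (X * l) + 4 * X\<^sup>2"
proof -
  have m0: "m > 0" using l m by linarith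
  have dm: "d * m = 2 * l" using m0 by (simp add: d)
  have d01: "0 \<le> d" "d \<le> 1" using l m m0 by (auto simp: d field_simps)
  have p3: "p \<le> p ^ 3" using power_increasing[of 1 3 p] p by simp
  have pk: "p * k \<le> X" unfolding X using mult_right_mono[OF p3, of k] k by (simp add: mult.commute)
  have pk0: "p * k \<ge> 0" using p k by simp
  have X0: "X \<ge> 0" using pk pk0 by linarith
  have pk2: "(p * k)\<^sup>2 \<le> X\<^sup>2" using pk pk0 by (rule power_mono)
  have p33: "k\<^sup>2 * p ^ n \<le> X\<^sup>2" if "n \<le> 6" for n
  proof -
    have "k\<^sup>2 * p ^ n \<le> k\<^sup>2 * p ^ 6" using p that by (intro mult_left_mono power_increasing) auto
    then show ?thesis by (simp add: X power_mult_distrib flip: power_mult)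
  qed
  have pl: "p * k * l \<le> X * l" using pk l by (intro mult_right_mono) auto
  have 1: "k\<^sup>2 * p ^ 5 * d \<le> X\<^sup>2"
    using mult_mono[OF p33[of 5] d01(2)] d01 by simp
  have 2: "k\<^sup>2 * p ^ 3 * d \<le> X\<^sup>2"
    using mult_mono[OF p33[of 3] d01(2)] d01 by simp
  have "4 * p * (256 * k * p\<^sup>2 * d) * (8 * m + 24 * p\<^sup>2 * k) + 32 * p * k * d * (7 * m + 24 * p\<^sup>2 * k) + 64 * p\<^sup>2 * k\<^sup>2
    = 8192 * (k * p ^ 3) * (d * m) + 24576 * (k\<^sup>2 * p ^ 5 * d) + 224 * (p * k) * (d * m) + 768 * (k\<^sup>2 * p ^ 3 * d) + 64 * (p * k)\<^sup>2"
    by (simp add: power2_eq_square power3_eq_cube eval_nat_numeral algebra_simps)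
  also have "\<dots> = 16384 * (X * l) + 24576 * (k\<^sup>2 * p ^ 5 * d) + 448 * (p * k * l) + 768 * (k\<^sup>2 * p ^ 3 * d) + 64 * (p * k)\<^sup>2"
    unfolding dm X by simp
  also have "\<dots> \<le> 16832 * (X * l) + 25408 * X\<^sup>2" using 1 2 pl pk2 by linarith
  finally show "4 * p * (256 * k * p\<^sup>2 * d) * (8 * m + 24 * p\<^sup>2 * k) + 32 * p * k * d * (7 * m + 24 * p\<^sup>2 * k)
      + 64 * p\<^sup>2 * k\<^sup>2 \<le> 16832 * (X * l) + 25408 * X\<^sup>2" .
  have pkd: "p * k * d \<le> p * k" using mult_left_mono[OF d01(2) pk0] by simp
  have "(p * k * d)\<^sup>2 \<le> (p * k)\<^sup>2" using pkd pk0 d01 by (intro power_mono) auto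
  moreover have "p * k * d * l \<le> X * l" using pkd pk l by (intro mult_right_mono) auto
  moreover have "(2 * p * k * d)\<^sup>2 + 4 * (2 * p * k * d) * l = 4 * (p * k * d)\<^sup>2 + 8 * (p * k * d * l)"
    by (simp add: power2_eq_square)
  ultimately show "(2 * p * k * d)\<^sup>2 + 4 * (2 * p * k * d) * l \<le> 8 * (X * l) + 4 * X\<^sup>2"
    using pk2 by linarith
qed

lemma row_sample_prob_le_1: "row_sample_prob N m Q \<le> 1"
proof -
  have "card {J \<in> {1..m} \<rightarrow>\<^sub>E {1..N}. Q J} \<le> card ({1..m} \<rightarrow>\<^sub>E {1..N})"
    by (intro card_mono finite_PiE) auto
  then have "real (card {J \<in> {1..m} \<rightarrow>\<^sub>E {1..N}. Q J}) \<le> real (N ^ m)"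
    by (simp add: card_PiE)
  then show ?thesis by (cases "N ^ m = 0") (auto simp: row_sample_prob_def divide_le_eq)
qed

lemma harmonic_frame_bounds:
  fixes \<eta> \<epsilon> :: real
  assumes "N \<ge> 1" "k \<ge> 1" "inj_on \<omega> {1..k}" "\<omega> ` {1..k} \<subseteq> {1..N}"
    and eta: "\<eta> > 0" and eps: "\<epsilon> > 0" "\<epsilon> \<le> 1" and l: "l \<ge> 1"
    and ml: "real m / pi\<^sup>2 \<ge> real l"
    and lk: "real l \<ge> 80000000 / \<eta>\<^sup>2 * real k * (ln (real m / \<epsilon>)) ^ 3"
    and svd: "is_svd_of_Dinv m U S V"
  shows "row_sample_prob N m (\<lambda>J. sigma_min l k (VlT_F m V (harmonic_frame N \<omega>) J)
      \<le> (1 - \<eta>) * sqrt (real l)) < \<epsilon>" (is "row_sample_prob N m ?E1 < \<epsilon>")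
    and "\<not> (\<exists>s\<in>{1..k}. \<forall>j\<in>{1..N}. harmonic_frame N \<omega> j s = 1) \<Longrightarrow>
      row_sample_prob N m (\<lambda>J. sigma_max l k (VlT_F m V (harmonic_frame N \<omega>) J)
      \<ge> (1 + \<eta>) * sqrt (real l)) < \<epsilon>" (is "_ \<Longrightarrow> row_sample_prob N m ?E2 < \<epsilon>")
proof -
  have "real l * 3\<^sup>2 \<le> real l * pi\<^sup>2" using pi_gt3 by (intro mult_left_mono power_mono) auto
  also have "\<dots> \<le> real m" using ml by (simp add: pos_le_divide_eq)
  finally have m9l: "9 * l \<le> m" by simp
  have m9: "real m \<ge> 9" using m9l l by linarith
  interpret harmonic_setup m U S V N k l \<omega>
    by unfold_locales (use assms m9l in auto)
  define L where "L = ln (real m / \<epsilon>)"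
  define p where "p = nat \<lceil>L\<rceil>"
  have "real m * \<epsilon> \<le> real m * 1" using eps by (intro mult_left_mono) auto
  then have me: "real m \<le> real m / \<epsilon>" using eps by (simp add: pos_le_divide_eq)
  have me9: "9 \<le> real m / \<epsilon>" using me m9 by linarith
  have L1: "1 \<le> L"
    unfolding L_def using me9 e_less_272 by (subst ln_ge_iff) auto
  have pL: "L \<le> real p" "real p \<le> 2 * L" unfolding p_def using L1 by linarith+
  have p1: "p \<ge> 1" using pL L1 by linarith
  have mp: "real m / \<epsilon> \<le> exp (real p)"
    using pL(1) me9 unfolding L_def by (metis exp_le_cancel_iff exp_ln less_le_trans zero_less_numeral)
  have m3p: "real m \<le> 3 ^ p"
  proof -
    have "exp (real p) = exp 1 ^ p" by (simp flip: exp_of_nat_mult)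
    also have "\<dots> \<le> 3 ^ p" using e_less_272 by (intro power_mono) auto
    finally show ?thesis using me mp by linarith
  qed
  define X where "X = real k * real p ^ 3"
  \<comment> \<open>For \<open>\<eta> \<le> 1\<close> the deviation \<open>2 * \<theta>\<close> is
    \<open>\<eta> l / 2\<close>. For \<open>\<eta> > 1\<close> it has to grow like
    \<open>\<eta>^2 l\<close>, because the hypothesis then bounds \<open>X\<close> only by a
    multiple of \<open>\<eta>^2 l\<close>; \<open>(1 + \<eta>)^2 l\<close> leaves room for
    this.\<close>
  define \<theta> where "\<theta> = \<eta> * real l * max 1 \<eta> / 4"
  have X0: "X \<ge> 0" by (simp add: X_def)
  \<comment> \<open>Rounding gives \<open>p \<le> 2 L\<close>, hence the factor \<open>2^3\<close>
    between \<open>10000000\<close> and the constant \<open>80000000\<close>.\<close>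
  have lX: "\<eta>\<^sup>2 * real l \<ge> 10000000 * X"
  proof -
    have "10000000 * X \<le> 10000000 * (real k * (2 * L) ^ 3)"
      unfolding X_def using pL by (intro mult_left_mono power_mono) auto
    also have "\<dots> = 80000000 * real k * L ^ 3" by (simp add: power_mult_distrib)
    also have "\<dots> \<le> \<eta>\<^sup>2 * real l" using lk eta by (simp add: L_def[symmetric] field_simps)
    finally show ?thesis .
  qed
  have th0: "\<theta> > 0" using eta l by (simp add: \<theta>_def)
  have th2: "\<theta>\<^sup>2 = (\<eta>\<^sup>2 * real l) * real l * (max 1 \<eta>)\<^sup>2 / 16"
    by (simp add: \<theta>_def power_mult_distrib power_divide power2_eq_square)
  have mx: "1 \<le> (max 1 \<eta>)\<^sup>2" "\<eta>\<^sup>2 \<le> (max 1 \<eta>)\<^sup>2"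
    using eta power_mono[of 1 "max 1 \<eta>" 2] power_mono[of \<eta> "max 1 \<eta>" 2] by auto
  have thA: "\<theta>\<^sup>2 \<ge> 600000 * (X * real l)"
  proof -
    have "10000000 * X * real l * 1 \<le> (\<eta>\<^sup>2 * real l) * real l * (max 1 \<eta>)\<^sup>2"
      using mx by (intro mult_mono[OF mult_right_mono[OF lX]]) auto
    moreover have "0 \<le> X * real l" using X0 by simp
    ultimately show ?thesis unfolding th2 by (simp add: field_simps)
  qed
  have thB: "\<theta>\<^sup>2 \<ge> 600000 * X\<^sup>2"
  proof -
    have "(10000000 * X) * (10000000 * X) \<le> (\<eta>\<^sup>2 * real l) * (\<eta>\<^sup>2 * real l)"
      using X0 by (intro mult_mono[OF lX lX]) auto
    also have "\<dots> \<le> (\<eta>\<^sup>2 * real l) * ((max 1 \<eta>)\<^sup>2 * real l)"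
      using mx by (intro mult_left_mono mult_right_mono) auto
    finally have "100000000000000 * X\<^sup>2 \<le> 16 * \<theta>\<^sup>2"
      unfolding th2 by (simp add: power2_eq_square mult_ac)
    then show ?thesis using zero_le_power2[of X] by linarith
  qed
  have pr: "(real k::real) \<ge> 1" "real p \<ge> 1" "real l \<ge> 1" "9 * real l \<le> real m"
    using k_pos p1 l m9l by linarith+
  note num = chaos_numerics[OF pr d_def X_def]
  have Xl0: "0 \<le> X * real l" "0 \<le> X\<^sup>2" using X0 by auto
  \<comment> \<open>The mean of \<open>thA\<close> and \<open>thB\<close> gives
    \<open>300000\<close> for both terms, while \<open>9 * 30000 = 270000\<close>.\<close>
  have gen: "9 * A \<le> \<theta>\<^sup>2"
    if "A \<le> a * (X * real l) + b * X\<^sup>2" "a \<le> 30000" "b \<le> 30000" for A a b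
  proof -
    have "a * (X * real l) + b * X\<^sup>2 \<le> 30000 * (X * real l) + 30000 * X\<^sup>2"
      using that Xl0 by (intro add_mono mult_right_mono) auto
    then show ?thesis using that(1) thA thB Xl0 by linarith
  qed
  have "pf.Pr (\<lambda>J. \<not> good_sample p \<theta> J) \<le> (3 / 2 * real m + real p) / 9 ^ p + 1 / 8 ^ p"
  proof (rule good_sample_prob[OF p1 m3p _ _ th0])
    show "9 * (4 * real p * (256 * real k * (real p)\<^sup>2 * d) * (8 * real m + 24 * (real p)\<^sup>2 * real k) +
      32 * real p * real k * d * (7 * real m + 24 * (real p)\<^sup>2 * real k) + 64 * (real p)\<^sup>2 * (real k)\<^sup>2) \<le> \<theta>\<^sup>2"
      by (rule gen[OF num(1)]) auto
    show "9 * ((2 * real p * real k * d)\<^sup>2 + 4 * (2 * real p * real k * d) * real l) \<le> \<theta>\<^sup>2"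
      by (rule gen[OF num(2)]) auto
  qed
  also have "\<dots> < \<epsilon>" by (rule tail_numerics[OF eps m9 mp])
  finally have prob: "pf.Pr (\<lambda>J. \<not> good_sample p \<theta> J) < \<epsilon>" .
  have E1: "\<not> ?E1 J" if g: "good_sample p \<theta> J" for J
  proof (cases "\<eta> > 1")
    case True
    have "(1 - \<eta>) * sqrt (real l) < 0" using True l by (simp add: mult_neg_pos)
    then show ?thesis
      using sigma_min_nonneg[OF l k_pos, of "VlT_F m V (harmonic_frame N \<omega>) J"] by linarith
  next
    case False
    have "\<eta>\<^sup>2 \<le> \<eta> * 1" unfolding power2_eq_square using False eta by (intro mult_left_mono) auto
    then have "\<eta>\<^sup>2 * real l \<le> \<eta> * real l" by (intro mult_right_mono) auto
    then have etal: "\<eta> * real l \<ge> 10000000 * X" using lX by linarith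
    have kpX: "real k * real p \<le> X"
      unfolding X_def using power_increasing[of 1 3 "real p"] pr by (intro mult_left_mono) auto
    have kX: "real k \<le> X" using kpX mult_left_mono[OF pr(2), of "real k"] by simp
    \<comment> \<open>The hypothesis forces \<open>k \<le> l\<close>, so \<open>sigma_min\<close> is
      the infimum over unit vectors of length \<open>k\<close>.\<close>
    have "\<eta> * real l \<le> 1 * real l" using False by (intro mult_right_mono) auto
    then have "real k \<le> real l" using etal kX X0 by linarith
    then have kl: "k \<le> l" by simp
    \<comment> \<open>The loss is \<open>\<eta> l / 2\<close> from the form and at most
      \<open>\<eta> l / 4\<close> from the constant column.\<close>
    have "sqrt ((1 - 3 / 4 * \<eta>) * real l) \<le> sigma_min l k (VlT_F m V (harmonic_frame N \<omega>) J)"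
    proof (rule sigma_min_ge[OF k_pos kl])
      fix x assume "cnorm k x = 1"
      then have "real l - 2 * \<theta> - 128 * real k * real p
        \<le> (cnorm l (cmat_vec k (VlT_F m V (harmonic_frame N \<omega>) J) x))\<^sup>2"
        using good_sample_lower[OF g] th0 by simp
      moreover have "2 * \<theta> = \<eta> * real l / 2" using False by (simp add: \<theta>_def max_def)
      moreover have "128 * real k * real p \<le> \<eta> * real l / 4" using etal kpX X0 by linarith
      ultimately show "(1 - 3 / 4 * \<eta>) * real l
        \<le> (cnorm l (cmat_vec k (VlT_F m V (harmonic_frame N \<omega>) J) x))\<^sup>2"
        by (simp add: algebra_simps)
    qed
    moreover have "(1 - \<eta>) * sqrt (real l) < sqrt ((1 - 3 / 4 * \<eta>) * real l)"
    proof -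
      have "(1 - \<eta>)\<^sup>2 \<le> (1 - \<eta>) * 1" unfolding power2_eq_square using False eta by (intro mult_left_mono) auto
      also have "\<dots> < 1 - 3 / 4 * \<eta>" using eta by simp
      finally have "(1 - \<eta>)\<^sup>2 * real l < (1 - 3 / 4 * \<eta>) * real l" using l by (intro mult_strict_right_mono) auto
      then have "sqrt ((1 - \<eta>)\<^sup>2 * real l) < sqrt ((1 - 3 / 4 * \<eta>) * real l)" by (rule real_sqrt_less_mono)
      then show ?thesis using False by (simp add: real_sqrt_mult)
    qed
    ultimately show ?thesis by linarith
  qed
  have "row_sample_prob N m ?E1 \<le> pf.Pr (\<lambda>J. \<not> good_sample p \<theta> J)"
    unfolding row_sample_prob_eq using E1 by (intro pf.Pr_mono) blast
  then show "row_sample_prob N m ?E1 < \<epsilon>" using prob by linarith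
  assume ones: "\<not> (\<exists>s\<in>{1..k}. \<forall>j\<in>{1..N}. harmonic_frame N \<omega> j s = 1)"
  have E2: "\<not> ?E2 J" if g: "good_sample p \<theta> J" for J
  proof -
    have "sigma_max l k (VlT_F m V (harmonic_frame N \<omega>) J) \<le> sqrt (real l + 2 * \<theta>)"
      by (intro sigma_max_le k_pos good_sample_upper[OF g _ ones])
    also have "\<dots> < sqrt ((1 + \<eta>)\<^sup>2 * real l)"
    proof (rule real_sqrt_less_mono)
      have "\<eta> * max 1 \<eta> \<le> \<eta> + \<eta>\<^sup>2" using eta by (simp add: max_def power2_eq_square)
      then have "\<eta> * max 1 \<eta> / 2 < 2 * \<eta> + \<eta>\<^sup>2" using eta zero_le_power2[of \<eta>] by linarith
      then have "\<eta> * max 1 \<eta> / 2 * real l < (2 * \<eta> + \<eta>\<^sup>2) * real l" using l by (intro mult_strict_right_mono) auto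
      then show "real l + 2 * \<theta> < (1 + \<eta>)\<^sup>2 * real l"
        by (simp add: \<theta>_def power2_eq_square algebra_simps)
    qed
    also have "\<dots> = (1 + \<eta>) * sqrt (real l)" using eta by (simp add: real_sqrt_mult)
    finally show ?thesis by simp
  qed
  have "row_sample_prob N m ?E2 \<le> pf.Pr (\<lambda>J. \<not> good_sample p \<theta> J)"
    unfolding row_sample_prob_eq using E2 by (intro pf.Pr_mono) blast
  then show "row_sample_prob N m ?E2 < \<epsilon>" using prob by linarith
qed

theorem theorem2p7:
  shows "\<exists>c1::real. c1 > 0 \<and>
    (\<forall>(N::nat) (k::nat) (\<omega>::nat \<Rightarrow> nat) (m::nat) (l::nat) (\<eta>::real) (\<epsilon>::real)
       (U::nat \<Rightarrow> nat \<Rightarrow> real) (S::nat \<Rightarrow> nat \<Rightarrow> real) (V::nat \<Rightarrow> nat \<Rightarrow> real).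
      N \<ge> 1 \<and> k \<ge> 1 \<and> inj_on \<omega> {1..k} \<and> \<omega> ` {1..k} \<subseteq> {1..N} \<and>
      \<eta> > 0 \<and> \<epsilon> > 0 \<and> l \<ge> 1 \<and>
      real m / pi\<^sup>2 \<ge> real l \<and>
      real l \<ge> c1 / \<eta>\<^sup>2 * real k * (ln (real m / \<epsilon>)) ^ 3 \<and>
      is_svd_of_Dinv m U S V
      \<longrightarrow>
        row_sample_prob N m (\<lambda>J. sigma_min l k (VlT_F m V (harmonic_frame N \<omega>) J)
                                     \<le> (1 - \<eta>) * sqrt (real l)) < \<epsilon> \<and>
        ((\<not> (\<exists>s\<in>{1..k}. \<forall>j\<in>{1..N}. harmonic_frame N \<omega> j s = 1)) \<longrightarrow>
         row_sample_prob N m (\<lambda>J. sigma_max l k (VlT_F m V (harmonic_frame N \<omega>) J)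
                                     \<ge> (1 + \<eta>) * sqrt (real l)) < \<epsilon>))"
proof (rule exI[of _ 80000000], intro conjI[of "(80000000::real) > 0"] allI impI)
  fix N k m l :: nat and \<omega> :: "nat \<Rightarrow> nat" and \<eta> \<epsilon> :: real and U S V :: "nat \<Rightarrow> nat \<Rightarrow> real"
  assume a: "N \<ge> 1 \<and> k \<ge> 1 \<and> inj_on \<omega> {1..k} \<and> \<omega> ` {1..k} \<subseteq> {1..N} \<and>
      \<eta> > 0 \<and> \<epsilon> > 0 \<and> l \<ge> 1 \<and>
      real m / pi\<^sup>2 \<ge> real l \<and>
      real l \<ge> 80000000 / \<eta>\<^sup>2 * real k * (ln (real m / \<epsilon>)) ^ 3 \<and>
      is_svd_of_Dinv m U S V"
  show "row_sample_prob N m (\<lambda>J. sigma_min l k (VlT_F m V (harmonic_frame N \<omega>) J)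
                                     \<le> (1 - \<eta>) * sqrt (real l)) < \<epsilon> \<and>
        ((\<not> (\<exists>s\<in>{1..k}. \<forall>j\<in>{1..N}. harmonic_frame N \<omega> j s = 1)) \<longrightarrow>
         row_sample_prob N m (\<lambda>J. sigma_max l k (VlT_F m V (harmonic_frame N \<omega>) J)
                                     \<ge> (1 + \<eta>) * sqrt (real l)) < \<epsilon>)"
  \<comment> \<open>For \<open>\<epsilon> \<le> 1\<close> one has
    \<open>m / \<epsilon> \<ge> m \<ge> 9\<close>, which keeps the logarithm above 1; a larger
    \<open>\<epsilon>\<close> exceeds every probability.\<close>
  proof (cases "\<epsilon> \<le> 1")
    case True
    then show ?thesis using a harmonic_frame_bounds[of N k \<omega> \<eta> \<epsilon> l m U S V] by blast
  next
    case False
    then show ?thesis using row_sample_prob_le_1 by (meson le_less_trans not_le)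
  qed
qed simp

end
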